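(* Let $n\ge 5$ and let $X=\mathbf{P}^2\times\mathbf{P}^{n-1}$ (over $\mathbf{C}$) embedded with the linear system $\mathcal{O}(1,2)$. Then the $(n+1)$-secant order satisfies $d_{n+1}(X)=1$ unless $X$ is $(n+1)$-weakly defective.
   Context: Let $W\subset\mathbf{P}^m$ be a projective variety. $\sigma_k(W)$ is the Zariski closure of the union of the linear spans $\langle x_1,\dots,x_k\rangle$ with $x_i\in W$. The abstract secant variety $\sigma^k(W)$ is the Zariski closure of the incidence variety $\{(p,x_1,\dots,x_k)\in\mathbf{P}^m\times \mathrm{Sym}^kW\mid p\in\langle x_1,\dots,x_k\rangle,\ x_1,\dots,x_k\text{ linearly independent}\}$; it projects onto $\sigma_k(W)$. The $k$-secant order $d_k(W)$ is the number of irreducible components of the general fiber of the projection $\sigma^k(W)\to\sigma_k(W)$ (so it is the degree of this map when $\dim\sigma_k(W)=\dim\sigma^k(W)$). $W$ is called $k$-weakly defective if the general hyperplane which is tangent to $W$ at $k$ general points is tangent to $W$ along a variety of positive dimension. *)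

theory Defs
  imports "HOL-Analysis.Analysis" "HOL-Library.Uprod"
begin

text \<open>
  Conventions.  Varieties are over the complex numbers, points are closed points, and
  \<open>'m proj\<close> is the projective space of lines in \<open>complex ^ 'm\<close>, so its dimension is
  \<open>CARD('m) - 1\<close>.  Since the ground field is infinite, polynomials are identified with the
  functions they define, and (multi)homogeneous polynomials with the polynomial functions
  satisfying the corresponding scaling identities.
\<close>

section \<open>General position and irreducibility in a topological space\<close>

text \<open>
  The general point of \<open>T\<close> satisfies \<open>P\<close>.  Nonemptiness is required so that nothing is asserted
  vacuously about the general member of an empty family.
\<close>

definition generally :: "'a topology \<Rightarrow> ('a \<Rightarrow> bool) \<Rightarrow> bool" where
  "generally T P \<longleftrightarrow>
     (\<exists>U. openin T U \<and> U \<noteq> {} \<and> T closure_of U = topspace T \<and> (\<forall>x\<in>U. P x))"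

definition irreducible_top :: "'a topology \<Rightarrow> bool" where
  "irreducible_top T \<longleftrightarrow> topspace T \<noteq> {} \<and>
     (\<forall>C D. closedin T C \<and> closedin T D \<and> C \<union> D = topspace T \<longrightarrow>
        C = topspace T \<or> D = topspace T)"

definition irreducible_in :: "'a topology \<Rightarrow> 'a set \<Rightarrow> bool" where
  "irreducible_in T Z \<longleftrightarrow> Z \<subseteq> topspace T \<and> irreducible_top (subtopology T Z)"

definition irreducible_components :: "'a topology \<Rightarrow> 'a set set" where
  "irreducible_components T =
     {Z. irreducible_in T Z \<and> (\<forall>Z'. irreducible_in T Z' \<and> Z \<subseteq> Z' \<longrightarrow> Z' = Z)}"

text \<open>Krull dimension; the empty space gets dimension \<open>0\<close>.\<close>

definition krull_dim :: "'a topology \<Rightarrow> enat" where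
  "krull_dim T =
     (SUP Zs \<in> {Zs. Zs \<noteq> [] \<and> sorted_wrt (\<subset>) Zs \<and>
                    (\<forall>Z\<in>set Zs. closedin T Z \<and> irreducible_in T Z)}.
        enat (length Zs - 1))"

definition quotient_topology :: "'a topology \<Rightarrow> ('a \<Rightarrow> 'b) \<Rightarrow> 'b topology" where
  "quotient_topology T q =
     topology (\<lambda>U. U \<subseteq> q ` topspace T \<and> openin T {x \<in> topspace T. q x \<in> U})"

lemma openin_quotient_topology:
  "openin (quotient_topology T q) U \<longleftrightarrow>
     U \<subseteq> q ` topspace T \<and> openin T {x \<in> topspace T. q x \<in> U}"
proof -
  have "istopology (\<lambda>U. U \<subseteq> q ` topspace T \<and> openin T {x \<in> topspace T. q x \<in> U})"
  proof (unfold istopology_def, intro conjI allI impI)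
    fix S S' assume a: "S \<subseteq> q ` topspace T \<and> openin T {x \<in> topspace T. q x \<in> S}"
      and b: "S' \<subseteq> q ` topspace T \<and> openin T {x \<in> topspace T. q x \<in> S'}"
    have "{x \<in> topspace T. q x \<in> S \<inter> S'} =
        {x \<in> topspace T. q x \<in> S} \<inter> {x \<in> topspace T. q x \<in> S'}" by auto
    with a b show "openin T {x \<in> topspace T. q x \<in> S \<inter> S'}" by auto
    from a show "S \<inter> S' \<subseteq> q ` topspace T" by auto
  next
    fix K assume a: "\<forall>S\<in>K. S \<subseteq> q ` topspace T \<and> openin T {x \<in> topspace T. q x \<in> S}"
    then show "\<Union>K \<subseteq> q ` topspace T" by auto
    have "{x \<in> topspace T. q x \<in> \<Union>K} = (\<Union>S\<in>K. {x \<in> topspace T. q x \<in> S})" by auto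
    with a show "openin T {x \<in> topspace T. q x \<in> \<Union>K}" by auto
  qed
  then show ?thesis by (simp add: quotient_topology_def)
qed

section \<open>Projective space\<close>

typedef ('m::finite) proj = "{L :: (complex ^ 'm) set. vec.subspace L \<and> vec.dim L = 1}"
  morphisms line_of Abs_proj
proof -
  have "vec.dim {axis undefined 1 :: complex ^ 'm} = 1"
    by (subst vec.dim_eq_card_independent) (auto simp: axis_eq_0_iff)
  then show ?thesis
    by (intro exI[of _ "vec.span {axis undefined 1}"]) (simp add: vec.subspace_span)
qed

definition hcoords :: "'m::finite proj \<Rightarrow> (complex ^ 'm) set" where
  "hcoords x = line_of x - {0}"

text \<open>The polynomial expressions in a given set of coordinate functions.\<close>

inductive_set polyfuns :: "('v \<Rightarrow> complex) set \<Rightarrow> ('v \<Rightarrow> complex) set"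
  for C :: "('v \<Rightarrow> complex) set" where
  const: "(\<lambda>_. c) \<in> polyfuns C"
| coord: "f \<in> C \<Longrightarrow> f \<in> polyfuns C"
| add: "f \<in> polyfuns C \<Longrightarrow> g \<in> polyfuns C \<Longrightarrow> (\<lambda>v. f v + g v) \<in> polyfuns C"
| mult: "f \<in> polyfuns C \<Longrightarrow> g \<in> polyfuns C \<Longrightarrow> (\<lambda>v. f v * g v) \<in> polyfuns C"

definition homog_polys :: "(complex ^ 'm \<Rightarrow> complex) set" where
  "homog_polys = {F \<in> polyfuns (range (\<lambda>j v. v $ j)). \<exists>d. \<forall>c v. F (c *s v) = c ^ d * F v}"

text \<open>
  The sets where one homogeneous polynomial does not vanish are closed under finite
  intersections (multiply the polynomials), hence a basis of the Zariski topology.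
\<close>

definition zariski :: "'m::finite proj topology" where
  "zariski = topology_generated_by {{x. \<forall>v\<in>hcoords x. F v \<noteq> 0} | F. F \<in> homog_polys}"

text \<open>
  The Zariski topology on the product of \<open>k\<close> copies of projective space, whose points are
  the lists of length \<open>k\<close>, given by the polynomials that are homogeneous in each of the \<open>k\<close>
  vectors separately (this is finer than the product topology).
\<close>

definition multihomog_polys :: "nat \<Rightarrow> ((complex ^ 'm) list \<Rightarrow> complex) set" where
  "multihomog_polys k =
     {F \<in> polyfuns {\<lambda>vs. (vs ! i) $ j | i j. i < k}.
        \<forall>i<k. \<exists>d. \<forall>c vs. length vs = k \<longrightarrow> F (vs[i := c *s (vs ! i)]) = c ^ d * F vs}"

definition hcoords_list :: "'m::finite proj list \<Rightarrow> (complex ^ 'm) list set" where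
  "hcoords_list xs = {vs. list_all2 (\<lambda>v x. v \<in> hcoords x) vs xs}"

definition multi_zariski :: "nat \<Rightarrow> 'm::finite proj list topology" where
  "multi_zariski k = topology_generated_by
     {{xs. length xs = k \<and> (\<forall>vs\<in>hcoords_list xs. F vs \<noteq> 0)} | F. F \<in> multihomog_polys k}"

section \<open>Secant varieties and the secant order\<close>

definition proj_span :: "'m::finite proj set \<Rightarrow> 'm proj set" where
  "proj_span S = {p. line_of p \<subseteq> vec.span (\<Union>x\<in>S. line_of x)}"

definition lin_indep_pts :: "'m::finite proj list \<Rightarrow> bool" where
  "lin_indep_pts xs \<longleftrightarrow>
     (\<exists>vs\<in>hcoords_list xs. distinct vs \<and> vec.independent (set vs))"

definition secant_variety :: "nat \<Rightarrow> 'm::finite proj set \<Rightarrow> 'm proj set" where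
  "secant_variety k W =
     zariski closure_of (\<Union>xs\<in>{xs. length xs = k \<and> set xs \<subseteq> W}. proj_span (set xs))"

text \<open>
  The product of the ambient projective space with the \<open>k\<close>-fold symmetric product of \<open>W\<close>, as a
  quotient of its product with the \<open>k\<close>-fold power of \<open>W\<close>.  Points of the symmetric product
  are multisets of size \<open>k\<close>; in a list of length \<open>Suc k\<close> the head is the ambient point.
\<close>

definition proj_times_Sym ::
    "nat \<Rightarrow> 'm::finite proj set \<Rightarrow> ('m proj \<times> 'm proj multiset) topology" where
  "proj_times_Sym k W =
     quotient_topology
       (subtopology (multi_zariski (Suc k)) {p # xs | p xs. length xs = k \<and> set xs \<subseteq> W})
       (\<lambda>ys. (hd ys, mset (tl ys)))"

definition abstract_secant_variety ::
    "nat \<Rightarrow> 'm::finite proj set \<Rightarrow> ('m proj \<times> 'm proj multiset) set" where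
  "abstract_secant_variety k W =
     proj_times_Sym k W closure_of
       {(p, mset xs) | p xs. length xs = k \<and> set xs \<subseteq> W \<and>
                             p \<in> proj_span (set xs) \<and> lin_indep_pts xs}"

definition secant_fiber ::
    "nat \<Rightarrow> 'm::finite proj set \<Rightarrow> 'm proj \<Rightarrow> ('m proj \<times> 'm proj multiset) set" where
  "secant_fiber k W p = {z \<in> abstract_secant_variety k W. fst z = p}"

definition secant_order :: "nat \<Rightarrow> 'm::finite proj set \<Rightarrow> nat" where
  "secant_order k W =
     (THE d. generally (subtopology zariski (secant_variety k W))
        (\<lambda>p. let Cs = irreducible_components
                        (subtopology (proj_times_Sym k W) (secant_fiber k W p))
             in finite Cs \<and> card Cs = d))"

section \<open>Tangent hyperplanes and weak defectivity\<close>

definition homog_ideal :: "'m::finite proj set \<Rightarrow> (complex ^ 'm \<Rightarrow> complex) set" where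
  "homog_ideal W = {F \<in> homog_polys. \<forall>x\<in>W. \<forall>v\<in>hcoords x. F v = 0}"

text \<open>
  The affine cone over the embedded projective tangent space: the common kernel of the
  differentials at \<open>x\<close> of the equations of \<open>W\<close>.
\<close>

definition tangent_cone_at :: "'m::finite proj set \<Rightarrow> 'm proj \<Rightarrow> (complex ^ 'm) set" where
  "tangent_cone_at W x =
     {w. \<forall>F\<in>homog_ideal W. \<forall>v\<in>hcoords x.
           ((\<lambda>t. F (v + t *s w)) has_field_derivative 0) (at (0::complex))}"

text \<open>
  Hyperplanes are points of the dual projective space, which is identified with \<open>'m proj\<close>
  by means of the coordinates.
\<close>

definition hyperplane_cone :: "'m::finite proj \<Rightarrow> (complex ^ 'm) set" where
  "hyperplane_cone h = {w. \<forall>a\<in>hcoords h. (\<Sum>j\<in>UNIV. a $ j * w $ j) = 0}"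

definition tangent_at :: "'m::finite proj set \<Rightarrow> 'm proj \<Rightarrow> 'm proj \<Rightarrow> bool" where
  "tangent_at W h x \<longleftrightarrow> x \<in> W \<and> tangent_cone_at W x \<subseteq> hyperplane_cone h"

definition weakly_defective :: "nat \<Rightarrow> 'm::finite proj set \<Rightarrow> bool" where
  "weakly_defective k W \<longleftrightarrow>
     generally (subtopology (multi_zariski k) {xs. length xs = k \<and> set xs \<subseteq> W})
       (\<lambda>xs. generally (subtopology zariski {h. \<forall>x\<in>set xs. tangent_at W h x})
          (\<lambda>h. \<exists>Z\<subseteq>W. closedin zariski Z \<and> irreducible_in zariski Z \<and>
                     krull_dim (subtopology zariski Z) > 0 \<and> (\<forall>z\<in>Z. tangent_at W h z)))"

section \<open>The Segre-Veronese embedding of bidegree \<open>(1,2)\<close>\<close>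

instance uprod :: (finite) finite
  by standard simp

lift_definition uprod_mult :: "('n \<Rightarrow> complex) \<Rightarrow> 'n uprod \<Rightarrow> complex" is
  "\<lambda>f (j, k). f j * f k"
  by (auto simp: eq_upair_def)

lemma uprod_mult_Upair [simp]: "uprod_mult f (Upair j k) = f j * f k"
  by transfer simp

text \<open>
  The monomials \<open>a\<^sub>i v\<^sub>j v\<^sub>k\<close>, one for each \<open>i\<close> and each unordered pair \<open>{j, k}\<close>, form a basis of
  the sections of \<open>O(1,2)\<close>; so this is the embedding by the complete linear system.
\<close>

definition segre_veronese_vec :: "complex ^ 'l \<Rightarrow> complex ^ 'n \<Rightarrow> complex ^ ('l \<times> 'n uprod)" where
  "segre_veronese_vec a v = (\<chi> iu. a $ fst iu * uprod_mult (($) v) (snd iu))"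

lemma segre_veronese_vec_nth [simp]:
  "segre_veronese_vec a v $ (i, Upair j k) = a $ i * (v $ j * v $ k)"
  by (simp add: segre_veronese_vec_def)

definition segre_veronese :: "('l::finite \<times> 'n::finite uprod) proj set" where
  "segre_veronese = {x. \<exists>a v. a \<noteq> 0 \<and> v \<noteq> 0 \<and> segre_veronese_vec a v \<in> hcoords x}"

end

theory Submission
  imports Defs "HOL-Computational_Algebra.Polynomial"
    "HOL-Computational_Algebra.Fundamental_Theorem_Algebra"
begin

text \<open>
  The general tensor \<open>\<Sum>\<^sub>i a\<^sub>i \<otimes> v\<^sub>i \<otimes> v\<^sub>i\<close> with \<open>n + 1\<close> summands has no other such decomposition.
  Indeed the kernel \<open>K\<close> of Strassen's skew-symmetric matrix of the tensor consists of the matrices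
  \<open>M\<close> for which every \<open>M v\<^sub>i\<close> is proportional to \<open>a\<^sub>i\<close>; so in a second decomposition
  \<open>(a'\<^sub>j, v'\<^sub>j)\<close> all the vectors \<open>M v'\<^sub>j\<close> with \<open>M \<in> K\<close> are proportional to \<open>a'\<^sub>j\<close>.  If \<open>v'\<^sub>j\<close> is not
  one of the points \<open>v\<^sub>i\<close>, this yields a conic through all the \<open>a\<^sub>i\<close>, and since \<open>n + 1 \<ge> 6\<close>
  there is none for general \<open>a\<^sub>i\<close>.

  Consequently the product of the values of a linear form at the summands is constant on the fibres
  of the parametrization of the secant variety, hence (in characteristic zero) a rational function
  of the tensor.  This gives relations between a tensor and the points of a decomposition that are
  homogeneous and symmetric in the points, persist on the closure of the incidence variety,
  and determine the multiset of points over a general tensor.  Hence the whole fibre of the closure,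
  not only that of the incidence variety, is a single point; it is nonempty over a dense open set by
  Chevalley's theorem.
\<close>

section \<open>Extending homomorphisms to the complex numbers\<close>

text \<open>Where the conic comes from: let c be the one linear relation among the v_i, and write a
  vector of the second decomposition as v' = sum s_i v_i, with partner a'. The matrices in K are
  given by M v_i = m_i a_i with sum c_i m_i a_i = 0, so the alignment of M v' with a' only involves
  the ratios s_i / c_i. If p and q are linear forms cutting out the point a', then multiplying
  p(a_i) and q(a_i) by these ratios gives the values at a_i of two linear forms \<mu> and \<nu>, and
  p \<nu> - q \<mu> vanishes at every a_i. Its being identically zero makes all ratios but one
  equal, and subtracting a multiple of c leaves a multiple of a single v_i. The obstacle afterwards:
  a fibre of the closure may a priori contain multisets whose span misses the given point, and
  uniqueness of decompositions says nothing about them. Only closed conditions carry over. For a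
  point sum \<tau>_i x_i the rational function has the value (prod \<tau>_i)(prod l(x_i)); the
  unknown prod \<tau>_i is eliminated by comparing two forms l and l'.\<close>

definition is_subring :: "'a::idom set \<Rightarrow> bool" where
  "is_subring A \<longleftrightarrow> 0 \<in> A \<and> 1 \<in> A \<and>
     (\<forall>x\<in>A. - x \<in> A) \<and> (\<forall>x\<in>A. \<forall>y\<in>A. x + y \<in> A \<and> x * y \<in> A)"

text \<open>Only the values on \<open>A\<close> are constrained, so restriction to a subring leaves
  the function unchanged. These are ring homomorphisms; that complex constants are fixed is deduced
  later from agreement on a subring containing them.\<close>

definition hom_on :: "'a::idom set \<Rightarrow> ('a \<Rightarrow> complex) \<Rightarrow> bool" where
  "hom_on A e \<longleftrightarrow> e 0 = 0 \<and> e 1 = 1 \<and>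
     (\<forall>x\<in>A. \<forall>y\<in>A. e (x + y) = e x + e y \<and> e (x * y) = e x * e y)"

definition polys_over :: "'a::idom set \<Rightarrow> 'a poly set" where
  "polys_over A = {F. \<forall>i. coeff F i \<in> A}"

definition adjoin :: "'a::idom set \<Rightarrow> 'a \<Rightarrow> 'a set" where
  "adjoin A b = (\<lambda>F. poly F b) ` polys_over A"

fun adjoin_list :: "'a::idom set \<Rightarrow> 'a list \<Rightarrow> 'a set" where
  "adjoin_list A [] = A"
| "adjoin_list A (b # bs) = adjoin_list (adjoin A b) bs"

lemma subring_sum:
  assumes "is_subring A" "\<And>i. i \<in> I \<Longrightarrow> f i \<in> A"
  shows "sum f I \<in> A"
  using assms(2)
  by (induction I rule: infinite_finite_induct) (use assms(1) in \<open>auto simp: is_subring_def\<close>)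

lemma subring_power: "is_subring A \<Longrightarrow> x \<in> A \<Longrightarrow> x ^ n \<in> A"
  by (induction n) (auto simp: is_subring_def)

lemma hom_on_sum:
  assumes "is_subring A" "hom_on A e" "\<And>i. i \<in> I \<Longrightarrow> f i \<in> A"
  shows "e (sum f I) = (\<Sum>i\<in>I. e (f i))"
  using assms(3)
proof (induction I rule: infinite_finite_induct)
  case (insert x F)
  then show ?case
    using assms(1,2) subring_sum[OF assms(1), of F f] by (auto simp: hom_on_def)
qed (use assms(2) in \<open>auto simp: hom_on_def\<close>)

lemma hom_on_of_nat:
  assumes "is_subring A" "hom_on A e" "x \<in> A"
  shows "of_nat n * x \<in> A \<and> e (of_nat n * x) = of_nat n * e x"
proof (induction n)
  case 0
  then show ?case using assms by (simp add: is_subring_def hom_on_def)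
next
  case (Suc n)
  have "of_nat (Suc n) * x = x + of_nat n * x" by (simp add: algebra_simps)
  with Suc assms show ?case by (auto simp: is_subring_def hom_on_def algebra_simps)
qed

lemma complex_poly_root:
  fixes p :: "complex poly"
  assumes "degree p \<noteq> 0"
  obtains c where "poly p c = 0"
  using fundamental_theorem_of_algebra[of p] constant_degree[of p] assms by auto

lemma exists_nonroot:
  fixes p :: "complex poly"
  assumes "p \<noteq> 0" "finite S"
  obtains c where "poly p c \<noteq> 0" "c \<notin> S"
proof -
  have "finite ({c. poly p c = 0} \<union> S)" using assms poly_roots_finite by blast
  then obtain c where "c \<notin> {c. poly p c = 0} \<union> S"
    using ex_new_if_finite infinite_UNIV_char_0 by blast
  with that show thesis by auto
qed

context
  fixes A :: "'a::idom set"
  assumes A: "is_subring A"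
begin

lemma polys_over_const: "x \<in> A \<Longrightarrow> [:x:] \<in> polys_over A"
  using A by (auto simp: polys_over_def coeff_pCons is_subring_def split: nat.splits)

lemma polys_over_0: "0 \<in> polys_over A"
  using A by (auto simp: polys_over_def is_subring_def)

lemma polys_over_1: "1 \<in> polys_over A"
  using polys_over_const[of 1] A by (simp add: is_subring_def one_pCons)

lemma polys_over_uminus: "F \<in> polys_over A \<Longrightarrow> - F \<in> polys_over A"
  using A by (auto simp: polys_over_def is_subring_def)

lemma polys_over_add: "F \<in> polys_over A \<Longrightarrow> G \<in> polys_over A \<Longrightarrow> F + G \<in> polys_over A"
  using A by (auto simp: polys_over_def is_subring_def)

lemma polys_over_diff: "F \<in> polys_over A \<Longrightarrow> G \<in> polys_over A \<Longrightarrow> F - G \<in> polys_over A"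
  using polys_over_add[OF _ polys_over_uminus] by force

lemma polys_over_mult: "F \<in> polys_over A \<Longrightarrow> G \<in> polys_over A \<Longrightarrow> F * G \<in> polys_over A"
  using A by (auto simp: polys_over_def coeff_mult is_subring_def intro!: subring_sum)

lemma polys_over_smult: "x \<in> A \<Longrightarrow> F \<in> polys_over A \<Longrightarrow> smult x F \<in> polys_over A"
  using A by (auto simp: polys_over_def is_subring_def)

lemma polys_over_monom: "x \<in> A \<Longrightarrow> monom x n \<in> polys_over A"
  using A by (auto simp: polys_over_def is_subring_def)

lemma polys_over_pderiv: "F \<in> polys_over A \<Longrightarrow> pderiv F \<in> polys_over A"
proof -
  have of_nat: "of_nat n * x \<in> A" if "x \<in> A" for x n
    by (induction n) (use A that in \<open>auto simp: is_subring_def algebra_simps\<close>)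
  assume F: "F \<in> polys_over A"
  then show "pderiv F \<in> polys_over A"
    using of_nat by (simp add: polys_over_def coeff_pderiv del: of_nat_Suc)
qed

lemma polys_over_lead_coeff: "F \<in> polys_over A \<Longrightarrow> lead_coeff F \<in> A"
  by (auto simp: polys_over_def)

lemmas polys_over_intros = polys_over_const polys_over_0 polys_over_1 polys_over_uminus
  polys_over_add polys_over_diff polys_over_mult polys_over_smult polys_over_monom
  polys_over_pderiv polys_over_lead_coeff

lemma adjoin_subset: "A \<subseteq> adjoin A b"
proof
  fix x assume "x \<in> A"
  then have "poly [:x:] b \<in> adjoin A b"
    unfolding adjoin_def by (intro imageI polys_over_intros)
  then show "x \<in> adjoin A b" by simp
qed

lemma adjoin_self: "b \<in> adjoin A b"
proof -
  have "poly (monom 1 1) b \<in> adjoin A b"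
    unfolding adjoin_def using A by (intro imageI polys_over_intros) (auto simp: is_subring_def)
  then show ?thesis by (simp add: poly_monom)
qed

lemma is_subring_adjoin: "is_subring (adjoin A b)"
  unfolding is_subring_def
proof (intro conjI ballI)
  show "0 \<in> adjoin A b" "1 \<in> adjoin A b"
    using A adjoin_subset by (auto simp: is_subring_def)
next
  fix x assume "x \<in> adjoin A b"
  then obtain F where "F \<in> polys_over A" "x = poly F b" by (auto simp: adjoin_def)
  then show "- x \<in> adjoin A b"
    unfolding adjoin_def by (intro image_eqI[of _ _ "- F"]) (auto intro: polys_over_intros)
next
  fix x y assume "x \<in> adjoin A b" "y \<in> adjoin A b"
  then obtain F G where F: "F \<in> polys_over A" "x = poly F b" "G \<in> polys_over A" "y = poly G b"
    by (auto simp: adjoin_def)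
  then show "x + y \<in> adjoin A b"
    unfolding adjoin_def by (intro image_eqI[of _ _ "F + G"]) (auto intro: polys_over_intros)
  from F show "x * y \<in> adjoin A b"
    unfolding adjoin_def by (intro image_eqI[of _ _ "F * G"]) (auto intro: polys_over_intros)
qed

lemma coeff_map_hom: "hom_on A e \<Longrightarrow> coeff (map_poly e F) i = e (coeff F i)"
  by (simp add: coeff_map_poly hom_on_def)

lemma map_hom_add:
  assumes "hom_on A e" "F \<in> polys_over A" "G \<in> polys_over A"
  shows "map_poly e (F + G) = map_poly e F + map_poly e G"
  using assms by (intro poly_eqI) (auto simp: coeff_map_hom hom_on_def polys_over_def)

lemma map_hom_mult:
  assumes "hom_on A e" "F \<in> polys_over A" "G \<in> polys_over A"
  shows "map_poly e (F * G) = map_poly e F * map_poly e G"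
proof (rule poly_eqI)
  fix n
  have "e (\<Sum>i\<le>n. coeff F i * coeff G (n - i)) = (\<Sum>i\<le>n. e (coeff F i * coeff G (n - i)))"
    by (rule hom_on_sum[OF A assms(1)]) (use assms A in \<open>auto simp: polys_over_def is_subring_def\<close>)
  also have "\<dots> = (\<Sum>i\<le>n. e (coeff F i) * e (coeff G (n - i)))"
    using assms by (auto simp: hom_on_def polys_over_def)
  finally show "coeff (map_poly e (F * G)) n = coeff (map_poly e F * map_poly e G) n"
    using assms by (simp add: coeff_mult coeff_map_hom)
qed

lemma map_hom_smult:
  assumes "hom_on A e" "F \<in> polys_over A" "x \<in> A"
  shows "map_poly e (smult x F) = smult (e x) (map_poly e F)"
  using assms by (intro poly_eqI) (auto simp: coeff_map_hom hom_on_def polys_over_def)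

lemma map_hom_pderiv:
  assumes "hom_on A e" "F \<in> polys_over A"
  shows "map_poly e (pderiv F) = pderiv (map_poly e F)"
  using assms hom_on_of_nat[OF A assms(1)]
  by (intro poly_eqI) (simp add: coeff_map_hom coeff_pderiv polys_over_def del: of_nat_Suc)

lemma map_hom_const: "hom_on A e \<Longrightarrow> map_poly e [:x:] = [:e x:]"
  by (intro poly_eqI) (auto simp: coeff_map_hom coeff_pCons hom_on_def split: nat.splits)

text \<open>\<open>A\<close> is a domain and not a field, so the division algorithm costs one factor
  \<open>lead_coeff f\<close> for every step.\<close>

lemma pseudo_division:
  assumes f: "f \<in> polys_over A" "f \<noteq> 0" and F: "F \<in> polys_over A"
  shows "\<exists>q r s. q \<in> polys_over A \<and> r \<in> polys_over A \<and>
           smult (lead_coeff f ^ s) F = q * f + r \<and> (r = 0 \<or> degree r < degree f)"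
  using F
proof (induction "degree F" arbitrary: F rule: less_induct)
  case less
  show ?case
  proof (cases "F = 0 \<or> degree F < degree f")
    case True
    with less.prems show ?thesis
      by (intro exI[of _ 0] exI[of _ F]) (auto intro: polys_over_intros)
  next
    case False
    define a where "a = lead_coeff f"
    define m where "m = monom (lead_coeff F) (degree F - degree f)"
    define G where "G = smult a F - m * f"
    have aA: "a \<in> A" using f by (simp add: a_def polys_over_lead_coeff)
    have m: "m \<in> polys_over A"
      using less.prems by (auto simp: m_def intro: polys_over_intros)
    have G: "G \<in> polys_over A" unfolding G_def using m f less.prems aA
      by (intro polys_over_intros)
    have dm: "degree (m * f) = degree F"
      using False f by (auto simp: m_def degree_mult_eq degree_monom_eq)
    have "degree G \<le> degree F"
      unfolding G_def by (rule degree_diff_le) (auto simp: dm)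
    moreover have "coeff G (degree F) = 0"
      using lead_coeff_mult[of m f] False dm
      by (simp add: G_def a_def m_def lead_coeff_monom degree_monom_eq mult.commute)
    ultimately have dG: "G = 0 \<or> degree G < degree F"
      by (metis le_neq_implies_less leading_coeff_0_iff)
    show ?thesis
    proof (cases "G = 0")
      case True
      then have "smult (lead_coeff f ^ 1) F = m * f + 0" by (simp add: G_def a_def)
      with m show ?thesis using polys_over_0 by blast
    next
      case False
      with dG have "degree G < degree F" by simp
      from less.hyps[OF this G] obtain q r s where qr: "q \<in> polys_over A" "r \<in> polys_over A"
        "smult (lead_coeff f ^ s) G = q * f + r" "r = 0 \<or> degree r < degree f" by blast
      have "smult (lead_coeff f ^ Suc s) F = smult (a ^ s) G + smult (a ^ s) m * f"
        by (simp add: G_def a_def smult_diff_right mult.commute)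
      also have "\<dots> = (q + smult (a ^ s) m) * f + r"
        using qr(3) by (simp add: a_def algebra_simps)
      finally have "smult (lead_coeff f ^ Suc s) F = (q + smult (a ^ s) m) * f + r" .
      moreover have "q + smult (a ^ s) m \<in> polys_over A"
        using qr m aA A by (intro polys_over_intros subring_power)
      ultimately show ?thesis using qr by blast
    qed
  qed
qed

text \<open>\<open>adjoin A b\<close> is A[X] modulo the relations satisfied by \<open>b\<close>;
  substituting \<open>c\<close> factors through this quotient as soon as \<open>c\<close> satisfies
  the images of all these relations.\<close>

lemma extend_hom_to_adjoin:
  assumes e: "hom_on A e"
    and van: "\<And>F. F \<in> polys_over A \<Longrightarrow> poly F b = 0 \<Longrightarrow> poly (map_poly e F) c = 0"
  obtains e' where "hom_on (adjoin A b) e'"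
    "\<And>F. F \<in> polys_over A \<Longrightarrow> e' (poly F b) = poly (map_poly e F) c"
    "\<And>x. x \<in> A \<Longrightarrow> e' x = e x"
proof -
  define e' where "e' x = poly (map_poly e (SOME F. F \<in> polys_over A \<and> poly F b = x)) c" for x
  have e': "e' (poly F b) = poly (map_poly e F) c" if F: "F \<in> polys_over A" for F
  proof -
    define G where "G = (SOME G. G \<in> polys_over A \<and> poly G b = poly F b)"
    have "G \<in> polys_over A \<and> poly G b = poly F b"
      unfolding G_def by (rule someI[of _ F]) (use F in auto)
    then have G: "G \<in> polys_over A" "poly G b = poly F b" by auto
    have "poly (map_poly e (G - F)) c = 0"
      using F G by (intro van) (auto intro: polys_over_intros)
    moreover have "map_poly e G = map_poly e (G - F) + map_poly e F"
      using map_hom_add[OF e, of "G - F" F] F G by (auto intro: polys_over_intros)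
    ultimately show ?thesis by (simp add: e'_def G_def)
  qed
  have c: "e' x = e x" if "x \<in> A" for x
    using e'[of "[:x:]"] that by (simp add: map_hom_const[OF e] polys_over_const)
  have "hom_on (adjoin A b) e'"
    unfolding hom_on_def
  proof (intro conjI ballI)
    show "e' 0 = 0" "e' 1 = 1"
      using c A e by (auto simp: is_subring_def hom_on_def)
  next
    fix x y assume "x \<in> adjoin A b" "y \<in> adjoin A b"
    then obtain F G where F: "F \<in> polys_over A" "x = poly F b" "G \<in> polys_over A" "y = poly G b"
      by (auto simp: adjoin_def)
    then show "e' (x + y) = e' x + e' y"
      using e'[of "F + G"] by (simp add: e' polys_over_add map_hom_add[OF e])
    from F show "e' (x * y) = e' x * e' y"
      using e'[of "F * G"] by (simp add: e' polys_over_mult map_hom_mult[OF e])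
  qed
  from that[OF this e' c] show thesis .
qed

section \<open>Minimal polynomials over a subring and extension of general homomorphisms\<close>

text \<open>Least degree takes the place of monic and irreducible: up to a scalar this is the
  minimal polynomial over the fraction field, with denominators cleared.\<close>

definition min_poly :: "'a \<Rightarrow> 'a poly \<Rightarrow> bool" where
  "min_poly b f \<longleftrightarrow> f \<in> polys_over A \<and> f \<noteq> 0 \<and> poly f b = 0 \<and>
     (\<forall>F\<in>polys_over A. F \<noteq> 0 \<longrightarrow> poly F b = 0 \<longrightarrow> degree f \<le> degree F)"

lemma min_poly_exists:
  assumes "F \<in> polys_over A" "F \<noteq> 0" "poly F b = 0"
  obtains f where "min_poly b f"
proof -
  let ?P = "\<lambda>F. F \<in> polys_over A \<and> F \<noteq> 0 \<and> poly F b = 0"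
  have "?P F" using assms by simp
  from ex_has_least_nat[of ?P, OF this, of degree] show thesis
    using that unfolding min_poly_def by blast
qed

lemma min_poly_degree:
  assumes "min_poly b f"
  shows "degree f \<noteq> 0"
proof
  assume "degree f = 0"
  then obtain c where "f = [:c:]" by (meson degree_eq_zeroE)
  with assms show False by (simp add: min_poly_def)
qed

text \<open>The remainder of the pseudo-division vanishes at \<open>b\<close> too and has smaller
  degree, so it is zero.\<close>

lemma min_poly_pseudo_dvd:
  assumes f: "min_poly b f" and F: "F \<in> polys_over A" "poly F b = 0"
  obtains q s where "q \<in> polys_over A" "smult (lead_coeff f ^ s) F = q * f"
proof -
  from pseudo_division[of f F] f F(1) obtain q r s where qr:
    "q \<in> polys_over A" "r \<in> polys_over A" "smult (lead_coeff f ^ s) F = q * f + r"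
    "r = 0 \<or> degree r < degree f"
    unfolding min_poly_def by blast
  have "poly (smult (lead_coeff f ^ s) F) b = poly (q * f + r) b" using qr(3) by simp
  then have "poly r b = 0" using f F(2) by (simp add: min_poly_def)
  with qr f have "r = 0" unfolding min_poly_def by force
  with qr show thesis by (intro that[of q s]) auto
qed

text \<open>Over the fraction field \<open>f\<close> is irreducible and does not divide
  \<open>H\<close>, so they are coprime, and \<open>r\<close> clears the denominators. Fractions are
  avoided by taking an element \<open>d\<close> of least degree in the ideal generated by
  \<open>H\<close> and \<open>f\<close>.\<close>

lemma min_poly_Bezout:
  assumes f: "min_poly b f" and H: "H \<in> polys_over A" "poly H b \<noteq> 0"
  obtains U V r where "U \<in> polys_over A" "V \<in> polys_over A" "r \<in> A" "r \<noteq> 0"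
    "U * H + V * f = [:r:]"
proof -
  define I where "I = {U * H + V * f | U V. U \<in> polys_over A \<and> V \<in> polys_over A}"
  have fA: "f \<in> polys_over A" "f \<noteq> 0" "poly f b = 0" using f by (auto simp: min_poly_def)
  have sub: "I \<subseteq> polys_over A" unfolding I_def using fA H by (auto intro!: polys_over_intros)
  have "0 * H + 1 * f \<in> I" unfolding I_def using polys_over_0 polys_over_1 by blast
  then have fI: "f \<in> I" by simp
  have "1 * H + 0 * f \<in> I" unfolding I_def using polys_over_0 polys_over_1 by blast
  then have HI: "H \<in> I" by simp
  \<comment> \<open>Remainders of pseudo-divisions within the ideal have this shape.\<close>
  have comb: "smult x F - q * G \<in> I" if FG: "F \<in> I" "G \<in> I" "x \<in> A" "q \<in> polys_over A" for F G x q
  proof -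
    from FG obtain U V U' V' where UV: "U \<in> polys_over A" "V \<in> polys_over A" "F = U * H + V * f"
      "U' \<in> polys_over A" "V' \<in> polys_over A" "G = U' * H + V' * f"
      unfolding I_def by blast
    then have "smult x F - q * G = (smult x U - q * U') * H + (smult x V - q * V') * f"
      by (simp add: algebra_simps smult_add_right)
    moreover have "smult x U - q * U' \<in> polys_over A" "smult x V - q * V' \<in> polys_over A"
      using UV FG by (auto intro!: polys_over_intros)
    ultimately show ?thesis unfolding I_def by blast
  qed
  have "f \<in> I \<and> f \<noteq> 0" using fI fA by simp
  from ex_has_least_nat[of "\<lambda>F. F \<in> I \<and> F \<noteq> 0", OF this, of degree]
  obtain d where d: "d \<in> I" "d \<noteq> 0" "\<And>F. F \<in> I \<Longrightarrow> F \<noteq> 0 \<Longrightarrow> degree d \<le> degree F"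
    by blast
  have dA: "d \<in> polys_over A" "lead_coeff d \<in> A" using d sub polys_over_lead_coeff by auto
  have dvd: "\<exists>q s. q \<in> polys_over A \<and> smult (lead_coeff d ^ s) F = q * d" if F: "F \<in> I" for F
  proof -
    from pseudo_division[OF dA(1) d(2), of F] F sub obtain q r s where qr:
      "q \<in> polys_over A" "smult (lead_coeff d ^ s) F = q * d + r"
      "r = 0 \<or> degree r < degree d" by blast
    have "smult (lead_coeff d ^ s) F - q * d \<in> I"
      using F d dA qr A by (intro comb subring_power)
    with qr(2) have "r \<in> I" by simp
    with d(3) qr(3) have "r = 0" by force
    with qr show ?thesis by auto
  qed
  have "degree d = 0"
  proof (rule ccontr)
    assume nz: "degree d \<noteq> 0"
    obtain q s where qs: "q \<in> polys_over A" "smult (lead_coeff d ^ s) f = q * d"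
      using dvd[OF fI] by blast
    have nzs: "lead_coeff d ^ s \<noteq> 0" for s using d by simp
    have q0: "q \<noteq> 0" using qs(2) nzs[of s] fA by (metis mult_zero_left smult_eq_0_iff)
    have "degree f = degree q + degree d"
      using qs(2) nzs[of s] q0 d(2) by (metis degree_mult_eq degree_smult_eq)
    \<comment> \<open>As \<open>d\<close> is not constant, \<open>q\<close> has smaller degree than
      \<open>f\<close> and cannot vanish at \<open>b\<close>. So \<open>d\<close> vanishes there,
      and with it \<open>H\<close>.\<close>
    with nz q0 f qs(1) have "poly q b \<noteq> 0" by (force simp: min_poly_def)
    moreover have "poly q b * poly d b = 0"
      using arg_cong[OF qs(2), of "\<lambda>p. poly p b"] fA by simp
    ultimately have db: "poly d b = 0" by simp
    obtain q' s' where "smult (lead_coeff d ^ s') H = q' * d"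
      using dvd[OF HI] by blast
    from arg_cong[OF this, of "\<lambda>p. poly p b"] db have "lead_coeff d ^ s' * poly H b = 0" by simp
    with nzs[of s'] H show False by simp
  qed
  then obtain r where r: "d = [:r:]" by (meson degree_eq_zeroE)
  from d(1) obtain U V where "U \<in> polys_over A" "V \<in> polys_over A" "d = U * H + V * f"
    unfolding I_def by blast
  with r d(2) dA show thesis by (intro that[of U V r]) auto
qed

text \<open>Every relation of \<open>b\<close> is a multiple of \<open>f\<close> after
  multiplication by a power of \<open>lead_coeff f\<close>, and \<open>e\<close> does not kill that
  power.\<close>

lemma poly_map_hom_root:
  assumes f: "min_poly b f" and e: "hom_on A e" "e (lead_coeff f) \<noteq> 0"
    and c: "poly (map_poly e f) c = 0" and F: "F \<in> polys_over A" "poly F b = 0"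
  shows "poly (map_poly e F) c = 0"
proof -
  from min_poly_pseudo_dvd[OF f F] obtain q s where
    q: "q \<in> polys_over A" "smult (lead_coeff f ^ s) F = q * f" .
  have fA: "f \<in> polys_over A" using f by (simp add: min_poly_def)
  have "e (lead_coeff f ^ s) = e (lead_coeff f) ^ s"
  proof (induction s)
    case (Suc s)
    then show ?case using e(1) subring_power[OF A polys_over_lead_coeff[OF fA]]
        polys_over_lead_coeff[OF fA] by (simp add: hom_on_def)
  qed (use e in \<open>simp add: hom_on_def\<close>)
  then have "smult (e (lead_coeff f) ^ s) (map_poly e F) = map_poly e q * map_poly e f"
    using map_hom_smult[OF e(1) F(1) subring_power[OF A polys_over_lead_coeff[OF fA]], of s]
      map_hom_mult[OF e(1) q(1) fA] q(2) by simp
  from arg_cong[OF this, of "\<lambda>p. poly p c"] c e(2) show ?thesis by simp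
qed

text \<open>Under \<open>e\<close> and substitution of \<open>c\<close> the Bezout identity becomes
  U(c) H(c) = e r, whose right side is not zero.\<close>

lemma Bezout_hom_nonzero:
  assumes "U * H + V * f = [:r:]" "U \<in> polys_over A" "V \<in> polys_over A" "H \<in> polys_over A"
    "f \<in> polys_over A" "hom_on A e" "e r \<noteq> 0" "poly (map_poly e f) c = 0"
  shows "poly (map_poly e H) c \<noteq> 0"
proof
  assume "poly (map_poly e H) c = 0"
  moreover have "map_poly e U * map_poly e H + map_poly e V * map_poly e f = [:e r:]"
    using assms map_hom_add[of e "U * H" "V * f"]
    by (simp add: map_hom_mult map_hom_const polys_over_intros)
  from arg_cong[OF this, of "\<lambda>p. poly p c"] have
    "poly (map_poly e U) c * poly (map_poly e H) c + poly (map_poly e V) c * poly (map_poly e f) c = e r"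
    by simp
  ultimately show False using assms by simp
qed

lemma degree_map_hom:
  assumes "hom_on A e" "e (lead_coeff f) \<noteq> 0"
  shows "degree (map_poly e f) = degree f"
  using assms by (intro antisym degree_le le_degree) (auto simp: coeff_map_hom coeff_eq_0 hom_on_def)

text \<open>The one-generator case of Chevalley's theorem. If \<open>b\<close> is algebraic, its
  image may be any root of the specialized minimal polynomial, which keeps its positive degree while
  the leading coefficient survives, and the Bezout identity keeps \<open>h\<close> alive. If
  \<open>b\<close> is transcendental, its image is free and only has to avoid the roots of the
  specialized \<open>H\<close>.\<close>

lemma extend_hom_generically:
  assumes "h \<in> adjoin A b" "h \<noteq> 0"
  obtains g where "g \<in> A" "g \<noteq> 0"
    "\<And>e. hom_on A e \<Longrightarrow> e g \<noteq> 0 \<Longrightarrow>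
        \<exists>e'. hom_on (adjoin A b) e' \<and> (\<forall>x\<in>A. e' x = e x) \<and> e' h \<noteq> 0"
proof -
  obtain H where H: "H \<in> polys_over A" "h = poly H b" using assms by (auto simp: adjoin_def)
  show thesis
  proof (cases "\<exists>F\<in>polys_over A. F \<noteq> 0 \<and> poly F b = 0")
    case True
    then obtain f where f: "min_poly b f" using min_poly_exists by blast
    then have fA: "f \<in> polys_over A" by (simp add: min_poly_def)
    obtain U V r where B: "U \<in> polys_over A" "V \<in> polys_over A" "r \<in> A" "r \<noteq> 0"
      "U * H + V * f = [:r:]" using min_poly_Bezout[OF f H(1)] assms(2) H(2) by blast
    show thesis
    proof (rule that[of "lead_coeff f * r"])
      show "lead_coeff f * r \<in> A" "lead_coeff f * r \<noteq> 0"
        using A B polys_over_lead_coeff[OF fA] f by (auto simp: is_subring_def min_poly_def)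
      fix e assume e: "hom_on A e" "e (lead_coeff f * r) \<noteq> 0"
      then have nz: "e (lead_coeff f) \<noteq> 0" "e r \<noteq> 0"
        using B polys_over_lead_coeff[OF fA] by (auto simp: hom_on_def)
      obtain c where c: "poly (map_poly e f) c = 0"
        using complex_poly_root degree_map_hom[OF e(1) nz(1)] min_poly_degree[OF f] by metis
      obtain e' where e': "hom_on (adjoin A b) e'"
        "\<And>F. F \<in> polys_over A \<Longrightarrow> e' (poly F b) = poly (map_poly e F) c"
        "\<And>x. x \<in> A \<Longrightarrow> e' x = e x"
        using extend_hom_to_adjoin[OF e(1) poly_map_hom_root[OF f e(1) nz(1) c]] by blast
      have "e' h \<noteq> 0"
        using e'(2)[OF H(1)] Bezout_hom_nonzero[OF B(5,1,2) H(1) fA e(1) nz(2) c] H(2) by simp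
      with e' show "\<exists>e'. hom_on (adjoin A b) e' \<and> (\<forall>x\<in>A. e' x = e x) \<and> e' h \<noteq> 0" by blast
    qed
  next
    case False
    then have triv: "F = 0" if "F \<in> polys_over A" "poly F b = 0" for F using that by blast
    have "H \<noteq> 0" using assms H by auto
    show thesis
    proof (rule that[of "lead_coeff H"])
      show "lead_coeff H \<in> A" "lead_coeff H \<noteq> 0"
        using \<open>H \<noteq> 0\<close> H polys_over_lead_coeff by auto
      fix e assume e: "hom_on A e" "e (lead_coeff H) \<noteq> 0"
      then have "map_poly e H \<noteq> 0" using coeff_map_hom by (metis coeff_0)
      then obtain c where c: "poly (map_poly e H) c \<noteq> 0" using exists_nonroot[of _ "{}"] by blast
      have "poly (map_poly e F) c = 0" if "F \<in> polys_over A" "poly F b = 0" for F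
        using triv[OF that] by simp
      then obtain e' where e': "hom_on (adjoin A b) e'"
        "\<And>F. F \<in> polys_over A \<Longrightarrow> e' (poly F b) = poly (map_poly e F) c"
        "\<And>x. x \<in> A \<Longrightarrow> e' x = e x"
        using extend_hom_to_adjoin[OF e(1)] by metis
      with c H have "e' h \<noteq> 0" by simp
      with e' show "\<exists>e'. hom_on (adjoin A b) e' \<and> (\<forall>x\<in>A. e' x = e x) \<and> e' h \<noteq> 0" by blast
    qed
  qed
qed

end

lemma subset_adjoin_list: "is_subring A \<Longrightarrow> A \<subseteq> adjoin_list A bs"
proof (induction bs arbitrary: A)
  case (Cons b bs)
  then show ?case using adjoin_subset[of A b] is_subring_adjoin[of A b] by fastforce
qed auto

lemma set_subset_adjoin_list: "is_subring A \<Longrightarrow> set bs \<subseteq> adjoin_list A bs"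
proof (induction bs arbitrary: A)
  case (Cons b bs)
  then show ?case
    using adjoin_self[of A b] is_subring_adjoin[of A b] subset_adjoin_list[of "adjoin A b" bs]
    by fastforce
qed auto

lemma is_subring_adjoin_list: "is_subring A \<Longrightarrow> is_subring (adjoin_list A bs)"
  by (induction bs arbitrary: A) (auto simp: is_subring_adjoin)

lemma extend_hom_list_generically:
  assumes "is_subring A" "h \<in> adjoin_list A bs" "h \<noteq> 0"
  shows "\<exists>g\<in>A. g \<noteq> 0 \<and> (\<forall>e. hom_on A e \<longrightarrow> e g \<noteq> 0 \<longrightarrow>
           (\<exists>e'. hom_on (adjoin_list A bs) e' \<and> (\<forall>x\<in>A. e' x = e x) \<and> e' h \<noteq> 0))"
  using assms
proof (induction bs arbitrary: A)
  case Nil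
  then show ?case by auto
next
  case (Cons b bs)
  from Cons.IH[of "adjoin A b"] Cons.prems is_subring_adjoin obtain h' where h':
    "h' \<in> adjoin A b" "h' \<noteq> 0" "\<And>e. hom_on (adjoin A b) e \<Longrightarrow> e h' \<noteq> 0 \<Longrightarrow>
       \<exists>e'. hom_on (adjoin_list A (b # bs)) e' \<and> (\<forall>x\<in>adjoin A b. e' x = e x) \<and> e' h \<noteq> 0"
    by fastforce
  obtain g where g: "g \<in> A" "g \<noteq> 0"
    "\<And>e. hom_on A e \<Longrightarrow> e g \<noteq> 0 \<Longrightarrow>
        \<exists>e'. hom_on (adjoin A b) e' \<and> (\<forall>x\<in>A. e' x = e x) \<and> e' h' \<noteq> 0"
    using extend_hom_generically[OF Cons.prems(1) h'(1,2)] by blast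
  show ?case
  proof (intro bexI[of _ g] conjI allI impI)
    fix e assume "hom_on A e" "e g \<noteq> 0"
    from g(3)[OF this] obtain e1 where e1: "hom_on (adjoin A b) e1" "\<forall>x\<in>A. e1 x = e x" "e1 h' \<noteq> 0"
      by blast
    from h'(3)[OF e1(1,3)] e1(2) adjoin_subset[OF Cons.prems(1), of b]
    show "\<exists>e'. hom_on (adjoin_list A (b # bs)) e' \<and> (\<forall>x\<in>A. e' x = e x) \<and> e' h \<noteq> 0"
      by (metis subsetD)
  qed (use g in auto)
qed

lemma two_simple_roots:
  fixes p :: "complex poly"
  assumes "degree p \<ge> 2" and simple: "\<And>c. poly p c = 0 \<Longrightarrow> poly (pderiv p) c \<noteq> 0"
  obtains c d where "poly p c = 0" "poly p d = 0" "c \<noteq> d"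
proof -
  obtain c where c: "poly p c = 0" using complex_poly_root[of p] assms by auto
  then obtain q where q: "p = [:- c, 1:] * q" by (auto simp: poly_eq_0_iff_dvd)
  have "q \<noteq> 0" using q assms by auto
  then have "degree p = degree q + 1" unfolding q by (subst degree_mult_eq) auto
  then have "degree q \<noteq> 0" using assms by simp
  then obtain d where d: "poly q d = 0" using complex_poly_root[of q] by auto
  have "poly (pderiv p) c = poly q c" unfolding q by (subst pderiv_mult) (simp add: pderiv_pCons)
  with simple[OF c] d have "c \<noteq> d" by auto
  moreover have "poly p d = 0" using d q by simp
  ultimately show thesis using c that by blast
qed

text \<open>
  If \<open>f\<close> were transcendental or algebraic of degree at least two over \<open>A\<close>, a general
  homomorphism on \<open>A\<close> would have two extensions with different values at \<open>f\<close>.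
\<close>

lemma determined_imp_fraction:
  fixes A :: "'a::{idom, ring_char_0} set"
  assumes A: "is_subring A"
    and gen: "adjoin_list (adjoin A f) bs = UNIV"
    and h: "h \<noteq> 0"
    and pts: "\<And>x. x \<noteq> 0 \<Longrightarrow> \<exists>e\<in>E. hom_on UNIV e \<and> e x \<noteq> 0"
    and det: "\<And>e0 e1 e2. e0 \<in> E \<Longrightarrow> hom_on UNIV e1 \<Longrightarrow> hom_on UNIV e2 \<Longrightarrow> \<forall>x\<in>A. e1 x = e0 x \<Longrightarrow>
       \<forall>x\<in>A. e2 x = e0 x \<Longrightarrow> e1 h \<noteq> 0 \<Longrightarrow> e2 h \<noteq> 0 \<Longrightarrow> e1 f = e2 f"
  obtains a b where "a \<in> A" "b \<in> A" "a \<noteq> 0" "a * f = b"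
proof -
  have "\<exists>g\<in>adjoin A f. g \<noteq> 0 \<and> (\<forall>e. hom_on (adjoin A f) e \<longrightarrow> e g \<noteq> 0 \<longrightarrow>
           (\<exists>e'. hom_on UNIV e' \<and> (\<forall>x\<in>adjoin A f. e' x = e x) \<and> e' h \<noteq> 0))"
    using extend_hom_list_generically[OF is_subring_adjoin[OF A], of h f bs] h gen by simp
  then obtain g where g: "g \<in> adjoin A f" "g \<noteq> 0"
    "\<And>e. hom_on (adjoin A f) e \<Longrightarrow> e g \<noteq> 0 \<Longrightarrow>
       \<exists>e'. hom_on UNIV e' \<and> (\<forall>x\<in>adjoin A f. e' x = e x) \<and> e' h \<noteq> 0" by blast
  obtain G where G: "G \<in> polys_over A" "g = poly G f" using g(1) by (auto simp: adjoin_def)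
  have X: "[:0, 1:] \<in> polys_over A"
    using A by (auto simp: polys_over_def coeff_pCons is_subring_def split: nat.splits)
  \<comment> \<open>Two admissible images of \<open>f\<close> at which \<open>g\<close> survives
    extend to homomorphisms of the whole ring that agree on \<open>A\<close>, so \<open>det\<close>
    identifies them. Each remaining case tries to produce two different images.\<close>
  have unique: "c = d" if e: "e \<in> E" "hom_on A e" and
      van: "\<And>F x. F \<in> polys_over A \<Longrightarrow> poly F f = 0 \<Longrightarrow> x \<in> {c, d} \<Longrightarrow> poly (map_poly e F) x = 0"
      and Gnz: "\<And>x. x \<in> {c, d} \<Longrightarrow> poly (map_poly e G) x \<noteq> 0" for e c d
  proof -
    have ext: "\<exists>e'. hom_on UNIV e' \<and> (\<forall>x\<in>A. e' x = e x) \<and> e' h \<noteq> 0 \<and> e' f = x" if x: "x \<in> {c, d}" for x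
    proof -
      obtain e1 where e1: "hom_on (adjoin A f) e1"
        "\<And>F. F \<in> polys_over A \<Longrightarrow> e1 (poly F f) = poly (map_poly e F) x"
        "\<And>x. x \<in> A \<Longrightarrow> e1 x = e x"
        using extend_hom_to_adjoin[OF A e(2), of f x] van x by blast
      have "e1 g \<noteq> 0" using e1(2)[OF G(1)] G(2) Gnz[OF x] by simp
      with g(3) e1(1) obtain e2 where e2: "hom_on UNIV e2" "\<forall>y\<in>adjoin A f. e2 y = e1 y" "e2 h \<noteq> 0"
        by blast
      have "map_poly e [:0, 1:] = [:0, 1:]"
        using e(2) by (intro poly_eqI) (auto simp: coeff_map_hom[OF A e(2)] coeff_pCons hom_on_def split: nat.splits)
      then have "e2 f = x" using e2(2) adjoin_self[OF A, of f] e1(2)[OF X] by simp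
      with e2 e1(3) adjoin_subset[OF A, of f] show ?thesis by (metis subsetD)
    qed
    from ext[of c] ext[of d] obtain e1 e2 where
      "hom_on UNIV e1" "\<forall>x\<in>A. e1 x = e x" "e1 h \<noteq> 0" "e1 f = c"
      "hom_on UNIV e2" "\<forall>x\<in>A. e2 x = e x" "e2 h \<noteq> 0" "e2 f = d" by blast
    with det[OF e(1), of e1 e2] show ?thesis by simp
  qed
  have homA: "hom_on A e" if "hom_on UNIV e" for e using that by (auto simp: hom_on_def)
  show thesis
  proof (cases "\<exists>F\<in>polys_over A. F \<noteq> 0 \<and> poly F f = 0")
    case False
    then have triv: "F = 0" if "F \<in> polys_over A" "poly F f = 0" for F using that by blast
    \<comment> \<open>Transcendental case: there is no relation to respect, so all but finitely many
      values are admissible.\<close>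
    have "G \<noteq> 0" using g G by auto
    then obtain e where e: "e \<in> E" "hom_on UNIV e" "e (lead_coeff G) \<noteq> 0"
      using pts[of "lead_coeff G"] by auto
    then have nz: "map_poly e G \<noteq> 0" using coeff_map_hom[OF A homA] by (metis coeff_0)
    obtain c where c: "poly (map_poly e G) c \<noteq> 0" using exists_nonroot[OF nz, of "{}"] by auto
    obtain d where d: "poly (map_poly e G) d \<noteq> 0" "d \<notin> {c}" using exists_nonroot[OF nz, of "{c}"] by auto
    have "c = d"
    proof (rule unique[OF e(1) homA[OF e(2)]])
      show "poly (map_poly e F) x = 0" if "F \<in> polys_over A" "poly F f = 0" for F x
        using triv[OF that] by simp
    qed (use c d in auto)
    with d show thesis by simp
  next
    case True
    then obtain F where F: "min_poly A f F" using min_poly_exists[OF A] by blast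
    then have FA: "F \<in> polys_over A" "F \<noteq> 0" "poly F f = 0" by (auto simp: min_poly_def[OF A])
    show thesis
    proof (cases "degree F = 1")
      case True
      define a b where "a = coeff F 1" and "b = coeff F 0"
      have ab: "F = [:b, a:]"
        unfolding a_def b_def using True
        by (intro poly_eqI) (auto simp: coeff_pCons coeff_eq_0 split: nat.splits)
      then have "a \<noteq> 0" using True by auto
      have "coeff F 0 \<in> A" "coeff F 1 \<in> A" using FA by (auto simp: polys_over_def)
      then have "a \<in> A" "- b \<in> A" using A ab by (auto simp: is_subring_def)
      moreover have "a * f = - b" using FA(3) ab
        by (simp add: mult.commute eq_neg_iff_add_eq_0 add.commute)
      ultimately show thesis using \<open>a \<noteq> 0\<close> that by blast
    next
      case False
      with min_poly_degree[OF A F] have deg: "degree F \<ge> 2" by simp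
      \<comment> \<open>Characteristic zero enters here. The derivative is nonzero, hence by
        minimality does not vanish at \<open>f\<close>, so a general specialization of
        \<open>F\<close> has only simple roots and thus at least two. The factor \<open>G\<close>
        below keeps \<open>g\<close> alive at all of them.\<close>
      have dd: "degree (pderiv F) < degree F" "pderiv F \<noteq> 0"
        using deg by (auto simp: degree_pderiv pderiv_eq_0_iff)
      then have "poly (pderiv F) f \<noteq> 0"
        using F polys_over_pderiv[OF A FA(1)] by (force simp: min_poly_def[OF A])
      then have nz: "poly (G * pderiv F) f \<noteq> 0" using g G by simp
      have HA: "G * pderiv F \<in> polys_over A"
        using G FA by (intro polys_over_mult[OF A] polys_over_pderiv[OF A])
      obtain U V r where B: "U \<in> polys_over A" "V \<in> polys_over A" "r \<in> A" "r \<noteq> 0"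
        "U * (G * pderiv F) + V * F = [:r:]" using min_poly_Bezout[OF A F HA nz] by blast
      have "lead_coeff F * r \<noteq> 0" using B FA by simp
      then obtain e where e: "e \<in> E" "hom_on UNIV e" "e (lead_coeff F * r) \<noteq> 0" using pts by blast
      then have nz: "e (lead_coeff F) \<noteq> 0" "e r \<noteq> 0" by (auto simp: hom_on_def)
      have H: "poly (map_poly e G) c \<noteq> 0 \<and> poly (pderiv (map_poly e F)) c \<noteq> 0"
        if "poly (map_poly e F) c = 0" for c
        using Bezout_hom_nonzero[OF A B(5,1,2) HA FA(1) homA[OF e(2)] nz(2) that]
          map_hom_mult[OF A homA[OF e(2)] G(1) polys_over_pderiv[OF A FA(1)]]
          map_hom_pderiv[OF A homA[OF e(2)] FA(1)] by simp
      obtain c d where cd: "poly (map_poly e F) c = 0" "poly (map_poly e F) d = 0" "c \<noteq> d"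
        using two_simple_roots[of "map_poly e F"] degree_map_hom[OF A homA[OF e(2)] nz(1)] deg H
        by metis
      have "c = d"
      proof (rule unique[OF e(1) homA[OF e(2)]])
        show "poly (map_poly e F') x = 0" if "F' \<in> polys_over A" "poly F' f = 0" "x \<in> {c, d}" for F' x
          using poly_map_hom_root[OF A F homA[OF e(2)] nz(1) _ that(1,2)] that(3) cd by blast
      qed (use H cd in auto)
      with cd show thesis by simp
    qed
  qed
qed

section \<open>Polynomial functions\<close>

lemma polyfuns_sum:
  "(\<And>i. i \<in> I \<Longrightarrow> f i \<in> polyfuns C) \<Longrightarrow> (\<lambda>v. \<Sum>i\<in>I. f i v) \<in> polyfuns C"
  by (induction I rule: infinite_finite_induct) (auto intro: polyfuns.intros)

lemma polyfuns_prod: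
  "(\<And>i. i \<in> I \<Longrightarrow> f i \<in> polyfuns C) \<Longrightarrow> (\<lambda>v. \<Prod>i\<in>I. f i v) \<in> polyfuns C"
  by (induction I rule: infinite_finite_induct) (auto intro: polyfuns.intros)

lemma polyfuns_uminus: "f \<in> polyfuns C \<Longrightarrow> (\<lambda>v. - f v) \<in> polyfuns C"
  using polyfuns.mult[OF polyfuns.const[of "- 1"], of f] by simp

lemma polyfuns_diff:
  "f \<in> polyfuns C \<Longrightarrow> g \<in> polyfuns C \<Longrightarrow> (\<lambda>v. f v - g v) \<in> polyfuns C"
  using polyfuns.add[OF _ polyfuns_uminus] by fastforce

lemmas polyfuns_intros = polyfuns.const polyfuns.add polyfuns.mult polyfuns_sum polyfuns_prod
  polyfuns_uminus polyfuns_diff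

lemma polyfuns_compose:
  assumes "F \<in> polyfuns C" "\<And>f. f \<in> C \<Longrightarrow> (\<lambda>t. f (\<pi> t)) \<in> polyfuns C'"
  shows "(\<lambda>t. F (\<pi> t)) \<in> polyfuns C'"
  using assms(1) by induction (auto intro: polyfuns.intros assms(2))

text \<open>For the family \<open>c *s v\<close> the coefficients obtained are the homogeneous
  components of \<open>F\<close>, and this shows that they are again polynomial.\<close>

lemma polyfuns_along_family:
  assumes "F \<in> polyfuns C"
    and "\<And>f. f \<in> C \<Longrightarrow> \<exists>G. (\<forall>w c. poly (G w) c = f (\<gamma> w c)) \<and> (\<forall>d. (\<lambda>w. coeff (G w) d) \<in> polyfuns C')"
  shows "\<exists>G. (\<forall>w c. poly (G w) c = F (\<gamma> w c)) \<and> (\<forall>d. (\<lambda>w. coeff (G w) d) \<in> polyfuns C')"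
  using assms(1)
proof induction
  case (const c)
  have "(\<lambda>w. coeff [:c:] d) \<in> polyfuns C'" for d by (rule polyfuns.const)
  then show ?case by (intro exI[of _ "\<lambda>_. [:c:]"]) simp
next
  case (coord f)
  then show ?case by (rule assms(2))
next
  case (add f g)
  then obtain G H where "\<forall>w c. poly (G w) c = f (\<gamma> w c)" "\<forall>d. (\<lambda>w. coeff (G w) d) \<in> polyfuns C'"
    "\<forall>w c. poly (H w) c = g (\<gamma> w c)" "\<forall>d. (\<lambda>w. coeff (H w) d) \<in> polyfuns C'" by blast
  then show ?case
    by (intro exI[of _ "\<lambda>w. G w + H w"]) (auto intro: polyfuns_intros)
next
  case (mult f g)
  then obtain G H where "\<forall>w c. poly (G w) c = f (\<gamma> w c)" "\<forall>d. (\<lambda>w. coeff (G w) d) \<in> polyfuns C'"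
    "\<forall>w c. poly (H w) c = g (\<gamma> w c)" "\<forall>d. (\<lambda>w. coeff (H w) d) \<in> polyfuns C'" by blast
  then show ?case
    by (intro exI[of _ "\<lambda>w. G w * H w"]) (auto simp: coeff_mult intro!: polyfuns_intros)
qed

lemma polyfuns_along_curve:
  assumes "F \<in> polyfuns C" "\<And>f. f \<in> C \<Longrightarrow> \<exists>q. \<forall>s. poly q s = f (\<gamma> s)"
  obtains q where "\<And>s. poly q s = F (\<gamma> s)"
proof -
  have "\<exists>q. \<forall>s. poly q s = F (\<gamma> s)"
    using assms(1)
  proof induction
    case (const c)
    show ?case by (intro exI[of _ "[:c:]"]) simp
  next
    case (coord f)
    then show ?case by (rule assms(2))
  next
    case (add f g)
    then obtain q r where "\<forall>s. poly q s = f (\<gamma> s)" "\<forall>s. poly r s = g (\<gamma> s)" by blast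
    then show ?case by (intro exI[of _ "q + r"]) simp
  next
    case (mult f g)
    then obtain q r where "\<forall>s. poly q s = f (\<gamma> s)" "\<forall>s. poly r s = g (\<gamma> s)" by blast
    then show ?case by (intro exI[of _ "q * r"]) simp
  qed
  then show thesis using that by blast
qed

abbreviation coords :: "(('i \<Rightarrow> complex) \<Rightarrow> complex) set" where
  "coords \<equiv> range (\<lambda>i t. t i)"

abbreviation vcoords :: "(complex ^ 'm \<Rightarrow> complex) set" where
  "vcoords \<equiv> range (\<lambda>j v. v $ j)"

text \<open>On the line through \<open>t\<close> and \<open>u\<close> both functions become nonzero
  polynomials in one variable, and so does their product. This is the irreducibility of affine
  space.\<close>

lemma nonvanishing_simultaneously:
  assumes "f \<in> polyfuns coords" "g \<in> polyfuns coords" "f t \<noteq> 0" "g u \<noteq> 0"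
  obtains w where "f w \<noteq> 0" "g w \<noteq> 0"
proof -
  define \<gamma> where "\<gamma> s = (\<lambda>i. t i + s * (u i - t i))" for s
  have c: "\<exists>q. \<forall>s. poly q s = h (\<gamma> s)" if "h \<in> coords" for h
  proof -
    from that obtain i where "h = (\<lambda>t. t i)" by auto
    then show ?thesis by (intro exI[of _ "[:t i, u i - t i:]"]) (simp add: \<gamma>_def)
  qed
  obtain q where q: "\<And>s. poly q s = f (\<gamma> s)" using polyfuns_along_curve[OF assms(1), of \<gamma>] c by blast
  obtain r where r: "\<And>s. poly r s = g (\<gamma> s)" using polyfuns_along_curve[OF assms(2), of \<gamma>] c by blast
  have "poly q 0 \<noteq> 0" "poly r 1 \<noteq> 0" using q r assms by (simp_all add: \<gamma>_def)
  then have "q * r \<noteq> 0" by auto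
  then obtain s where "poly (q * r) s \<noteq> 0" by (meson poly_all_0_iff_0)
  then show thesis using q r that[of "\<gamma> s"] by simp
qed

section \<open>The domain of polynomial functions on affine space\<close>

text \<open>As a type this ring is an instance of \<open>idom\<close>, so that the results on
  subrings of a domain apply to it.\<close>

typedef 'i polyfun = "polyfuns coords :: (('i \<Rightarrow> complex) \<Rightarrow> complex) set"
  morphisms ev Abs_polyfun
  using polyfuns.const by blast

setup_lifting type_definition_polyfun

instantiation polyfun :: (type) idom
begin

lift_definition zero_polyfun :: "'a polyfun" is "\<lambda>_. 0" by (rule polyfuns.const)
lift_definition one_polyfun :: "'a polyfun" is "\<lambda>_. 1" by (rule polyfuns.const)
lift_definition plus_polyfun :: "'a polyfun \<Rightarrow> 'a polyfun \<Rightarrow> 'a polyfun" is "\<lambda>f g t. f t + g t"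
  by (rule polyfuns.add)
lift_definition times_polyfun :: "'a polyfun \<Rightarrow> 'a polyfun \<Rightarrow> 'a polyfun" is "\<lambda>f g t. f t * g t"
  by (rule polyfuns.mult)
lift_definition minus_polyfun :: "'a polyfun \<Rightarrow> 'a polyfun \<Rightarrow> 'a polyfun" is "\<lambda>f g t. f t - g t"
  by (rule polyfuns_diff)
lift_definition uminus_polyfun :: "'a polyfun \<Rightarrow> 'a polyfun" is "\<lambda>f t. - f t"
  by (rule polyfuns_uminus)

instance
proof
  fix a b :: "'a polyfun"
  assume "a \<noteq> 0" "b \<noteq> 0"
  then show "a * b \<noteq> 0"
  proof transfer
    fix f g :: "('a \<Rightarrow> complex) \<Rightarrow> complex"
    assume fg: "f \<in> polyfuns coords" "g \<in> polyfuns coords" "f \<noteq> (\<lambda>_. 0)" "g \<noteq> (\<lambda>_. 0)"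
    then obtain t u where tu: "f t \<noteq> 0" "g u \<noteq> 0" by (auto simp: fun_eq_iff)
    obtain w where "f w \<noteq> 0" "g w \<noteq> 0" by (rule nonvanishing_simultaneously[OF fg(1,2), OF tu])
    then show "(\<lambda>t. f t * g t) \<noteq> (\<lambda>_. 0)" by (auto simp: fun_eq_iff)
  qed
qed (transfer; simp add: fun_eq_iff algebra_simps)+

end

lift_definition Const :: "complex \<Rightarrow> 'i polyfun" is "\<lambda>c _. c" by (rule polyfuns.const)
lift_definition Var :: "'i \<Rightarrow> 'i polyfun" is "\<lambda>i t. t i" by (auto intro: polyfuns.coord)

lemma ev_simps [simp]:
  "ev 0 t = 0" "ev 1 t = 1" "ev (p + q) t = ev p t + ev q t" "ev (p * q) t = ev p t * ev q t"
  "ev (- p) t = - ev p t" "ev (p - q) t = ev p t - ev q t" "ev (Const c) t = c" "ev (Var i) t = t i"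
  by (transfer; simp)+

lemma polyfun_eqI: "(\<And>t. ev p t = ev q t) \<Longrightarrow> p = q"
  by transfer blast

lemma polyfun_nonzero: "p \<noteq> 0 \<Longrightarrow> \<exists>t. ev p t \<noteq> 0"
  using polyfun_eqI[of p 0] by auto

lemma ev_of_nat: "ev (of_nat n) t = of_nat n"
  by (induction n) auto

instance polyfun :: (type) ring_char_0
proof
  show "inj (of_nat :: nat \<Rightarrow> 'a polyfun)"
    by (rule injI) (metis ev_of_nat of_nat_eq_iff)
qed

lemma hom_on_ev: "hom_on A (\<lambda>p. ev p t)"
  by (auto simp: hom_on_def)

text \<open>This turns abstractly extended homomorphisms back into points: the coordinates are the
  images of the variables.\<close>

lemma hom_on_UNIV_eq_ev:
  assumes e: "hom_on UNIV e" and c: "\<And>c. e (Const c) = c"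
  shows "e p = ev p (\<lambda>i. e (Var i))"
proof -
  have "e (Abs_polyfun f) = f (\<lambda>i. e (Var i))" if "f \<in> polyfuns coords" for f
    using that
  proof (induction rule: polyfuns.induct)
    case (const d)
    then show ?case using c[of d] by (simp add: Const_def)
  next
    case (coord f)
    then obtain i where "f = (\<lambda>t. t i)" by auto
    then show ?case by (simp add: Var_def)
  next
    case (add f g)
    then have "Abs_polyfun (\<lambda>v. f v + g v) = Abs_polyfun f + Abs_polyfun g"
      by (simp add: plus_polyfun.abs_eq eq_onp_def)
    with add e show ?case by (simp add: hom_on_def)
  next
    case (mult f g)
    then have "Abs_polyfun (\<lambda>v. f v * g v) = Abs_polyfun f * Abs_polyfun g"
      by (simp add: times_polyfun.abs_eq eq_onp_def)
    with mult e show ?case by (simp add: hom_on_def)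
  qed
  from this[OF ev[of p]] show ?thesis by (simp add: ev_inverse)
qed

lemma subring_eq_UNIV:
  assumes S: "is_subring S" and "range Const \<subseteq> S" "range Var \<subseteq> S"
  shows "S = UNIV"
proof -
  have "Abs_polyfun f \<in> S" if "f \<in> polyfuns coords" for f
    using that
  proof (induction rule: polyfuns.induct)
    case (const d)
    then show ?case using assms(2) by (auto simp: Const_def)
  next
    case (coord f)
    then obtain i where "f = (\<lambda>t. t i)" by auto
    then show ?case using assms(3) by (auto simp: Var_def)
  next
    case (add f g)
    then have "Abs_polyfun (\<lambda>v. f v + g v) = Abs_polyfun f + Abs_polyfun g"
      by (simp add: plus_polyfun.abs_eq eq_onp_def)
    with add S show ?case by (simp add: is_subring_def)
  next
    case (mult f g)
    then have "Abs_polyfun (\<lambda>v. f v * g v) = Abs_polyfun f * Abs_polyfun g"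
      by (simp add: times_polyfun.abs_eq eq_onp_def)
    with mult S show ?case by (simp add: is_subring_def)
  qed
  then show ?thesis by (metis UNIV_eq_I ev ev_inverse)
qed

section \<open>Images of polynomial maps\<close>

text \<open>If \<open>C\<close> consists of the coordinates of the target, this is a copy of the
  coordinate ring of the closure of the image of \<open>\<Phi>\<close>, placed inside the ring of
  the source so that homomorphisms can be extended from the one to the other.\<close>

definition pullback :: "('w \<Rightarrow> complex) set \<Rightarrow> (('i \<Rightarrow> complex) \<Rightarrow> 'w) \<Rightarrow> 'i polyfun set" where
  "pullback C \<Phi> = {p. \<exists>G\<in>polyfuns C. \<forall>t. ev p t = G (\<Phi> t)}"

lemma is_subring_pullback: "is_subring (pullback C \<Phi>)"
proof -
  have "0 \<in> pullback C \<Phi>" "1 \<in> pullback C \<Phi>"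
    using polyfuns.const[of 0 C] polyfuns.const[of 1 C] by (force simp: pullback_def)+
  moreover have "- x \<in> pullback C \<Phi>" if "x \<in> pullback C \<Phi>" for x
    using that polyfuns_uminus by (force simp: pullback_def)
  moreover have "x + y \<in> pullback C \<Phi> \<and> x * y \<in> pullback C \<Phi>"
    if xy: "x \<in> pullback C \<Phi>" "y \<in> pullback C \<Phi>" for x y
  proof -
    obtain G H where GH: "G \<in> polyfuns C" "\<And>t. ev x t = G (\<Phi> t)"
      "H \<in> polyfuns C" "\<And>t. ev y t = H (\<Phi> t)" using xy by (auto simp: pullback_def)
    show ?thesis
      using polyfuns.add[OF GH(1,3)] polyfuns.mult[OF GH(1,3)]
      unfolding pullback_def mem_Collect_eq ev_simps GH(2,4)
      by (intro conjI bexI[of _ "\<lambda>v. G v + H v"] bexI[of _ "\<lambda>v. G v * H v"] allI refl)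
  qed
  ultimately show ?thesis by (auto simp: is_subring_def)
qed

lemma Const_in_pullback: "Const c \<in> pullback C \<Phi>"
  using polyfuns.const[of c C] by (force simp: pullback_def)

lemma pullback_generates:
  fixes \<Phi> :: "('i::finite \<Rightarrow> complex) \<Rightarrow> 'w"
  assumes "is_subring S" "pullback C \<Phi> \<subseteq> S"
  obtains bs where "adjoin_list S bs = UNIV"
proof -
  obtain vs where "set vs = (UNIV :: 'i set)" using finite_list[of "UNIV :: 'i set"] by auto
  then have "range Var \<subseteq> adjoin_list S (map Var vs)"
    using set_subset_adjoin_list[OF assms(1), of "map Var vs"] by simp
  moreover have "range Const \<subseteq> adjoin_list S (map Var vs)"
    using subset_adjoin_list[OF assms(1)] assms(2) Const_in_pullback by blast
  ultimately show thesis
    using subring_eq_UNIV[OF is_subring_adjoin_list[OF assms(1)]] that by blast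
qed

text \<open>Chevalley's theorem. A point \<open>w\<close> satisfying all equations of the image is a
  homomorphism on the pullback ring; if \<open>g\<close> does not vanish at \<open>w\<close>, it
  extends to all polynomial functions, and the extension is a parameter lying over \<open>w\<close>.
  The function \<open>h\<close> is an open condition that this parameter has to meet.\<close>

theorem general_point_of_closure_in_image:
  fixes \<Phi> :: "('i::finite \<Rightarrow> complex) \<Rightarrow> 'w"
  assumes \<Phi>: "\<And>f. f \<in> C \<Longrightarrow> (\<lambda>t. f (\<Phi> t)) \<in> polyfuns coords"
    and h: "h \<in> polyfuns coords" "h t0 \<noteq> 0"
  obtains g t1 where "g \<in> polyfuns C" "g (\<Phi> t1) \<noteq> 0"
    "\<And>w. (\<And>G. G \<in> polyfuns C \<Longrightarrow> (\<And>t. G (\<Phi> t) = 0) \<Longrightarrow> G w = 0) \<Longrightarrow> g w \<noteq> 0 \<Longrightarrow>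
       \<exists>t. h t \<noteq> 0 \<and> (\<forall>f\<in>C. f (\<Phi> t) = f w)"
proof -
  define A where "A = pullback C \<Phi>"
  have A: "is_subring A" unfolding A_def by (rule is_subring_pullback)
  obtain bs where bs: "adjoin_list A bs = UNIV" using pullback_generates[OF A] A_def by blast
  have evh: "ev (Abs_polyfun h) = h" using h by (simp add: Abs_polyfun_inverse)
  then have "Abs_polyfun h \<noteq> 0" using h(2) by auto
  then obtain p where p: "p \<in> A" "p \<noteq> 0" "\<And>e. hom_on A e \<Longrightarrow> e p \<noteq> 0 \<Longrightarrow>
      \<exists>e'. hom_on UNIV e' \<and> (\<forall>x\<in>A. e' x = e x) \<and> e' (Abs_polyfun h) \<noteq> 0"
    using extend_hom_list_generically[OF A, of "Abs_polyfun h" bs] bs by auto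
  obtain t1 where t1: "ev p t1 \<noteq> 0" using polyfun_nonzero p by blast
  obtain g where g: "g \<in> polyfuns C" "\<And>t. ev p t = g (\<Phi> t)"
    using p(1) by (auto simp: A_def pullback_def)
  show thesis
  proof (rule that[of g t1])
    fix w assume w: "\<And>G. G \<in> polyfuns C \<Longrightarrow> (\<And>t. G (\<Phi> t) = 0) \<Longrightarrow> G w = 0" and gw: "g w \<noteq> 0"
    \<comment> \<open>The homomorphism sends the composite of \<open>G\<close> and
      \<open>\<Phi>\<close> to \<open>G w\<close>. The choice of \<open>G\<close> does not matter,
      because \<open>w\<close> satisfies the equations of the image.\<close>
    define r where "r x = (SOME G. G \<in> polyfuns C \<and> (\<forall>t. ev x t = G (\<Phi> t)))" for x
    define e where "e x = r x w" for x
    have e: "e x = G w" if G: "G \<in> polyfuns C" "\<And>t. ev x t = G (\<Phi> t)" for x G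
    proof -
      have "r x \<in> polyfuns C \<and> (\<forall>t. ev x t = r x (\<Phi> t))"
        unfolding r_def by (rule someI[of _ G]) (use G in auto)
      then have "(\<lambda>v. r x v - G v) \<in> polyfuns C" "\<And>t. r x (\<Phi> t) - G (\<Phi> t) = 0"
        using G by (auto intro: polyfuns_diff)
      from w[OF this] show ?thesis by (simp add: e_def)
    qed
    have "hom_on A e"
      unfolding hom_on_def
    proof (intro conjI ballI)
      show "e 0 = 0" "e 1 = 1" by (rule e; auto intro: polyfuns.const)+
      fix x y assume "x \<in> A" "y \<in> A"
      then obtain G H where GH: "G \<in> polyfuns C" "\<And>t. ev x t = G (\<Phi> t)"
        "H \<in> polyfuns C" "\<And>t. ev y t = H (\<Phi> t)" by (auto simp: A_def pullback_def)
      have "e (x + y) = G w + H w" "e (x * y) = G w * H w"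
        by (rule e; use GH in \<open>auto intro: polyfuns_intros\<close>)+
      then show "e (x + y) = e x + e y" "e (x * y) = e x * e y" using e GH by auto
    qed
    moreover have "e p \<noteq> 0" using e g gw by simp
    ultimately obtain e' where e': "hom_on UNIV e'" "\<forall>x\<in>A. e' x = e x" "e' (Abs_polyfun h) \<noteq> 0"
      using p(3) by blast
    have "e' (Const c) = c" for c
      using e' Const_in_pullback[of c C \<Phi>] e[of "\<lambda>_. c" "Const c"] by (simp add: A_def polyfuns.const)
    then have ev: "e' x = ev x (\<lambda>i. e' (Var i))" for x using hom_on_UNIV_eq_ev e'(1) by blast
    have "h (\<lambda>i. e' (Var i)) \<noteq> 0" using e'(3) ev[of "Abs_polyfun h"] evh by simp
    moreover have "f (\<Phi> (\<lambda>i. e' (Var i))) = f w" if f: "f \<in> C" for f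
    proof -
      define x where "x = Abs_polyfun (\<lambda>t. f (\<Phi> t))"
      have x: "ev x t = f (\<Phi> t)" for t using \<Phi>[OF f] by (simp add: x_def Abs_polyfun_inverse)
      then have "x \<in> A" using polyfuns.coord[OF f] by (auto simp: A_def pullback_def)
      then have "e' x = e x" using e' by blast
      also have "\<dots> = f w" by (rule e) (use x polyfuns.coord[OF f] in auto)
      finally show ?thesis using ev[of x] x by simp
    qed
    ultimately show "\<exists>t. h t \<noteq> 0 \<and> (\<forall>f\<in>C. f (\<Phi> t) = f w)" by blast
  qed (use g t1 in auto)
qed

text \<open>Two points that agree on the pullback ring lie in the same fibre of
  \<open>\<Phi>\<close>. Constancy on fibres is therefore the uniqueness of the value at
  \<open>f\<close> that forces \<open>f\<close> to have degree one over that ring.\<close>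

theorem constant_on_fibres_imp_fraction:
  fixes \<Phi> :: "('i::finite \<Rightarrow> complex) \<Rightarrow> 'w"
  assumes \<Phi>: "\<And>f. f \<in> C \<Longrightarrow> (\<lambda>t. f (\<Phi> t)) \<in> polyfuns coords"
    and h: "h \<in> polyfuns coords" "h t0 \<noteq> 0" and f: "f \<in> polyfuns coords"
    and const: "\<And>t u. (\<And>c. c \<in> C \<Longrightarrow> c (\<Phi> t) = c (\<Phi> u)) \<Longrightarrow> h t \<noteq> 0 \<Longrightarrow> h u \<noteq> 0 \<Longrightarrow> f t = f u"
  obtains a b t1 where "a \<in> polyfuns C" "b \<in> polyfuns C" "a (\<Phi> t1) \<noteq> 0"
    "\<And>t. a (\<Phi> t) * f t = b (\<Phi> t)"
proof -
  define A where "A = pullback C \<Phi>"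
  have A: "is_subring A" unfolding A_def by (rule is_subring_pullback)
  have evh: "ev (Abs_polyfun h) = h" and evf: "ev (Abs_polyfun f) = f"
    using h f by (simp_all add: Abs_polyfun_inverse)
  have hnz: "Abs_polyfun h \<noteq> 0" using h(2) evh by auto
  obtain bs where bs: "adjoin_list (adjoin A (Abs_polyfun f)) bs = UNIV"
    using pullback_generates[OF is_subring_adjoin[OF A]] adjoin_subset[OF A] A_def by blast
  define E where "E = range (\<lambda>t (p :: 'i polyfun). ev p t)"
  obtain x y where xy: "x \<in> A" "y \<in> A" "x \<noteq> 0" "x * Abs_polyfun f = y"
  proof (rule determined_imp_fraction[OF A bs hnz, of E])
    fix x :: "'i polyfun" assume "x \<noteq> 0"
    from polyfun_nonzero[OF this] show "\<exists>e\<in>E. hom_on UNIV e \<and> e x \<noteq> 0"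
      by (auto simp: E_def hom_on_ev)
  next
    fix e0 e1 e2 assume e: "e0 \<in> E" "hom_on UNIV e1" "hom_on UNIV e2" "\<forall>x\<in>A. e1 x = e0 x"
      "\<forall>x\<in>A. e2 x = e0 x" "e1 (Abs_polyfun h) \<noteq> 0" "e2 (Abs_polyfun h) \<noteq> 0"
    from e(1) have "e0 (Const c) = c" for c by (auto simp: E_def)
    then have "e1 (Const c) = c" "e2 (Const c) = c" for c
      using e(4,5) Const_in_pullback[of c C \<Phi>] by (auto simp: A_def)
    then have ev: "e1 x = ev x (\<lambda>i. e1 (Var i))" "e2 x = ev x (\<lambda>i. e2 (Var i))" for x
      using hom_on_UNIV_eq_ev e(2,3) by blast+
    have "c (\<Phi> (\<lambda>i. e1 (Var i))) = c (\<Phi> (\<lambda>i. e2 (Var i)))" if c: "c \<in> C" for c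
    proof -
      define x where "x = Abs_polyfun (\<lambda>t. c (\<Phi> t))"
      have x: "ev x t = c (\<Phi> t)" for t using \<Phi>[OF c] by (simp add: x_def Abs_polyfun_inverse)
      then have "x \<in> A" using polyfuns.coord[OF c] by (auto simp: A_def pullback_def)
      then have "e1 x = e2 x" using e by simp
      then show ?thesis using ev[of x] x by simp
    qed
    from const[of "\<lambda>i. e1 (Var i)" "\<lambda>i. e2 (Var i)", OF this] show "e1 (Abs_polyfun f) = e2 (Abs_polyfun f)"
      using ev[of "Abs_polyfun h"] ev[of "Abs_polyfun f"] e(6,7) evh evf by simp
  qed
  obtain a where a: "a \<in> polyfuns C" "\<And>t. ev x t = a (\<Phi> t)" using xy(1) by (auto simp: A_def pullback_def)
  obtain b where b: "b \<in> polyfuns C" "\<And>t. ev y t = b (\<Phi> t)" using xy(2) by (auto simp: A_def pullback_def)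
  obtain t1 where "ev x t1 \<noteq> 0" using polyfun_nonzero xy by blast
  moreover have "a (\<Phi> t) * f t = b (\<Phi> t)" for t
    using arg_cong[OF xy(4), of "\<lambda>p. ev p t"] a b evf by simp
  ultimately show thesis using a b that by metis
qed

section \<open>Uniqueness of the decomposition of a general tensor\<close>

text \<open>For n + 1 vectors in n-space this says that any n of them form a basis, a projective
  frame. The relation \<open>c\<close> is named because the kernel of Strassen's matrix is described
  by it.\<close>

definition frame :: "('i::finite \<Rightarrow> complex ^ 'n) \<Rightarrow> ('i \<Rightarrow> complex) \<Rightarrow> bool" where
  "frame v c \<longleftrightarrow> (\<forall>i. c i \<noteq> 0) \<and> (\<Sum>i\<in>UNIV. c i *s v i) = 0 \<and>
     (\<forall>w. (\<Sum>i\<in>UNIV. w i *s v i) = 0 \<longrightarrow> (\<exists>\<kappa>. \<forall>i. w i = \<kappa> * c i)) \<and>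
     (\<forall>y. \<exists>s. y = (\<Sum>i\<in>UNIV. s i *s v i))"

text \<open>Dual formulation: the tensors \<open>a\<^sub>i \<otimes> a\<^sub>i\<close> span the symmetric tensors.\<close>

definition on_no_conic :: "('i::finite \<Rightarrow> complex ^ 'l) \<Rightarrow> bool" where
  "on_no_conic a \<longleftrightarrow> (\<forall>Q. \<exists>z. \<forall>b d. (\<Sum>i\<in>UNIV. z i * (a i $ b * a i $ d)) = Q (Upair b d))"

text \<open>Formulated by minors, so that it is an open condition; it makes the vectors nonzero as
  soon as there are two indices.\<close>

definition pairwise_distinct_pts :: "('i \<Rightarrow> complex ^ 'l) \<Rightarrow> bool" where
  "pairwise_distinct_pts a \<longleftrightarrow> (\<forall>i j. i \<noteq> j \<longrightarrow> (\<exists>b d. a i $ b * a j $ d \<noteq> a i $ d * a j $ b))"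

definition apply_cols :: "('n \<Rightarrow> complex ^ 'l) \<Rightarrow> complex ^ 'n::finite \<Rightarrow> complex ^ 'l" where
  "apply_cols M y = (\<Sum>j\<in>UNIV. y $ j *s M j)"

text \<open>For a general decomposition this is membership of \<open>M\<close> in the kernel of
  Strassen's matrix.\<close>

definition aligned :: "('i \<Rightarrow> complex ^ 'l) \<Rightarrow> ('i \<Rightarrow> complex ^ 'n::finite) \<Rightarrow> ('n \<Rightarrow> complex ^ 'l) \<Rightarrow> bool" where
  "aligned a v M \<longleftrightarrow>
     (\<forall>i b d. a i $ b * apply_cols M (v i) $ d = a i $ d * apply_cols M (v i) $ b)"

definition same_tensor :: "('i::finite \<Rightarrow> complex ^ 'l) \<Rightarrow> ('i \<Rightarrow> complex ^ 'n) \<Rightarrow>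
    ('i \<Rightarrow> complex ^ 'l) \<Rightarrow> ('i \<Rightarrow> complex ^ 'n) \<Rightarrow> bool" where
  "same_tensor a v a' v' \<longleftrightarrow> (\<forall>b j l. (\<Sum>i\<in>UNIV. a i $ b * (v i $ j * v i $ l)) =
     (\<Sum>i\<in>UNIV. a' i $ b * (v' i $ j * v' i $ l)))"

lemma frame_relation:
  assumes "frame v c" "(\<Sum>i\<in>UNIV. w i *s v i) = 0"
  obtains \<kappa> where "\<And>i. w i = \<kappa> * c i"
  using assms unfolding frame_def by meson

lemma apply_cols_sum:
  "apply_cols M (\<Sum>i\<in>I. s i *s v i) = (\<Sum>i\<in>I. s i *s apply_cols M (v i))"
  unfolding apply_cols_def
  by (simp add: vec_eq_iff sum_component sum_distrib_left sum_distrib_right mult.assoc)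
    (subst sum.swap, simp)

text \<open>Take a symmetric matrix \<open>Q\<close> whose row \<open>e\<close> is \<open>y\<close>
  and contract its expression by squares with the coordinate \<open>e\<close>. The index set
  defining \<open>Q\<close> has at most one element, so \<open>Q\<close> is zero away from that row
  and column.\<close>

lemma on_no_conic_span:
  fixes a :: "'i::finite \<Rightarrow> complex ^ 'l"
  assumes "on_no_conic a"
  obtains z where "(\<Sum>i\<in>UNIV. z i *s a i) = y"
proof -
  fix e :: 'l
  define Q where "Q u = (\<Sum>b\<in>{b. u = Upair b e}. y $ b)" for u
  have Q: "Q (Upair b e) = y $ b" for b
  proof -
    have "{b'. Upair b e = Upair b' e} = {b}" by auto
    then show ?thesis by (simp add: Q_def)
  qed
  obtain z where z: "\<And>b d. (\<Sum>i\<in>UNIV. z i * (a i $ b * a i $ d)) = Q (Upair b d)"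
    using assms unfolding on_no_conic_def by meson
  have "(\<Sum>i\<in>UNIV. (z i * a i $ e) *s a i) = y"
    using z[of _ e] Q by (simp add: vec_eq_iff sum_component mult_ac)
  then show thesis by (rule that)
qed

lemma on_no_conic_annihilator:
  fixes a :: "'i::finite \<Rightarrow> complex ^ 'l::finite"
  assumes a: "on_no_conic a" and w: "\<And>i. (\<Sum>b\<in>UNIV. w b * a i $ b) = 0"
  shows "w d = 0"
proof -
  obtain z where z: "(\<Sum>i\<in>UNIV. z i *s a i) = axis d 1" using on_no_conic_span[OF a] .
  have "w d = (\<Sum>b\<in>UNIV. w b * (axis d 1 :: complex ^ 'l) $ b)"
    by (simp add: axis_def if_distrib cong: if_cong)
  also have "\<dots> = (\<Sum>b\<in>UNIV. \<Sum>i\<in>UNIV. z i * (w b * a i $ b))"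
    by (simp add: z[symmetric] sum_component sum_distrib_left mult_ac)
  also have "\<dots> = (\<Sum>i\<in>UNIV. z i * (\<Sum>b\<in>UNIV. w b * a i $ b))"
    by (subst sum.swap) (simp add: sum_distrib_left)
  finally show ?thesis by (simp add: w)
qed

text \<open>
  The condition \<open>\<Sum>\<^sub>i (a\<^sub>i \<times> M v\<^sub>i) \<otimes> v\<^sub>i = 0\<close> on \<open>M\<close> depends only on the tensor
  (it says that \<open>M\<close> lies in the kernel of Strassen's skew-symmetric matrix), and for a general
  decomposition it forces every single summand to vanish.
\<close>

lemma aligned_transfer:
  fixes a a' :: "'i::finite \<Rightarrow> complex ^ 3" and v v' :: "'i \<Rightarrow> complex ^ 'n::finite"
  assumes T: "same_tensor a v a' v'" and v': "frame v' c" and a': "on_no_conic a'"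
    and M: "aligned a v M"
  shows "aligned a' v' M"
proof -
  define W where "W a v i b d = a i $ b * apply_cols M (v i) $ d - a i $ d * apply_cols M (v i) $ b"
    for a :: "'i \<Rightarrow> complex ^ 3" and v :: "'i \<Rightarrow> complex ^ 'n" and i b d
  define T where "T a v b l j = (\<Sum>i\<in>UNIV. a i $ b * (v i $ l * v i $ j))"
    for a :: "'i \<Rightarrow> complex ^ 3" and v :: "'i \<Rightarrow> complex ^ 'n" and b l j
  have W: "(\<Sum>i\<in>UNIV. W a v i b d * v i $ j) = (\<Sum>l\<in>UNIV. M l $ d * T a v b l j - M l $ b * T a v d l j)"
    for a v b d j
  proof -
    have 1: "(\<Sum>i\<in>UNIV. a i $ b * apply_cols M (v i) $ d * v i $ j) = (\<Sum>l\<in>UNIV. M l $ d * T a v b l j)" for b d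
      unfolding T_def apply_cols_def sum_component vector_smult_component sum_distrib_left sum_distrib_right
      by (subst sum.swap) (simp add: mult_ac)
    show ?thesis
      unfolding W_def left_diff_distrib sum_subtractf 1 ..
  qed
  have "T a v b l j = T a' v' b l j" for b l j
    using assms(1) by (simp add: same_tensor_def T_def)
  moreover have "W a v i b d = 0" for i b d using M by (simp add: aligned_def W_def)
  ultimately have "(\<Sum>i\<in>UNIV. W a' v' i b d * v' i $ j) = 0" for b d j
    using W[of a v b d j] W[of a' v' b d j] by simp
  then have "(\<Sum>i\<in>UNIV. W a' v' i b d *s v' i) = 0" for b d
    by (simp add: vec_eq_iff sum_component)
  then have "\<exists>\<kappa>. \<forall>i. W a' v' i b d = \<kappa> * c i" for b d
    using frame_relation[OF v', of "\<lambda>i. W a' v' i b d"] by metis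
  then obtain \<kappa> where \<kappa>: "\<And>b d i. W a' v' i b d = \<kappa> b d * c i" by metis
  \<comment> \<open>\<open>W\<close> is the cross product of a'_i and M v'_i, hence orthogonal to
    a'_i. So the vector (\<kappa> 2 3, \<kappa> 3 1, \<kappa> 1 2) is a linear form vanishing at
    every a'_i.\<close>
  have "c i * (a' i $ 3 * \<kappa> 1 2 + a' i $ 1 * \<kappa> 2 3 + a' i $ 2 * \<kappa> 3 1) = 0" for i
  proof -
    have "a' i $ 3 * W a' v' i 1 2 + a' i $ 1 * W a' v' i 2 3 + a' i $ 2 * W a' v' i 3 1 = 0"
      by (simp add: W_def algebra_simps)
    then show ?thesis unfolding \<kappa> by (simp add: algebra_simps)
  qed
  moreover have c: "c i \<noteq> 0" for i using v' by (simp add: frame_def)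
  ultimately have lin: "a' i $ 3 * \<kappa> 1 2 + a' i $ 1 * \<kappa> 2 3 + a' i $ 2 * \<kappa> 3 1 = 0" for i
    by simp
  define w :: "3 \<Rightarrow> complex" where "w b = (if b = 1 then \<kappa> 2 3 else if b = 2 then \<kappa> 3 1 else \<kappa> 1 2)" for b
  have "(\<Sum>b\<in>UNIV. w b * a' i $ b) = 0" for i
    using lin[of i] by (simp add: sum_3 w_def algebra_simps)
  from on_no_conic_annihilator[OF a' this] have w0: "w b = 0" for b .
  have "\<kappa> 1 2 = 0" "\<kappa> 2 3 = 0" "\<kappa> 3 1 = 0"
    using w0[of 1] w0[of 2] w0[of 3] by (simp_all add: w_def)
  then have "W a' v' i 1 2 = 0" "W a' v' i 2 3 = 0" "W a' v' i 3 1 = 0" for i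
    by (simp_all add: \<kappa>)
  then have "\<forall>b d. a' i $ b * apply_cols M (v' i) $ d = a' i $ d * apply_cols M (v' i) $ b" for i
    unfolding W_def by (simp add: forall_3 mult.commute)
  then show ?thesis by (simp add: aligned_def)
qed

text \<open>The v_i span and satisfy only the relation \<open>c\<close>, so images may be prescribed
  freely as long as they satisfy this one relation.\<close>

lemma aligned_exists:
  fixes a :: "'i::finite \<Rightarrow> complex ^ 'l" and v :: "'i \<Rightarrow> complex ^ 'n::finite"
  assumes v: "frame v c" and m: "(\<Sum>i\<in>UNIV. (c i * m i) *s a i) = 0"
  obtains M where "\<And>i. apply_cols M (v i) = m i *s a i"
proof -
  have "\<forall>j. \<exists>s. axis j 1 = (\<Sum>i\<in>UNIV. s i *s v i)" using v unfolding frame_def by blast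
  then obtain s where s: "\<And>j. axis j 1 = (\<Sum>i\<in>UNIV. s j i *s v i)" by metis
  define M where "M j = (\<Sum>i\<in>UNIV. (s j i * m i) *s a i)" for j
  have "apply_cols M (v l) = m l *s a l" for l
  proof -
    define r where "r i = (\<Sum>j\<in>UNIV. v l $ j * s j i)" for i
    have "(\<Sum>i\<in>UNIV. r i *s v i) = (\<Sum>j\<in>UNIV. v l $ j *s (\<Sum>i\<in>UNIV. s j i *s v i))"
      unfolding r_def vec_eq_iff by (simp add: sum_component sum_distrib_left sum_distrib_right mult.assoc)
        (subst sum.swap, simp)
    also have "\<dots> = v l"
      unfolding s[symmetric] by (simp add: vec_eq_iff sum_component axis_def if_distrib cong: if_cong)
    finally have r: "(\<Sum>i\<in>UNIV. r i *s v i) = v l" .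
    \<comment> \<open>The coefficients \<open>r\<close> express v_l, but may differ from the obvious
      ones by a multiple of \<open>c\<close>; hypothesis \<open>m\<close> makes that multiple
      harmless.\<close>
    have "(\<Sum>i\<in>UNIV. (r i - of_bool (i = l)) *s v i) = 0"
      using r by (simp add: vec_eq_iff sum_component left_diff_distrib sum_subtractf)
    from frame_relation[OF v this] obtain \<kappa> where
      \<kappa>: "\<And>i. r i - of_bool (i = l) = \<kappa> * c i" by blast
    then have ri: "r i = of_bool (i = l) + \<kappa> * c i" for i by (metis add.commute diff_add_cancel)
    have "apply_cols M (v l) = (\<Sum>i\<in>UNIV. (r i * m i) *s a i)"
      unfolding apply_cols_def M_def r_def vec_eq_iff
      by (simp add: sum_component sum_distrib_left sum_distrib_right mult.assoc)
        (subst sum.swap, simp)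
    also have "\<dots> = m l *s a l + \<kappa> *s (\<Sum>i\<in>UNIV. (c i * m i) *s a i)"
      unfolding ri vec_eq_iff
      by (simp add: sum_component distrib_right sum.distrib sum_distrib_left mult.assoc)
    finally show ?thesis by (simp add: m)
  qed
  then show thesis by (rule that)
qed

text \<open>A functional on coefficient vectors that kills the relations among the a_i descends to a
  linear form on the space they span.\<close>

lemma factors_through_span:
  fixes a :: "'i::finite \<Rightarrow> complex ^ 'l::finite"
  assumes a: "\<And>y. \<exists>z. (\<Sum>i\<in>UNIV. z i *s a i) = y"
    and r: "\<And>z. (\<Sum>i\<in>UNIV. z i *s a i) = 0 \<Longrightarrow> (\<Sum>i\<in>UNIV. z i * r i) = 0"
  obtains \<mu> where "\<And>i. r i = (\<Sum>b\<in>UNIV. \<mu> b * a i $ b)"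
proof -
  have "\<forall>b. \<exists>z. (\<Sum>i\<in>UNIV. z i *s a i) = axis b 1" using a by simp
  then obtain z where z: "\<And>b. (\<Sum>i\<in>UNIV. z b i *s a i) = axis b 1" by metis
  define \<mu> where "\<mu> b = (\<Sum>i\<in>UNIV. z b i * r i)" for b
  have "r l = (\<Sum>b\<in>UNIV. \<mu> b * a l $ b)" for l
  proof -
    \<comment> \<open>The relation expressing a_l through the chosen preimages of the standard
      basis.\<close>
    define x where "x i = of_bool (i = l) - (\<Sum>b\<in>UNIV. a l $ b * z b i)" for i
    have "(\<Sum>i\<in>UNIV. (\<Sum>b\<in>UNIV. a l $ b * z b i) *s a i) = (\<Sum>b\<in>UNIV. a l $ b *s (\<Sum>i\<in>UNIV. z b i *s a i))"
      unfolding vec_eq_iff by (simp add: sum_component sum_distrib_left sum_distrib_right mult.assoc)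
        (subst sum.swap, simp)
    also have "\<dots> = a l"
      unfolding z by (simp add: vec_eq_iff sum_component axis_def if_distrib cong: if_cong)
    finally have "(\<Sum>i\<in>UNIV. (\<Sum>b\<in>UNIV. a l $ b * z b i) *s a i) = a l" .
    then have "(\<Sum>i\<in>UNIV. x i *s a i) = 0"
      by (simp add: x_def vec_eq_iff sum_component left_diff_distrib sum_subtractf)
    from r[OF this] have "r l = (\<Sum>i\<in>UNIV. (\<Sum>b\<in>UNIV. a l $ b * z b i) * r i)"
      by (simp add: x_def left_diff_distrib sum_subtractf)
    also have "\<dots> = (\<Sum>b\<in>UNIV. \<mu> b * a l $ b)"
      unfolding \<mu>_def sum_distrib_right by (subst sum.swap) (simp add: mult_ac)
    finally show ?thesis .
  qed
  then show thesis by (rule that)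
qed

text \<open>In the application \<open>\<alpha>\<close> is a vector a'_k of the second decomposition
  and \<open>\<sigma> i\<close> the ratio s_i / c_i. The exceptional index belongs to the point a_i,
  if there is one, that coincides with \<open>\<alpha>\<close>.\<close>

lemma proportional_at_most_one_exception:
  fixes a :: "'i::finite \<Rightarrow> complex ^ 3"
  assumes a: "on_no_conic a" "pairwise_distinct_pts a" and \<alpha>: "\<alpha> \<noteq> 0"
    and H: "\<And>z b d. (\<Sum>i\<in>UNIV. z i *s a i) = 0 \<Longrightarrow>
       \<alpha> $ b * (\<Sum>i\<in>UNIV. (\<sigma> i * z i) *s a i) $ d = \<alpha> $ d * (\<Sum>i\<in>UNIV. (\<sigma> i * z i) *s a i) $ b"
  obtains \<tau> i0 where "\<And>i. i \<noteq> i0 \<Longrightarrow> \<sigma> i = \<tau>"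
proof -
  obtain b where b: "\<alpha> $ b \<noteq> 0" using \<alpha> by (auto simp: vec_eq_iff)
  obtain d e where de: "UNIV = {b, d, e}" "b \<noteq> d" "b \<noteq> e" "d \<noteq> (e :: 3)"
  proof -
    consider "b = 1" | "b = 2" | "b = 3" using exhaust_3 by blast
    then show thesis
    proof cases
      case 1
      show thesis by (rule that[of 2 3], unfold 1 UNIV_3) simp_all
    next
      case 2
      have "UNIV = {2, 1, 3 :: 3}" unfolding UNIV_3 by (rule insert_commute)
      then show thesis by (intro that[of 1 3], unfold 2) simp_all
    next
      case 3
      have "UNIV = {3, 1, 2 :: 3}" unfolding UNIV_3 by blast
      then show thesis by (intro that[of 1 2], unfold 3) simp_all
    qed
  qed
  have sum3: "(\<Sum>b\<in>UNIV. f b) = f b + f d + f e" for f :: "3 \<Rightarrow> complex"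
    unfolding de(1) using de(2-) by (simp add: add.assoc)
  define k where "k = \<alpha> $ b"
  \<comment> \<open>As \<open>k\<close> is nonzero, \<open>p\<close> and \<open>q\<close> are
    independent forms whose common zeros are the multiples of \<open>\<alpha>\<close>.\<close>
  define p where "p x = k * x $ d - \<alpha> $ d * x $ b" for x
  define q where "q x = k * x $ e - \<alpha> $ e * x $ b" for x
  have k: "k \<noteq> 0" using b by (simp add: k_def)
  have span: "\<exists>z. (\<Sum>i\<in>UNIV. z i *s a i) = y" for y
    by (rule on_no_conic_span[OF a(1)]) blast
  have ker: "(\<Sum>i\<in>UNIV. z i * (\<sigma> i * (k * a i $ c - \<alpha> $ c * a i $ b))) = 0"
    if "(\<Sum>i\<in>UNIV. z i *s a i) = 0" for z c
    using H[OF that, of b c]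
    by (simp add: sum_component sum_distrib_left right_diff_distrib sum_subtractf k_def mult_ac)
  from factors_through_span[of a "\<lambda>i. \<sigma> i * p (a i)", OF span ker[of _ d, folded p_def]]
  obtain m where m: "\<And>i. \<sigma> i * p (a i) = (\<Sum>c\<in>UNIV. m c * a i $ c)" by blast
  from factors_through_span[of a "\<lambda>i. \<sigma> i * q (a i)", OF span ker[of _ e, folded q_def]]
  obtain n where n: "\<And>i. \<sigma> i * q (a i) = (\<Sum>c\<in>UNIV. n c * a i $ c)" by blast
  define \<mu> where "\<mu> x = (\<Sum>c\<in>UNIV. m c * x $ c)" for x :: "complex ^ 3"
  define \<nu> where "\<nu> x = (\<Sum>c\<in>UNIV. n c * x $ c)" for x :: "complex ^ 3"
  \<comment> \<open>Coefficients, not symmetrized, of the quadratic form p \<nu> - q \<mu>; the last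
    case is the row of the coordinate \<open>b\<close>.\<close>
  define B where "B c f = (if c = d then k * n f else if c = e then - k * m f
     else - \<alpha> $ d * n f + \<alpha> $ e * m f)" for c f
  have Bq: "p x * \<nu> x - q x * \<mu> x = (\<Sum>c\<in>UNIV. \<Sum>f\<in>UNIV. B c f * (x $ c * x $ f))" for x
    unfolding \<nu>_def \<mu>_def sum3 p_def q_def B_def using de(2-)
    by (simp add: algebra_simps)
  have Ba: "p (a i) * \<nu> (a i) - q (a i) * \<mu> (a i) = 0" for i
    using m[of i] n[of i] by (simp add: \<mu>_def \<nu>_def flip: m n)
  \<comment> \<open>The square of any \<open>x\<close> is a combination of the squares of the a_i,
    where the quadratic form vanishes.\<close>
  have conic: "p x * \<nu> x = q x * \<mu> x" for x
  proof -
    obtain z where z: "\<And>c f. (\<Sum>i\<in>UNIV. z i * (a i $ c * a i $ f)) = uprod_mult (($) x) (Upair c f)"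
      using a(1) unfolding on_no_conic_def by meson
    have "p x * \<nu> x - q x * \<mu> x = (\<Sum>c\<in>UNIV. \<Sum>f\<in>UNIV. B c f * (\<Sum>i\<in>UNIV. z i * (a i $ c * a i $ f)))"
      unfolding Bq z by simp
    also have "\<dots> = (\<Sum>i\<in>UNIV. z i * (\<Sum>c\<in>UNIV. \<Sum>f\<in>UNIV. B c f * (a i $ c * a i $ f)))"
      unfolding sum3 by (simp add: sum_distrib_left sum.distrib algebra_simps)
    also have "\<dots> = 0" unfolding Bq[symmetric] Ba by simp
    finally show ?thesis by simp
  qed
  have lin: "\<mu> (x + y) = \<mu> x + \<mu> y" "\<nu> (x + y) = \<nu> x + \<nu> y" "p (x + y) = p x + p y" "q (x + y) = q x + q y"
    "\<mu> (c *s x) = c * \<mu> x" "\<nu> (c *s x) = c * \<nu> x" for x y c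
    by (simp_all add: \<mu>_def \<nu>_def p_def q_def sum3 algebra_simps)
  \<comment> \<open>Together with \<open>\<alpha>\<close> these form a basis adapted to
    \<open>p\<close> and \<open>q\<close>. Testing the identity \<open>conic\<close> on sums of
    basis vectors shows that (\<mu>, \<nu>) is a multiple of (p, q).\<close>
  define f1 :: "complex ^ 3" where "f1 = axis d 1"
  define f2 :: "complex ^ 3" where "f2 = axis e 1"
  have pq: "p \<alpha> = 0" "q \<alpha> = 0" "p f1 = k" "q f1 = 0" "p f2 = 0" "q f2 = k"
    using de(2-) by (auto simp: p_def q_def f1_def f2_def k_def axis_def)
  have nu1: "\<nu> f1 = 0" using conic[of f1] k by (simp add: pq)
  have mu2: "\<mu> f2 = 0" using conic[of f2] k by (simp add: pq)
  have nu0: "\<nu> \<alpha> = 0" using conic[of "f1 + \<alpha>"] k nu1 by (simp add: pq lin)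
  have mu0: "\<mu> \<alpha> = 0" using conic[of "f2 + \<alpha>"] k mu2 by (simp add: pq lin)
  have munu: "\<mu> f1 = \<nu> f2" using conic[of "f1 + f2"] k nu1 mu2 by (simp add: pq lin)
  have decomp: "x = (x $ b / k) *s \<alpha> + ((p x / k) *s f1 + (q x / k) *s f2)" for x
  proof -
    have "x $ c = ((x $ b / k) *s \<alpha> + ((p x / k) *s f1 + (q x / k) *s f2)) $ c" for c
    proof -
      have "c \<in> {b, d, e}" using de(1) by auto
      then show ?thesis using k de(2-)
        by (auto simp: f1_def f2_def axis_def p_def q_def k_def field_simps)
    qed
    then show ?thesis unfolding vec_eq_iff by blast
  qed
  define \<tau> where "\<tau> = \<mu> f1 / k"
  have mu: "\<mu> x = \<tau> * p x" for x
    using arg_cong[OF decomp[of x], of \<mu>] unfolding lin mu0 mu2 by (simp add: \<tau>_def)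
  have nu: "\<nu> x = \<tau> * q x" for x
    using arg_cong[OF decomp[of x], of \<nu>] unfolding lin nu0 nu1 by (simp add: \<tau>_def munu)
  have exc: "p (a i) = 0 \<and> q (a i) = 0" if "\<sigma> i \<noteq> \<tau>" for i
  proof -
    have "(\<sigma> i - \<tau>) * p (a i) = 0" "(\<sigma> i - \<tau>) * q (a i) = 0"
      using m[of i] n[of i] mu[of "a i"] nu[of "a i"] by (simp_all add: \<mu>_def \<nu>_def algebra_simps)
    with that show ?thesis by simp
  qed
  have unique: "i = j" if "\<sigma> i \<noteq> \<tau>" "\<sigma> j \<noteq> \<tau>" for i j
  proof (rule ccontr)
    assume "i \<noteq> j"
    then obtain c f where cf: "a i $ c * a j $ f \<noteq> a i $ f * a j $ c"
      using a(2) unfolding pairwise_distinct_pts_def by blast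
    define r s where "r = a i $ b / k" and "s = a j $ b / k"
    have "a i = r *s \<alpha>" "a j = s *s \<alpha>"
      using decomp[of "a i"] decomp[of "a j"] exc[OF that(1)] exc[OF that(2)]
      by (simp_all add: r_def s_def)
    with cf show False by (simp add: mult_ac)
  qed
  show thesis
  proof (cases "\<exists>i. \<sigma> i \<noteq> \<tau>")
    case True
    then obtain i0 where "\<sigma> i0 \<noteq> \<tau>" by blast
    with unique show ?thesis by (intro that[of i0 \<tau>]) blast
  next
    case False
    then show ?thesis by (intro that[of undefined \<tau>]) blast
  qed
qed

text \<open>A relation between two of the vectors is a multiple of \<open>c\<close> that vanishes at
  a third index, where \<open>c\<close> does not, so the multiple is zero.\<close>

lemma frame_not_parallel:
  fixes v :: "'i::finite \<Rightarrow> complex ^ 'n"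
  assumes v: "frame v c" and card: "CARD('i) \<ge> 3" and ij: "i \<noteq> j" and rel: "r *s v i = s *s v j"
  shows "r = 0 \<and> s = 0"
proof -
  define w where "w l = (if l = i then r else if l = j then - s else 0)" for l
  have "(\<Sum>l\<in>UNIV. w l *s v l) = (\<Sum>l\<in>{i, j}. w l *s v l)"
    by (rule sum.mono_neutral_right) (auto simp: w_def)
  also have "\<dots> = 0" using ij rel by (simp add: w_def)
  finally have "(\<Sum>l\<in>UNIV. w l *s v l) = 0" .
  from frame_relation[OF v this] obtain \<kappa> where \<kappa>: "\<And>l. w l = \<kappa> * c l" by blast
  have "card {i, j} < CARD('i)" using card ij by simp
  then obtain l where "l \<notin> {i, j}" by (metis UNIV_eq_I card_seteq finite nat_neq_iff subset_UNIV)
  then have "\<kappa> * c l = 0" using \<kappa>[of l] by (simp add: w_def)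
  then have "\<kappa> = 0" using v by (simp add: frame_def)
  then show ?thesis using \<kappa>[of i] \<kappa>[of j] ij by (simp add: w_def)
qed

lemma frame_nonzero:
  fixes v :: "'i::finite \<Rightarrow> complex ^ 'n"
  assumes v: "frame v c" and card: "CARD('i) \<ge> 3"
  shows "v i \<noteq> 0"
proof
  assume "v i = 0"
  have "card {i} < CARD('i)" using card by simp
  then obtain j where "j \<notin> {i}" by (metis UNIV_eq_I card_seteq finite nat_neq_iff subset_UNIV)
  then have "i \<noteq> j" by auto
  from frame_not_parallel[OF v card this, of 1 0] \<open>v i = 0\<close> show False by simp
qed

text \<open>Fixing one coordinate turns the hypothesis into linear relations among the v_i, so r_i
  v_i = c_i \<kappa> with a single vector \<kappa>. Hence r_i v_i and r_j v_j are parallel, which is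
  impossible for nonzero r_i.\<close>

lemma frame_squares_independent:
  fixes v :: "'i::finite \<Rightarrow> complex ^ 'n"
  assumes v: "frame v c" and card: "CARD('i) \<ge> 3"
    and r: "\<And>j l. (\<Sum>i\<in>UNIV. r i * (v i $ j * v i $ l)) = 0"
  shows "r i = 0"
proof (rule ccontr)
  assume ri: "r i \<noteq> 0"
  have "(\<Sum>i\<in>UNIV. (r i * v i $ l) *s v i) = 0" for l
    using r by (simp add: vec_eq_iff sum_component mult_ac)
  then have "\<exists>\<kappa>. \<forall>i. r i * v i $ l = \<kappa> * c i" for l
    using frame_relation[OF v, of "\<lambda>i. r i * v i $ l"] by metis
  then obtain \<kappa> where \<kappa>: "\<And>i l. r i * v i $ l = \<kappa> l * c i" by metis
  have "card {i} < CARD('i)" using card by simp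
  then obtain j where "j \<notin> {i}" by (metis UNIV_eq_I card_seteq finite nat_neq_iff subset_UNIV)
  then have "i \<noteq> j" by auto
  have "(c j * r i) *s v i = (c i * r j) *s v j"
    using \<kappa> by (simp add: vec_eq_iff mult_ac)
  from frame_not_parallel[OF v card \<open>i \<noteq> j\<close> this] ri v show False by (simp add: frame_def)
qed

lemma pairwise_distinct_pts_nonzero:
  fixes a :: "'i::finite \<Rightarrow> complex ^ 'l"
  assumes a: "pairwise_distinct_pts a" and card: "CARD('i) \<ge> 2"
  shows "a i \<noteq> 0"
proof -
  have "card {i} < CARD('i)" using card by simp
  then obtain j where "j \<notin> {i}" by (metis UNIV_eq_I card_seteq finite nat_neq_iff subset_UNIV)
  then obtain b d where "a i $ b * a j $ d \<noteq> a i $ d * a j $ b"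
    using a unfolding pairwise_distinct_pts_def by (metis singletonI)
  then show ?thesis by auto
qed

text \<open>The conic argument matches the points v'_k with the v_i up to scalars; independence of
  the squares then matches the first factors. The scalars cancel in the rank-one summands, which is
  why these, and not the vectors, are compared.\<close>

theorem decomposition_unique:
  fixes a a' :: "'i::finite \<Rightarrow> complex ^ 3" and v v' :: "'i \<Rightarrow> complex ^ 'n::finite"
  assumes card: "CARD('i) \<ge> 3"
    and gen: "frame v c" "on_no_conic a" "pairwise_distinct_pts a"
    and gen': "frame v' c'" "on_no_conic a'" "pairwise_distinct_pts a'"
    and T: "same_tensor a v a' v'"
  obtains \<pi> where "bij \<pi>"
    "\<And>i b j l. a' i $ b * (v' i $ j * v' i $ l) = a (\<pi> i) $ b * (v (\<pi> i) $ j * v (\<pi> i) $ l)"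
proof -
  have c: "c i \<noteq> 0" "(\<Sum>i\<in>UNIV. c i *s v i) = 0" for i using gen(1) by (auto simp: frame_def)
  have "\<exists>i \<rho>. v' k = \<rho> *s v i" for k
  proof -
    obtain s where s: "v' k = (\<Sum>i\<in>UNIV. s i *s v i)" using gen(1) unfolding frame_def by blast
    have a'k: "a' k \<noteq> 0" using card by (intro pairwise_distinct_pts_nonzero[OF gen'(3)]) simp
    have H: "a' k $ b * (\<Sum>i\<in>UNIV. (s i / c i * z i) *s a i) $ d =
         a' k $ d * (\<Sum>i\<in>UNIV. (s i / c i * z i) *s a i) $ b"
      if z: "(\<Sum>i\<in>UNIV. z i *s a i) = 0" for z b d
    proof -
      \<comment> \<open>A relation \<open>z\<close> among the a_i yields a matrix of the kernel by
        means of m_i = z_i / c_i.\<close>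
      from z have "(\<Sum>i\<in>UNIV. (c i * (z i / c i)) *s a i) = 0" using c by simp
      from aligned_exists[OF gen(1) this] obtain M where M: "\<And>i. apply_cols M (v i) = (z i / c i) *s a i" by blast
      then have "aligned a v M" by (simp add: aligned_def)
      from aligned_transfer[OF T gen'(1,2) this]
      have "a' k $ b * apply_cols M (v' k) $ d = a' k $ d * apply_cols M (v' k) $ b"
        by (simp add: aligned_def)
      moreover have "apply_cols M (v' k) = (\<Sum>i\<in>UNIV. (s i / c i * z i) *s a i)"
        unfolding s apply_cols_sum M by (simp add: vector_smult_assoc)
      ultimately show ?thesis by simp
    qed
    obtain \<tau> i0 where \<tau>: "\<And>i. i \<noteq> i0 \<Longrightarrow> s i / c i = \<tau>"
      using proportional_at_most_one_exception[OF gen(2,3) a'k H] by blast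
    \<comment> \<open>Subtracting \<tau> times the relation \<open>c\<close> cancels every
      coefficient except the one at \<open>i0\<close>.\<close>
    have "v' k = (\<Sum>i\<in>UNIV. s i *s v i) - \<tau> *s (\<Sum>i\<in>UNIV. c i *s v i)" using s c by simp
    also have "\<dots> = (\<Sum>i\<in>UNIV. (s i - \<tau> * c i) *s v i)"
      by (simp add: vec_eq_iff sum_component left_diff_distrib sum_subtractf sum_distrib_left mult.assoc)
    also have "\<dots> = (\<Sum>i\<in>{i0}. (s i - \<tau> * c i) *s v i)"
    proof (rule sum.mono_neutral_right)
      show "\<forall>i\<in>UNIV - {i0}. (s i - \<tau> * c i) *s v i = 0"
      proof
        fix i assume "i \<in> UNIV - {i0}"
        then have "s i / c i = \<tau>" using \<tau> by simp
        then show "(s i - \<tau> * c i) *s v i = 0" using c(1)[of i] by (auto simp: field_simps)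
      qed
    qed auto
    also have "\<dots> = (s i0 - \<tau> * c i0) *s v i0" by simp
    finally show ?thesis by blast
  qed
  then obtain \<pi> \<rho> where \<pi>: "\<And>k. v' k = \<rho> k *s v (\<pi> k)" by metis
  have "inj \<pi>"
  proof (rule injI, rule ccontr)
    fix i j assume ij: "\<pi> i = \<pi> j" "i \<noteq> j"
    have "\<rho> j *s v' i = \<rho> i *s v' j" unfolding \<pi> ij(1) by (simp add: vector_smult_assoc mult.commute)
    from frame_not_parallel[OF gen'(1) card ij(2) this] have "v' i = 0" unfolding \<pi> by simp
    then show False using frame_nonzero[OF gen'(1) card] by blast
  qed
  then have bij: "bij \<pi>" using finite_UNIV_inj_surj[of \<pi>] by (simp add: bij_def)
  define \<psi> where "\<psi> = inv \<pi>"
  have \<psi>: "\<pi> (\<psi> i) = i" "\<psi> (\<pi> i) = i" for i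
    using bij by (simp_all add: \<psi>_def bij_is_surj surj_f_inv_f bij_is_inj)
  have diff: "a i $ b - (\<rho> (\<psi> i))\<^sup>2 * a' (\<psi> i) $ b = 0" for i b
  proof (rule frame_squares_independent[OF gen(1) card,
        where r = "\<lambda>i. a i $ b - (\<rho> (\<psi> i))\<^sup>2 * a' (\<psi> i) $ b"])
    fix j l
    have "(\<Sum>i\<in>UNIV. a' i $ b * (v' i $ j * v' i $ l)) =
        (\<Sum>i\<in>UNIV. (\<rho> i)\<^sup>2 * a' i $ b * (v (\<pi> i) $ j * v (\<pi> i) $ l))"
      unfolding \<pi> by (simp add: power2_eq_square mult_ac)
    also have "\<dots> = (\<Sum>i\<in>UNIV. (\<rho> (\<psi> i))\<^sup>2 * a' (\<psi> i) $ b * (v i $ j * v i $ l))"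
      using sum.reindex_bij_betw[OF bij, of "\<lambda>i. (\<rho> (\<psi> i))\<^sup>2 * a' (\<psi> i) $ b * (v i $ j * v i $ l)"]
      by (simp add: \<psi>)
    finally show "(\<Sum>i\<in>UNIV. (a i $ b - (\<rho> (\<psi> i))\<^sup>2 * a' (\<psi> i) $ b) * (v i $ j * v i $ l)) = 0"
      using T by (simp add: same_tensor_def left_diff_distrib sum_subtractf)
  qed
  have ab: "a (\<pi> k) $ b = (\<rho> k)\<^sup>2 * a' k $ b" for k b
    using diff[of "\<pi> k" b] by (simp add: \<psi>)
  show thesis
    by (rule that[OF bij]) (simp add: ab \<pi> power2_eq_square mult_ac)
qed

section \<open>General parameters\<close>

text \<open>Parameters \<open>(a\<^sub>i, v\<^sub>i)\<close> of \<open>n + 1\<close> points, indexed by \<open>'n option\<close>, and a linear form \<open>l\<close>.\<close>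

type_synonym 'n par = "('n option \<times> 3) + ('n option \<times> 'n) + (3 \<times> 'n uprod)"

definition par_a :: "('n par \<Rightarrow> complex) \<Rightarrow> 'n option \<Rightarrow> complex ^ 3" where
  "par_a t i = (\<chi> b. t (Inl (i, b)))"

definition par_v :: "('n::finite par \<Rightarrow> complex) \<Rightarrow> 'n option \<Rightarrow> complex ^ 'n" where
  "par_v t i = (\<chi> j. t (Inr (Inl (i, j))))"

definition par_l :: "('n::finite par \<Rightarrow> complex) \<Rightarrow> complex ^ (3 \<times> 'n uprod)" where
  "par_l t = (\<chi> q. t (Inr (Inr q)))"

definition mk_par :: "('n option \<Rightarrow> complex ^ 3) \<Rightarrow> ('n option \<Rightarrow> complex ^ 'n::finite) \<Rightarrow>
    complex ^ (3 \<times> 'n uprod) \<Rightarrow> 'n par \<Rightarrow> complex" where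
  "mk_par a v l = case_sum (\<lambda>(i, b). a i $ b) (case_sum (\<lambda>(i, j). v i $ j) (($) l))"

lemma par_mk_par [simp]:
  "par_a (mk_par a v l) = a" "par_v (mk_par a v l) = v" "par_l (mk_par a v l) = l"
  by (simp_all add: par_a_def par_v_def par_l_def mk_par_def fun_eq_iff vec_eq_iff)

lemma polyfuns_coord: "(\<lambda>t. t i) \<in> polyfuns coords"
  by (rule polyfuns.coord) simp

lemma polyfuns_par:
  "(\<lambda>t. par_a t i $ b) \<in> polyfuns coords"
  "(\<lambda>t. par_v t i $ j) \<in> polyfuns coords"
  "(\<lambda>t. par_l t $ q) \<in> polyfuns coords"
  by (simp_all add: par_a_def par_v_def par_l_def polyfuns_coord)

lemma polyfuns_det:
  assumes "\<And>i j. (\<lambda>t. A t $ i $ j) \<in> polyfuns C"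
  shows "(\<lambda>t. det (A t :: complex ^ 'n ^ 'n::finite)) \<in> polyfuns C"
  unfolding det_def by (intro polyfuns_intros assms)

lemma polyfuns_uprod_mult:
  assumes "\<And>j. (\<lambda>t. f t j) \<in> polyfuns C"
  shows "(\<lambda>t. uprod_mult (f t) u) \<in> polyfuns C"
  by (cases u) (simp add: polyfuns.mult assms)

lemma polyfuns_prod_nonvanishing:
  assumes "finite I" "\<And>i. i \<in> I \<Longrightarrow> f i \<in> polyfuns coords \<and> (\<exists>t. f i t \<noteq> 0)"
  shows "\<exists>t. (\<Prod>i\<in>I. f i t) \<noteq> 0"
  using assms
proof (induction I rule: finite_induct)
  case (insert i I)
  then have "\<exists>t. f i t \<noteq> 0" "\<exists>u. (\<Prod>i\<in>I. f i u) \<noteq> 0" by simp_all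
  then obtain t u where tu: "f i t \<noteq> 0" "(\<Prod>i\<in>I. f i u) \<noteq> 0" by blast
  have p: "(\<lambda>t. \<Prod>i\<in>I. f i t) \<in> polyfuns coords" "f i \<in> polyfuns coords"
    using insert by (auto intro: polyfuns_prod)
  show ?case
    using nonvanishing_simultaneously[OF p(2,1), OF tu] insert(1,2) by (metis mult_eq_0_iff prod.insert)
qed simp

lemma sum_option: "(\<Sum>i\<in>UNIV. f i) = f None + (\<Sum>j\<in>UNIV. f (Some j))"
  for f :: "'n::finite option \<Rightarrow> 'a::comm_monoid_add"
  unfolding UNIV_option_conv by (subst sum.insert) (auto simp: sum.reindex)

lemma det_nonzero_rows:
  fixes A :: "complex ^ 'n ^ 'n::finite"
  assumes "det A \<noteq> 0"
  shows "\<exists>x. y = (\<Sum>i\<in>UNIV. x i *s row i A)"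
    and "(\<Sum>i\<in>UNIV. x i *s row i A) = 0 \<Longrightarrow> x i = 0"
proof -
  have mult: "transpose A *v x = (\<Sum>i\<in>UNIV. x $ i *s row i A)" for x
    by (simp add: matrix_mult_sum column_transpose)
  have "invertible (transpose A)" using assms by (simp add: invertible_det_nz)
  then obtain B where B: "B ** transpose A = mat 1" "transpose A ** B = mat 1"
    unfolding invertible_def by blast
  have "y = transpose A *v (B *v y)" by (simp add: matrix_vector_mul_assoc B)
  then show "\<exists>x. y = (\<Sum>i\<in>UNIV. x i *s row i A)" unfolding mult by blast
  assume "(\<Sum>i\<in>UNIV. x i *s row i A) = 0"
  then have "transpose A *v (\<chi> i. x i) = 0" unfolding mult by simp
  then have "B *v (transpose A *v (\<chi> i. x i)) = 0" by simp
  then have "(\<chi> i. x i) = 0"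
    unfolding matrix_vector_mul_assoc B matrix_vector_mul_lid .
  then show "x i = 0" by (simp add: vec_eq_iff)
qed

text \<open>By Cramer's rule the coefficients of \<open>v None\<close> in the basis
  \<open>v (Some j)\<close> are quotients of these determinants.\<close>

lemma frame_from_dets:
  fixes v :: "'n::finite option \<Rightarrow> complex ^ 'n"
  assumes d: "det (\<chi> j. v (Some j)) \<noteq> 0"
    and e: "\<And>k. det (\<chi> j. if j = k then v None else v (Some j)) \<noteq> 0"
  shows "\<exists>c. frame v c"
proof -
  define V where "V = (\<chi> j. v (Some j))"
  have row: "row j V = v (Some j)" for j by (simp add: V_def row_def vec_eq_iff)
  have dV: "det V \<noteq> 0" using d by (simp add: V_def)
  obtain x where x: "v None = (\<Sum>j\<in>UNIV. x j *s v (Some j))"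
    using det_nonzero_rows(1)[OF dV, of "v None"] by (auto simp: row)
  have xnz: "x k \<noteq> 0" for k
  proof -
    have "det (\<chi> j. if j = k then v None else v (Some j)) = x k * det V"
      using cramer_lemma_transpose[of k "\<chi> j. x j" V] by (simp only: row vec_lambda_beta x[symmetric])
    with e[of k] show ?thesis by auto
  qed
  define c where "c i = (case i of None \<Rightarrow> - 1 | Some j \<Rightarrow> x j)" for i
  have "frame v c"
    unfolding frame_def
  proof (intro conjI allI impI)
    show "c i \<noteq> 0" for i using xnz by (auto simp: c_def split: option.splits)
    show "(\<Sum>i\<in>UNIV. c i *s v i) = 0"
      unfolding sum_option by (simp add: c_def x[symmetric])
  next
    fix w assume w: "(\<Sum>i\<in>UNIV. w i *s v i) = 0"
    have "(\<Sum>j\<in>UNIV. (w None * x j + w (Some j)) *s row j V) = w None *s v None + (\<Sum>j\<in>UNIV. w (Some j) *s v (Some j))"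
      unfolding x row by (simp add: vec_eq_iff sum_component sum_distrib_left sum.distrib algebra_simps)
    also have "\<dots> = 0" using w by (simp add: sum_option)
    finally have "(\<Sum>j\<in>UNIV. (w None * x j + w (Some j)) *s row j V) = 0" .
    from det_nonzero_rows(2)[OF dV this] have "w None * x j + w (Some j) = 0" for j .
    then have "w (Some j) = - w None * x j" for j by (simp add: eq_neg_iff_add_eq_0 add.commute)
    then have "w i = - w None * c i" for i by (cases i) (simp_all add: c_def)
    then show "\<exists>\<kappa>. \<forall>i. w i = \<kappa> * c i" by blast
  next
    fix y
    obtain s where s: "y = (\<Sum>j\<in>UNIV. s j *s v (Some j))"
      using det_nonzero_rows(1)[OF dV, of y] by (auto simp: row)
    show "\<exists>s. y = (\<Sum>i\<in>UNIV. s i *s v i)"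
      by (rule exI[of _ "\<lambda>i. case i of None \<Rightarrow> 0 | Some j \<Rightarrow> s j"]) (simp add: sum_option s)
  qed
  then show ?thesis by blast
qed

text \<open>The map \<open>\<iota>\<close> picks as many points as there are quadratic monomials,
  which makes the matrix square and its determinant a polynomial condition on the points.\<close>

definition squares_matrix :: "('l uprod \<Rightarrow> 'i) \<Rightarrow> ('i \<Rightarrow> complex ^ 'l) \<Rightarrow> complex ^ ('l uprod) ^ ('l::finite uprod)" where
  "squares_matrix \<iota> a = (\<chi> r u. uprod_mult (($) (a (\<iota> r))) u)"

lemma on_no_conic_from_det:
  fixes a :: "'i::finite \<Rightarrow> complex ^ 'l::finite"
  assumes \<iota>: "inj \<iota>" and d: "det (squares_matrix \<iota> a) \<noteq> 0"
  shows "on_no_conic a"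
  unfolding on_no_conic_def
proof
  fix Q :: "'l uprod \<Rightarrow> complex"
  obtain z where z: "(\<chi> u. Q u) = (\<Sum>r\<in>UNIV. z r *s row r (squares_matrix \<iota> a))"
    using det_nonzero_rows(1)[OF d] by blast
  define z' where "z' i = (if i \<in> range \<iota> then z (inv \<iota> i) else 0)" for i
  have "(\<Sum>i\<in>UNIV. z' i * (a i $ b * a i $ e)) = Q (Upair b e)" for b e
  proof -
    have "(\<Sum>i\<in>UNIV. z' i * (a i $ b * a i $ e)) = (\<Sum>i\<in>range \<iota>. z' i * (a i $ b * a i $ e))"
      by (rule sum.mono_neutral_right) (auto simp: z'_def)
    also have "\<dots> = (\<Sum>r\<in>UNIV. z r * (a (\<iota> r) $ b * a (\<iota> r) $ e))"
      by (subst sum.reindex[OF \<iota>]) (simp add: z'_def inv_f_f[OF \<iota>])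
    also have "\<dots> = (\<chi> u. Q u) $ Upair b e"
      unfolding z by (simp add: sum_component row_def squares_matrix_def)
    finally show ?thesis by simp
  qed
  then show "\<exists>z. \<forall>b d. (\<Sum>i\<in>UNIV. z i * (a i $ b * a i $ d)) = Q (Upair b d)" by blast
qed

text \<open>A quadratic form vanishing at all the points \<open>e\<^sub>b + e\<^sub>d\<close> is zero.\<close>

lemma squares_matrix_nonsingular:
  fixes \<iota> :: "'l::finite uprod \<Rightarrow> 'i"
  assumes \<iota>: "inj \<iota>"
  obtains a where "det (squares_matrix \<iota> a) \<noteq> 0"
proof -
  have "\<forall>u :: 'l uprod. \<exists>b d. u = Upair b d" by (metis uprod_exhaust)
  then obtain \<beta> \<delta> where bd: "\<And>u :: 'l uprod. u = Upair (\<beta> u) (\<delta> u)" by metis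
  define pt :: "'l uprod \<Rightarrow> complex ^ 'l" where "pt u = axis (\<beta> u) 1 + axis (\<delta> u) 1" for u
  have pt: "pt (Upair b d) = axis b 1 + axis d 1" for b d
    using bd[of "Upair b d"] by (auto simp: pt_def add.commute)
  define a where "a i = pt (inv \<iota> i)" for i
  have "q = 0" if q: "squares_matrix \<iota> a *v q = 0" for q
  proof -
    have eq: "(\<Sum>u\<in>UNIV. q $ u * uprod_mult (($) (pt r)) u) = 0" for r
      using q by (simp add: vec_eq_iff matrix_vector_mult_def squares_matrix_def a_def inv_f_f[OF \<iota>] mult.commute)
    have diag: "q $ Upair b b = 0" for b
    proof -
      \<comment> \<open>The point is 2 e_b, where only the square of the coordinate \<open>b\<close>
        survives, with value 4.\<close>
      have "uprod_mult (($) (pt (Upair b b))) u = (if u = Upair b b then 4 else 0)" for u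
        by (cases u) (auto simp: pt axis_def)
      with eq[of "Upair b b"] have "(\<Sum>u\<in>UNIV. q $ u * (if u = Upair b b then 4 else 0)) = 0" by simp
      then show ?thesis by (simp add: if_distrib cong: if_cong)
    qed
    have "q $ Upair b d = 0" if "b \<noteq> d" for b d
    proof -
      have "uprod_mult (($) (pt (Upair b d))) u =
          (if u = Upair b d then 1 else 0) + (if u = Upair b b then 1 else 0) + (if u = Upair d d then 1 else 0)" for u
        using that by (cases u) (auto simp: pt axis_def)
      then have "(\<Sum>u\<in>UNIV. q $ u * ((if u = Upair b d then 1 else 0) +
          (if u = Upair b b then 1 else 0) + (if u = Upair d d then 1 else 0))) = 0"
        using eq[of "Upair b d"] by (simp only:)
      then have "q $ Upair b d + q $ Upair b b + q $ Upair d d = 0"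
        unfolding distrib_left sum.distrib by (simp add: if_distrib[of "times _"] cong: if_cong)
      then show ?thesis by (simp add: diag)
    qed
    with diag have "q $ u = 0" for u by (cases u) metis
    then show "q = 0" by (simp add: vec_eq_iff)
  qed
  then have "invertible (squares_matrix \<iota> a)"
    unfolding invertible_left_inverse matrix_left_invertible_ker by blast
  then show thesis using that by (simp add: invertible_det_nz)
qed

text \<open>Each requirement follows from the nonvanishing of polynomials that are not identically
  zero; their product \<open>h\<close> is not identically zero either and summarizes them
  all.\<close>

lemma general_parameters:
  assumes n: "CARD('n::finite) \<ge> 5"
  obtains h :: "('n::finite par \<Rightarrow> complex) \<Rightarrow> complex" and t0 where "h \<in> polyfuns coords" "h t0 \<noteq> 0"
    "\<And>t. h t \<noteq> 0 \<Longrightarrow> (\<exists>c. frame (par_v t) c) \<and> on_no_conic (par_a t) \<and> pairwise_distinct_pts (par_a t)"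
proof -
  \<comment> \<open>Six quadratic monomials in three variables against n + 1 points: the origin of
    the bound 5.\<close>
  have "CARD(3 uprod) \<le> CARD('n option)" using n by (simp add: card_UNIV_uprod card_UNIV_option)
  then obtain \<iota> :: "3 uprod \<Rightarrow> 'n option" where \<iota>: "inj \<iota>"
    using card_le_inj[of "UNIV :: 3 uprod set" "UNIV :: 'n option set"] by auto
  define h1 where "h1 t = det (\<chi> j. par_v t (Some j))" for t :: "'n par \<Rightarrow> complex"
  define h2 where "h2 k t = det (\<chi> j. if j = k then par_v t None else par_v t (Some j))"
    for k and t :: "'n par \<Rightarrow> complex"
  define h3 where "h3 t = det (squares_matrix \<iota> (par_a t))" for t :: "'n par \<Rightarrow> complex"
  define D where "D = {(i :: 'n option, j). i \<noteq> j}"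
  \<comment> \<open>One of the three minors is enough to separate two points.\<close>
  define h4 where "h4 p t = par_a t (fst p) $ 1 * par_a t (snd p) $ 2 - par_a t (fst p) $ 2 * par_a t (snd p) $ 1"
    for p and t :: "'n par \<Rightarrow> complex"
  \<comment> \<open>The standard basis on \<open>Some j\<close>. The value at \<open>None\<close> is
    unspecified; it is overwritten in the determinants that involve it.\<close>
  define V0 :: "'n option \<Rightarrow> complex ^ 'n" where "V0 i = axis (the i) 1" for i
  have mat1: "(\<chi> j. axis j 1) = (mat 1 :: complex ^ 'n ^ 'n)"
    by (simp add: vec_eq_iff mat_def axis_def)
  have p1: "h1 \<in> polyfuns coords"
    unfolding h1_def by (intro polyfuns_det) (simp add: polyfuns_par)
  have n1: "\<exists>t. h1 t \<noteq> 0"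
    by (rule exI[of _ "mk_par (\<lambda>_. 0) V0 0"]) (simp add: h1_def V0_def mat1)
  have p2: "h2 k \<in> polyfuns coords" for k
    unfolding h2_def
  proof (rule polyfuns_det)
    fix i j
    show "(\<lambda>t. (\<chi> j. if j = k then par_v t None else par_v t (Some j)) $ i $ j) \<in> polyfuns coords"
      by (cases "i = k") (simp_all add: polyfuns_par)
  qed
  have n2: "\<exists>t. h2 k t \<noteq> 0" for k
  proof (rule exI[of _ "mk_par (\<lambda>_. 0) (V0(None := axis k 1)) 0"])
    have "(\<chi> j. if j = k then (V0(None := axis k 1)) None else (V0(None := axis k 1)) (Some j)) = mat 1"
      by (simp add: vec_eq_iff mat_def axis_def V0_def)
    then show "h2 k (mk_par (\<lambda>_. 0) (V0(None := axis k 1)) 0) \<noteq> 0"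
      by (simp only: h2_def par_mk_par) simp
  qed
  have p3: "h3 \<in> polyfuns coords"
    unfolding h3_def by (intro polyfuns_det) (simp add: squares_matrix_def polyfuns_uprod_mult polyfuns_par)
  have n3: "\<exists>t. h3 t \<noteq> 0"
  proof -
    obtain a where "det (squares_matrix \<iota> a) \<noteq> 0" using squares_matrix_nonsingular[OF \<iota>] .
    then show ?thesis by (intro exI[of _ "mk_par a V0 0"]) (simp add: h3_def)
  qed
  have p4: "h4 p \<in> polyfuns coords" for p
    unfolding h4_def by (intro polyfuns_intros polyfuns_par)
  have n4: "\<exists>t. h4 p t \<noteq> 0" if "p \<in> D" for p
    using that by (intro exI[of _ "mk_par (\<lambda>i. if i = fst p then axis 1 1 else axis 2 1) V0 0"])
      (auto simp: h4_def D_def axis_def)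
  define f where "f m t = (case m of Inl (_ :: unit) \<Rightarrow> h1 t * h3 t | Inr (Inl k) \<Rightarrow> h2 k t | Inr (Inr p) \<Rightarrow> h4 p t)" for m t
  define I where "I = insert (Inl ()) (Inr ` (range (Inl :: 'n \<Rightarrow> _) \<union> Inr ` D))"
  have f: "f m \<in> polyfuns coords \<and> (\<exists>t. f m t \<noteq> 0)" if "m \<in> I" for m
  proof -
    obtain t u where tu: "h1 t \<noteq> 0" "h3 u \<noteq> 0" using n1 n3 by blast
    have "\<exists>w. h1 w * h3 w \<noteq> 0"
      using nonvanishing_simultaneously[OF p1 p3, OF tu] by (metis mult_eq_0_iff)
    moreover have "f (Inl ()) = (\<lambda>t. h1 t * h3 t)" "f (Inr (Inl k)) = h2 k" "f (Inr (Inr p)) = h4 p" for k p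
      by (simp_all add: f_def fun_eq_iff)
    ultimately show ?thesis
      using that polyfuns.mult[OF p1 p3] p2 p4 n2 n4 unfolding I_def by auto
  qed
  have "finite I" unfolding I_def by simp
  from polyfuns_prod_nonvanishing[of I f, OF this f] obtain t0 where t0: "(\<Prod>m\<in>I. f m t0) \<noteq> 0" by blast
  show thesis
  proof (rule that[of "\<lambda>t. \<Prod>m\<in>I. f m t" t0])
    show "(\<lambda>t. \<Prod>m\<in>I. f m t) \<in> polyfuns coords" using f by (intro polyfuns_prod) blast
    fix t assume "(\<Prod>m\<in>I. f m t) \<noteq> 0"
    then have fm: "f m t \<noteq> 0" if "m \<in> I" for m using that \<open>finite I\<close> by (auto simp: prod_zero_iff)
    have "h1 t \<noteq> 0" "h3 t \<noteq> 0" using fm[of "Inl ()"] by (auto simp: f_def I_def)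
    moreover have "h2 k t \<noteq> 0" for k using fm[of "Inr (Inl k)"] by (auto simp: f_def I_def)
    moreover have "h4 p t \<noteq> 0" if "p \<in> D" for p using fm[of "Inr (Inr p)"] that by (auto simp: f_def I_def)
    then have "pairwise_distinct_pts (par_a t)"
      unfolding pairwise_distinct_pts_def h4_def D_def by force
    ultimately show "(\<exists>c. frame (par_v t) c) \<and> on_no_conic (par_a t) \<and> pairwise_distinct_pts (par_a t)"
      unfolding h1_def h2_def h3_def using frame_from_dets on_no_conic_from_det[OF \<iota>] by blast
  qed (rule t0)
qed

section \<open>Zariski closures\<close>

text \<open>The components are the coefficients of \<open>F (c *s v)\<close> as a polynomial in
  \<open>c\<close>; their scaling law comes from comparing coefficients after the substitution of a
  multiple of the variable.\<close>

lemma homogeneous_components: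
  fixes F :: "complex ^ 'm \<Rightarrow> complex"
  assumes "F \<in> polyfuns vcoords"
  obtains G where "\<And>v c. poly (G v) c = F (c *s v)" "\<And>d. (\<lambda>v. coeff (G v) d) \<in> homog_polys"
    "\<And>c d v. coeff (G (c *s v)) d = c ^ d * coeff (G v) d"
proof -
  have "\<exists>G. (\<forall>v c. poly (G v) c = f (c *s v)) \<and> (\<forall>d. (\<lambda>v. coeff (G v) d) \<in> polyfuns vcoords)"
    if "f \<in> vcoords" for f :: "complex ^ 'm \<Rightarrow> complex"
  proof -
    from that obtain j where f: "f = (\<lambda>v. v $ j)" by auto
    have "(\<lambda>v. coeff [:0, v $ j:] d) \<in> polyfuns vcoords" for d
    proof -
      have eq: "(\<lambda>v. coeff [:0, v $ j:] d) = (if d = 1 then (\<lambda>v. v $ j) else (\<lambda>_. 0))"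
        by (auto simp: fun_eq_iff coeff_pCons split: nat.splits)
      show ?thesis unfolding eq by (auto intro: polyfuns.intros)
    qed
    then show ?thesis by (intro exI[of _ "\<lambda>v. [:0, v $ j:]"]) (simp add: f)
  qed
  from polyfuns_along_family[OF assms, of "\<lambda>v c. c *s v", OF this] obtain G where
    G: "\<And>v c. poly (G v) c = F (c *s v)" "\<And>d. (\<lambda>v. coeff (G v) d) \<in> polyfuns vcoords" by blast
  have scale: "coeff (G (c *s v)) d = c ^ d * coeff (G v) d" for c d v
  proof -
    have "poly (G (c *s v)) = poly (pcompose (G v) [:0, c:])"
      by (simp add: fun_eq_iff G poly_pcompose vector_smult_assoc mult.commute)
    then have "G (c *s v) = pcompose (G v) [:0, c:]" by (simp add: poly_eq_poly_eq_iff)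
    then show ?thesis by (simp add: coeff_pcompose_linear)
  qed
  then have "(\<lambda>v. coeff (G v) d) \<in> homog_polys" for d
    using G(2) unfolding homog_polys_def by blast
  with G scale show thesis by (intro that) auto
qed

lemma hcoords_nonempty: "\<exists>v. v \<in> hcoords x"
proof (rule ccontr)
  assume "\<nexists>v. v \<in> hcoords x"
  then have "line_of x \<subseteq> {0}" by (auto simp: hcoords_def)
  then have "vec.dim (line_of x) = 0" by (simp add: vec.dim_eq_0)
  moreover have "vec.dim (line_of x) = 1" using line_of[of x] by auto
  ultimately show False by (metis zero_neq_one)
qed

lemma line_of_eq_span:
  assumes "v \<in> hcoords x"
  shows "line_of x = vec.span {v}"
proof -
  have sub: "vec.subspace (line_of x)" "vec.dim (line_of x) = 1" using line_of[of x] by auto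
  have v: "v \<in> line_of x" "v \<noteq> 0" using assms by (auto simp: hcoords_def)
  have "vec.independent {v}" using v by simp
  then have "line_of x \<subseteq> vec.span {v}"
    using v sub by (intro vec.card_ge_dim_independent) auto
  moreover have "vec.span {v} \<subseteq> line_of x" using v sub by (simp add: vec.span_minimal)
  ultimately show ?thesis by blast
qed

lemma hcoords_parallel:
  assumes "v \<in> hcoords x" "w \<in> hcoords x"
  obtains c where "c \<noteq> 0" "w = c *s v"
proof -
  have "w \<in> vec.span {v}" "w \<noteq> 0"
    using line_of_eq_span[OF assms(1)] assms(2) by (auto simp: hcoords_def)
  then obtain c where "w = c *s v" by (auto simp: vec.span_singleton)
  with \<open>w \<noteq> 0\<close> show thesis by (intro that[of c]) auto
qed

lemma hcoords_scale:
  assumes "v \<in> hcoords x" "c \<noteq> 0"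
  shows "c *s v \<in> hcoords x"
proof -
  have "vec.subspace (line_of x)" using line_of[of x] by auto
  with assms show ?thesis by (simp add: hcoords_def vec.subspace_scale)
qed

lemma hcoords_unique: "v \<in> hcoords x \<Longrightarrow> v \<in> hcoords y \<Longrightarrow> x = y"
  by (metis line_of_eq_span line_of_inject)

lemma hcoords_nonzero: "v \<in> hcoords x \<Longrightarrow> v \<noteq> 0"
  by (simp add: hcoords_def)

lemma point_exists:
  assumes "v \<noteq> 0"
  obtains x where "v \<in> hcoords x"
proof -
  have "vec.dim (vec.span {v}) = 1"
    using assms by (simp add: vec.dim_eq_card_independent)
  then have "line_of (Abs_proj (vec.span {v})) = vec.span {v}"
    by (intro Abs_proj_inverse) (simp add: vec.subspace_span)
  then have "v \<in> hcoords (Abs_proj (vec.span {v}))"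
    using assms by (simp add: hcoords_def vec.span_base)
  then show thesis by (rule that)
qed

lemma homog_nonvanishing:
  assumes "F \<in> homog_polys" "v \<in> hcoords x" "F v \<noteq> 0" "w \<in> hcoords x"
  shows "F w \<noteq> 0"
proof -
  obtain c where c: "c \<noteq> 0" "w = c *s v" using hcoords_parallel[OF assms(2,4)] .
  obtain d where "\<And>c v. F (c *s v) = c ^ d * F v" using assms(1) by (auto simp: homog_polys_def)
  with c assms(3) show ?thesis by simp
qed

lemma homog_polys_const: "(\<lambda>_. c) \<in> homog_polys"
  unfolding homog_polys_def by (auto intro!: polyfuns.const exI[of _ 0])

lemma homog_polys_mult:
  assumes "F \<in> homog_polys" "G \<in> homog_polys"
  shows "(\<lambda>v. F v * G v) \<in> homog_polys"
proof -
  from assms obtain d e where "\<And>c v. F (c *s v) = c ^ d * F v" "\<And>c v. G (c *s v) = c ^ e * G v"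
    by (auto simp: homog_polys_def)
  then have "F (c *s v) * G (c *s v) = c ^ (d + e) * (F v * G v)" for c v
    by (simp add: power_add mult_ac)
  with assms show ?thesis unfolding homog_polys_def by (auto intro: polyfuns.mult)
qed

lemma openin_zariski_nonvanishing:
  "F \<in> homog_polys \<Longrightarrow> openin zariski {x. \<forall>v\<in>hcoords x. F v \<noteq> 0}"
  unfolding zariski_def by (rule topology_generated_by_Basis) blast

lemma topspace_zariski [simp]: "topspace zariski = UNIV"
  using openin_subset[OF openin_zariski_nonvanishing[OF homog_polys_const[of 1]]] by auto

lemma zariski_basis:
  assumes "openin zariski O'" "x \<in> O'"
  obtains F where "F \<in> homog_polys" "\<forall>v\<in>hcoords x. F v \<noteq> 0" "{y. \<forall>v\<in>hcoords y. F v \<noteq> 0} \<subseteq> O'"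
proof -
  have "generate_topology_on {{x. \<forall>v\<in>hcoords x. F v \<noteq> 0} | F. F \<in> homog_polys} O'"
    using assms(1) by (simp add: zariski_def openin_topology_generated_by_iff)
  then have "\<exists>F\<in>homog_polys. (\<forall>v\<in>hcoords x. F v \<noteq> 0) \<and> {y. \<forall>v\<in>hcoords y. F v \<noteq> 0} \<subseteq> O'"
    using assms(2)
  proof (induction arbitrary: x rule: generate_topology_on.induct)
    case (Int a b)
    from Int.prems have "x \<in> a" "x \<in> b" by auto
    from Int.IH(1)[OF this(1)] obtain F where F: "F \<in> homog_polys" "\<forall>v\<in>hcoords x. F v \<noteq> 0"
      "{y. \<forall>v\<in>hcoords y. F v \<noteq> 0} \<subseteq> a" by blast
    from Int.IH(2)[OF \<open>x \<in> b\<close>] obtain G where G: "G \<in> homog_polys" "\<forall>v\<in>hcoords x. G v \<noteq> 0"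
      "{y. \<forall>v\<in>hcoords y. G v \<noteq> 0} \<subseteq> b" by blast
    have "{y. \<forall>v\<in>hcoords y. F v * G v \<noteq> 0} \<subseteq> {y. \<forall>v\<in>hcoords y. F v \<noteq> 0} \<inter> {y. \<forall>v\<in>hcoords y. G v \<noteq> 0}"
      by auto
    with F G have "{y. \<forall>v\<in>hcoords y. F v * G v \<noteq> 0} \<subseteq> a \<inter> b" by blast
    moreover have "\<forall>v\<in>hcoords x. F v * G v \<noteq> 0" using F(2) G(2) by simp
    ultimately show ?case using homog_polys_mult[OF F(1) G(1)]
      by (intro bexI[of _ "\<lambda>v. F v * G v"] conjI)
  next
    case (UN K)
    then obtain k where k: "k \<in> K" "x \<in> k" by blast
    from UN.IH[OF this] obtain F where "F \<in> homog_polys" "\<forall>v\<in>hcoords x. F v \<noteq> 0"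
      "{y. \<forall>v\<in>hcoords y. F v \<noteq> 0} \<subseteq> k" by blast
    moreover from this(3) k(1) have "{y. \<forall>v\<in>hcoords y. F v \<noteq> 0} \<subseteq> \<Union> K" by (rule subset_trans[OF _ Union_upper])
    ultimately show ?case by (intro bexI[of _ F] conjI)
  next
    case (Basis s)
    then obtain F where F: "s = {x. \<forall>v\<in>hcoords x. F v \<noteq> 0}" "F \<in> homog_polys" by blast
    with Basis.prems show ?case by (intro bexI[of _ F]) auto
  qed simp
  then show thesis using that by blast
qed

lemma homog_vanishes_on_closure:
  assumes "p \<in> zariski closure_of S" "F \<in> homog_polys" "\<And>s v. s \<in> S \<Longrightarrow> v \<in> hcoords s \<Longrightarrow> F v = 0"
    "v \<in> hcoords p"
  shows "F v = 0"
proof (rule ccontr)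
  assume "F v \<noteq> 0"
  then have "p \<in> {x. \<forall>v\<in>hcoords x. F v \<noteq> 0}" using homog_nonvanishing[OF assms(2,4)] by blast
  moreover have "\<forall>T. p \<in> T \<and> openin zariski T \<longrightarrow> (\<exists>s\<in>S. s \<in> T)"
    using assms(1) unfolding in_closure_of by blast
  ultimately obtain s where s: "s \<in> S" "\<forall>v\<in>hcoords s. F v \<noteq> 0"
    using openin_zariski_nonvanishing[OF assms(2)] by (smt (verit) mem_Collect_eq)
  obtain v where "v \<in> hcoords s" using hcoords_nonempty by blast
  with s assms(3) show False by blast
qed

lemma hcoords_list_exists: "\<exists>vs. vs \<in> hcoords_list xs"
proof (induction xs)
  case (Cons x xs)
  then show ?case using hcoords_nonempty[of x] by (auto simp: hcoords_list_def list_all2_Cons2)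
qed (auto simp: hcoords_list_def)

lemma hcoords_list_nth:
  "vs \<in> hcoords_list xs \<Longrightarrow> length vs = length xs \<and> (\<forall>i<length xs. vs ! i \<in> hcoords (xs ! i))"
  by (simp add: hcoords_list_def list_all2_conv_all_nth)

lemma proj_span_combination:
  assumes p: "p \<in> proj_span (set xs)" and vs: "vs \<in> hcoords_list xs" and P: "P \<in> hcoords p"
  obtains \<tau> where "P = (\<Sum>i<length xs. \<tau> i *s vs ! i)"
proof -
  define V where "V = vec.span (set vs)"
  have "line_of x \<subseteq> V" if x: "x \<in> set xs" for x
  proof -
    obtain i where "i < length xs" "x = xs ! i" using x by (auto simp: in_set_conv_nth)
    with hcoords_list_nth[OF vs] have "vs ! i \<in> hcoords x" "vs ! i \<in> set vs" by auto
    then show ?thesis unfolding V_def line_of_eq_span[OF \<open>vs ! i \<in> hcoords x\<close>]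
      by (intro vec.span_mono) auto
  qed
  then have "vec.span (\<Union>x\<in>set xs. line_of x) \<subseteq> V"
    unfolding V_def by (intro vec.span_minimal vec.subspace_span) auto
  moreover have "P \<in> vec.span (\<Union>x\<in>set xs. line_of x)"
    using p P by (auto simp: proj_span_def hcoords_def)
  ultimately have "P \<in> vec.span (set vs)" by (auto simp: V_def)
  moreover have "vec.subspace {P. \<exists>\<tau>. P = (\<Sum>i<length xs. \<tau> i *s vs ! i)}" (is "vec.subspace ?S")
  proof (rule vec.subspaceI)
    show "0 \<in> ?S" by (auto intro!: exI[of _ "\<lambda>_. 0"])
    fix x y c assume "x \<in> ?S" "y \<in> ?S"
    then obtain \<tau> \<rho> where "x = (\<Sum>i<length xs. \<tau> i *s vs ! i)" "y = (\<Sum>i<length xs. \<rho> i *s vs ! i)" by auto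
    then have eq: "x + y = (\<Sum>i<length xs. (\<tau> i + \<rho> i) *s vs ! i)"
      "c *s x = (\<Sum>i<length xs. (c * \<tau> i) *s vs ! i)"
      by (simp_all add: vec_eq_iff sum_component sum.distrib distrib_right sum_distrib_left mult.assoc)
    show "x + y \<in> ?S" unfolding eq(1) mem_Collect_eq by (rule exI, rule refl)
    show "c *s x \<in> ?S" unfolding eq(2) mem_Collect_eq by (rule exI, rule refl)
  qed
  moreover have "set vs \<subseteq> ?S"
  proof
    fix w assume "w \<in> set vs"
    then obtain i where i: "i < length xs" "w = vs ! i"
      using hcoords_list_nth[OF vs] by (auto simp: in_set_conv_nth)
    have "(\<Sum>j<length xs. of_bool (j = i) *s vs ! j) = (\<Sum>j\<in>{i}. of_bool (j = i) *s vs ! j)"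
      using i by (intro sum.mono_neutral_right) auto
    then have "w = (\<Sum>j<length xs. of_bool (j = i) *s vs ! j)" using i by simp
    then show "w \<in> ?S" by (intro CollectI exI)
  qed
  ultimately have "P \<in> ?S" using vec.span_minimal by blast
  then show thesis using that by blast
qed

lemma combination_in_proj_span:
  assumes vs: "vs \<in> hcoords_list xs" and P: "P \<in> hcoords p" "P = (\<Sum>i<length xs. \<tau> i *s vs ! i)"
  shows "p \<in> proj_span (set xs)"
proof -
  have "P \<in> vec.span (\<Union>x\<in>set xs. line_of x)"
    unfolding P(2)
  proof (intro vec.span_sum vec.span_scale vec.span_base)
    fix i assume "i \<in> {..<length xs}"
    then show "vs ! i \<in> (\<Union>x\<in>set xs. line_of x)"
      using hcoords_list_nth[OF vs] by (auto simp: hcoords_def)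
  qed
  then show ?thesis
    unfolding proj_span_def mem_Collect_eq line_of_eq_span[OF P(1)] by (simp add: vec.span_minimal)
qed

section \<open>Values of linear forms at lists of points\<close>

text \<open>Bilinear, without conjugation, hence polynomial in the form as well as in the
  point.\<close>

definition pairing :: "complex ^ 'm \<Rightarrow> complex ^ 'm::finite \<Rightarrow> complex" where
  "pairing l x = (\<Sum>q\<in>UNIV. l $ q * x $ q)"

lemma pairing_scale: "pairing l (c *s x) = c * pairing l x"
  by (simp add: pairing_def sum_distrib_left mult_ac)

text \<open>A change of representatives costs a factor that is the same for all forms
  \<open>l\<close>. The fixed choice on the right depends only on the points and is symmetric in
  them.\<close>

lemma prod_list_pairing_representatives:
  assumes "vs \<in> hcoords_list xs"
  obtains C where "C \<noteq> 0"
    "\<And>l. prod_list (map (pairing l) vs) = C * prod_list (map (\<lambda>x. pairing l (SOME v. v \<in> hcoords x)) xs)"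
proof -
  have "\<exists>C. C \<noteq> 0 \<and> (\<forall>l. prod_list (map (pairing l) vs) =
      C * prod_list (map (\<lambda>x. pairing l (SOME v. v \<in> hcoords x)) xs))"
    using assms unfolding hcoords_list_def mem_Collect_eq
  proof (induction rule: list_all2_induct)
    case Nil
    show ?case by (rule exI[of _ 1]) simp
  next
    case (Cons v vs x xs)
    then obtain C where C: "C \<noteq> 0" "\<And>l. prod_list (map (pairing l) vs) =
        C * prod_list (map (\<lambda>x. pairing l (SOME v. v \<in> hcoords x)) xs)" by blast
    have "(SOME v. v \<in> hcoords x) \<in> hcoords x" using hcoords_nonempty by (rule someI_ex)
    from hcoords_parallel[OF this Cons.hyps(1)] obtain c where
      c: "c \<noteq> 0" "v = c *s (SOME v. v \<in> hcoords x)" .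
    have "pairing l v = c * pairing l (SOME v. v \<in> hcoords x)" for l
      by (subst c(2)) (rule pairing_scale)
    then show ?case using C c(1) by (intro exI[of _ "c * C"]) (simp add: mult_ac)
  qed
  then show thesis using that by blast
qed

text \<open>As a function of \<open>l\<close> the product is the Chow form of the multiset of
  points, which is defined up to a nonzero scalar.\<close>

lemma prod_list_pairing_mset:
  assumes "vs \<in> hcoords_list xs" "ws \<in> hcoords_list ys" "mset xs = mset ys"
  obtains C where "C \<noteq> 0" "\<And>l. prod_list (map (pairing l) ws) = C * prod_list (map (pairing l) vs)"
proof -
  obtain C where C: "C \<noteq> 0" "\<And>l. prod_list (map (pairing l) vs) =
      C * prod_list (map (\<lambda>x. pairing l (SOME v. v \<in> hcoords x)) xs)"
    using prod_list_pairing_representatives[OF assms(1)] by blast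
  obtain D where D: "D \<noteq> 0" "\<And>l. prod_list (map (pairing l) ws) =
      D * prod_list (map (\<lambda>x. pairing l (SOME v. v \<in> hcoords x)) ys)"
    using prod_list_pairing_representatives[OF assms(2)] by blast
  have "prod_list (map f xs) = prod_list (map f ys)" for f :: "'a proj \<Rightarrow> complex"
    using assms(3) by (metis mset_map prod_mset_prod_list)
  then show thesis using C D by (intro that[of "D / C"]) auto
qed

lemma prod_list_map_nth:
  "length vs = k \<Longrightarrow> prod_list (map f vs) = (\<Prod>i<k. f (vs ! i))"
  by (simp add: prod.list_conv_set_nth atLeast0LessThan)

section \<open>Closed conditions on products and symmetric products\<close>

lemma openin_multi_zariski_nonvanishing:
  "F \<in> multihomog_polys k \<Longrightarrow>
     openin (multi_zariski k) {xs. length xs = k \<and> (\<forall>vs\<in>hcoords_list xs. F vs \<noteq> 0)}"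
  unfolding multi_zariski_def by (rule topology_generated_by_Basis) blast

lemma topspace_multi_zariski: "topspace (multi_zariski k) = {xs. length xs = k}"
proof
  have "(\<lambda>_. 1) \<in> multihomog_polys k"
    unfolding multihomog_polys_def by (auto intro: polyfuns.const exI[of _ 0])
  from openin_subset[OF openin_multi_zariski_nonvanishing[OF this]]
  show "{xs. length xs = k} \<subseteq> topspace (multi_zariski k)" by simp
  show "topspace (multi_zariski k) \<subseteq> {xs. length xs = k}"
    unfolding multi_zariski_def topology_generated_by_topspace by auto
qed

lemma topspace_quotient_topology: "topspace (quotient_topology T q) = q ` topspace T"
proof
  show "topspace (quotient_topology T q) \<subseteq> q ` topspace T"
    using openin_topspace[of "quotient_topology T q"] unfolding openin_quotient_topology by blast
  have "openin (quotient_topology T q) (q ` topspace T)"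
    unfolding openin_quotient_topology
  proof
    have "{x \<in> topspace T. q x \<in> q ` topspace T} = topspace T" by auto
    then show "openin T {x \<in> topspace T. q x \<in> q ` topspace T}" by simp
  qed simp
  then show "q ` topspace T \<subseteq> topspace (quotient_topology T q)" by (rule openin_subset)
qed

lemma topspace_proj_times_Sym:
  "topspace (proj_times_Sym k W) = {(p, mset xs) | p xs. length xs = k \<and> set xs \<subseteq> W}"
proof -
  have "{xs. length xs = Suc k} \<inter> {p # xs | p xs. length xs = k \<and> set xs \<subseteq> W} =
      (\<lambda>(p, xs). p # xs) ` {(p, xs) | p xs. length xs = k \<and> set xs \<subseteq> W}"
    by (auto simp: image_iff)
  then show ?thesis
    unfolding proj_times_Sym_def topspace_quotient_topology topspace_subtopology topspace_multi_zariski
    by (simp add: image_image case_prod_unfold) (auto simp: image_iff)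
qed

text \<open>The degree is \<open>d\<close> in the ambient point, which is why \<open>F\<close> and
  \<open>G\<close> share it, and one in each of the other points.\<close>

lemma multihomog_pairing_products:
  fixes l l' :: "complex ^ 'm::finite"
  assumes F: "F \<in> polyfuns vcoords" "\<And>c v. F (c *s v) = c ^ d * F v"
    and G: "G \<in> polyfuns vcoords" "\<And>c v. G (c *s v) = c ^ d * G v"
  shows "(\<lambda>ws. F (ws ! 0) * (\<Prod>i<k. pairing l (ws ! Suc i)) - G (ws ! 0) * (\<Prod>i<k. pairing l' (ws ! Suc i)))
    \<in> multihomog_polys (Suc k)"
proof -
  let ?C = "{\<lambda>vs :: (complex ^ 'm) list. (vs ! i) $ j | i j. i < Suc k}"
  have coord: "(\<lambda>vs. (vs ! i) $ j) \<in> polyfuns ?C" if "i < Suc k" for i j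
    using that by (intro polyfuns.coord) blast
  have comp: "(\<lambda>ws. H (ws ! 0)) \<in> polyfuns ?C" if "H \<in> polyfuns vcoords" for H
    using that
  proof (rule polyfuns_compose)
    fix f :: "complex ^ 'm \<Rightarrow> complex" assume "f \<in> vcoords"
    then obtain j where f: "f = (\<lambda>v. v $ j)" by auto
    show "(\<lambda>ws. f (ws ! 0)) \<in> polyfuns ?C" unfolding f by (rule coord) simp
  qed
  have pol: "(\<lambda>ws. \<Prod>i<k. pairing l (ws ! Suc i)) \<in> polyfuns ?C" for l
    unfolding pairing_def by (intro polyfuns_intros coord) auto
  have P: "(\<Prod>i<k. pairing l (vs[Suc m := c *s (vs ! Suc m)] ! Suc i)) = c * (\<Prod>i<k. pairing l (vs ! Suc i))"
    if "m < k" "length vs = Suc k" for l m c and vs :: "(complex ^ 'm) list"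
  proof -
    have "pairing l (vs[Suc m := c *s (vs ! Suc m)] ! Suc i) = (if i = m then c else 1) * pairing l (vs ! Suc i)"
      if "i < k" for i
      using that \<open>length vs = Suc k\<close> by (simp add: nth_list_update pairing_scale)
    then have "(\<Prod>i<k. pairing l (vs[Suc m := c *s (vs ! Suc m)] ! Suc i)) =
        (\<Prod>i<k. (if i = m then c else 1) * pairing l (vs ! Suc i))" by simp
    also have "\<dots> = c * (\<Prod>i<k. pairing l (vs ! Suc i))"
      using that by (simp add: prod.distrib)
    finally show ?thesis .
  qed
  show ?thesis
    unfolding multihomog_polys_def mem_Collect_eq
  proof (intro conjI allI impI)
    show "(\<lambda>ws. F (ws ! 0) * (\<Prod>i<k. pairing l (ws ! Suc i)) -
        G (ws ! 0) * (\<Prod>i<k. pairing l' (ws ! Suc i))) \<in> polyfuns ?C"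
      by (intro polyfuns_diff polyfuns.mult comp pol F(1) G(1))
    fix i assume i: "i < Suc k"
    show "\<exists>d. \<forall>c vs. length vs = Suc k \<longrightarrow>
        F (vs[i := c *s vs ! i] ! 0) * (\<Prod>ia<k. pairing l (vs[i := c *s vs ! i] ! Suc ia)) -
        G (vs[i := c *s vs ! i] ! 0) * (\<Prod>ia<k. pairing l' (vs[i := c *s vs ! i] ! Suc ia)) =
        c ^ d * (F (vs ! 0) * (\<Prod>ia<k. pairing l (vs ! Suc ia)) - G (vs ! 0) * (\<Prod>ia<k. pairing l' (vs ! Suc ia)))"
    proof (cases i)
      case 0
      then show ?thesis
        by (intro exI[of _ d]) (auto simp: F G nth_list_update algebra_simps)
    next
      case (Suc m)
      then show ?thesis
        using i by (intro exI[of _ 1]) (auto simp: P algebra_simps)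
    qed
  qed
qed

text \<open>
  A relation of this shape, homogeneous and symmetric in the points, passes from the incidence
  variety to its closure once it is split into components homogeneous in the ambient point.
\<close>

lemma relation_on_abstract_secant_variety:
  fixes W :: "'m::finite proj set"
  assumes u: "u \<in> polyfuns vcoords" and w: "w \<in> polyfuns vcoords"
    and rel: "\<And>xs vs \<tau>. length xs = k \<Longrightarrow> set xs \<subseteq> W \<Longrightarrow> vs \<in> hcoords_list xs \<Longrightarrow>
       u (\<Sum>i<k. \<tau> i *s vs ! i) * prod_list (map (pairing l) vs) =
       w (\<Sum>i<k. \<tau> i *s vs ! i) * prod_list (map (pairing l') vs)"
    and z: "(p, mset xs) \<in> abstract_secant_variety k W" "length xs = k" "set xs \<subseteq> W"
    and P: "P \<in> hcoords p" and vs: "vs \<in> hcoords_list xs"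
  shows "u P * prod_list (map (pairing l) vs) = w P * prod_list (map (pairing l') vs)"
proof -
  obtain Gu where Gu: "\<And>v c. poly (Gu v) c = u (c *s v)" "\<And>d. (\<lambda>v. coeff (Gu v) d) \<in> homog_polys"
    "\<And>c d v. coeff (Gu (c *s v)) d = c ^ d * coeff (Gu v) d" using homogeneous_components[OF u] by blast
  obtain Gw where Gw: "\<And>v c. poly (Gw v) c = w (c *s v)" "\<And>d. (\<lambda>v. coeff (Gw v) d) \<in> homog_polys"
    "\<And>c d v. coeff (Gw (c *s v)) d = c ^ d * coeff (Gw v) d" using homogeneous_components[OF w] by blast
  define A where "A l vs = prod_list (map (pairing l) vs)" for l and vs :: "(complex ^ 'm) list"
  define \<Phi> where "\<Phi> d P vs = coeff (Gu P) d * A l vs - coeff (Gw P) d * A l' vs" for d P vs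
  \<comment> \<open>The same expression on lists of length k + 1 with the ambient point at the head,
    the form in which it defines an open set of the product.\<close>
  define \<Psi> where "\<Psi> d ws = coeff (Gu (ws ! 0)) d * (\<Prod>i<k. pairing l (ws ! Suc i)) -
      coeff (Gw (ws ! 0)) d * (\<Prod>i<k. pairing l' (ws ! Suc i))" for d ws
  have \<Psi>: "\<Psi> d (P # vs) = \<Phi> d P vs" if "length vs = k" for d P vs
    using that by (simp add: \<Psi>_def \<Phi>_def A_def prod_list_map_nth)
  have multi: "\<Psi> d \<in> multihomog_polys (Suc k)" for d
    unfolding \<Psi>_def using Gu(2,3) Gw(2,3)
    by (intro multihomog_pairing_products[of "\<lambda>v. coeff (Gu v) d" d "\<lambda>v. coeff (Gw v) d"])
      (auto simp: homog_polys_def)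
  \<comment> \<open>Scaling \<tau> shows that the relation holds at every multiple of
    \<open>P\<close>, so its components vanish degree by degree.\<close>
  have zero: "\<Phi> d P vs = 0" if inc: "length xs = k" "set xs \<subseteq> W" "p \<in> proj_span (set xs)"
    "P \<in> hcoords p" "vs \<in> hcoords_list xs" for d P vs p xs
  proof -
    obtain \<tau> where \<tau>: "P = (\<Sum>i<k. \<tau> i *s vs ! i)"
      using proj_span_combination[OF inc(3,5,4)] inc(1) by blast
    have "poly (smult (A l vs) (Gu P) - smult (A l' vs) (Gw P)) c = 0" for c
    proof -
      have "c *s P = (\<Sum>i<k. (c * \<tau> i) *s vs ! i)"
        unfolding \<tau> by (simp add: vec_eq_iff sum_component sum_distrib_left mult.assoc)
      with rel[OF inc(1,2,5), of "\<lambda>i. c * \<tau> i"] show ?thesis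
        by (simp add: Gu(1) Gw(1) A_def mult.commute)
    qed
    then have "smult (A l vs) (Gu P) - smult (A l' vs) (Gw P) = 0" using poly_all_0_iff_0 by blast
    from arg_cong[OF this, of "\<lambda>q. coeff q d"] show ?thesis by (simp add: \<Phi>_def mult.commute)
  qed
  \<comment> \<open>Nonvanishing does not depend on the representatives or on the order of the
    points, so it is a condition on the quotient.\<close>
  have nz: "\<Phi> d P' vs' \<noteq> 0" if h: "\<Phi> d P vs \<noteq> 0" "P \<in> hcoords p" "P' \<in> hcoords p" "vs \<in> hcoords_list xs"
    "vs' \<in> hcoords_list xs'" "mset xs = mset xs'" for d P P' p vs vs' xs xs'
  proof -
    obtain c where c: "c \<noteq> 0" "P' = c *s P" using hcoords_parallel[OF h(2,3)] .
    obtain C where C: "C \<noteq> 0" "\<And>l. A l vs' = C * A l vs"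
      unfolding A_def using prod_list_pairing_mset[OF h(4-6)] by blast
    have "\<Phi> d P' vs' = c ^ d * C * \<Phi> d P vs"
      by (simp add: \<Phi>_def C(2) c(2) Gu(3) Gw(3) algebra_simps)
    then show ?thesis using c C h(1) by simp
  qed
  have "\<Phi> d P vs = 0" for d
  proof (rule ccontr)
    assume nonzero: "\<Phi> d P vs \<noteq> 0"
    \<comment> \<open>If the relation failed at the given point, \<open>N\<close> would be a
      neighbourhood of it: the preimage of \<open>N\<close> among ordered lists is a basic open set.
      Then \<open>N\<close> would meet the incidence variety, contradicting
      \<open>zero\<close>.\<close>
    define N where "N = {(p, mset xs) | p xs P vs. length xs = k \<and> set xs \<subseteq> W \<and> P \<in> hcoords p \<and>
      vs \<in> hcoords_list xs \<and> \<Phi> d P vs \<noteq> 0}"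
    define T where "T = subtopology (multi_zariski (Suc k)) {p # xs | p xs. length xs = k \<and> set xs \<subseteq> W}"
    have topT: "topspace T = {p # xs | p xs. length xs = k \<and> set xs \<subseteq> W}"
      by (auto simp: T_def topspace_multi_zariski)
    have pre: "{ys \<in> topspace T. (hd ys, mset (tl ys)) \<in> N} =
        topspace T \<inter> {ys. length ys = Suc k \<and> (\<forall>ws\<in>hcoords_list ys. \<Psi> d ws \<noteq> 0)}"
    proof (rule set_eqI)
      fix ys
      have "(hd ys, mset (tl ys)) \<in> N \<longleftrightarrow> length ys = Suc k \<and> (\<forall>ws\<in>hcoords_list ys. \<Psi> d ws \<noteq> 0)"
        if ysT: "ys \<in> topspace T"
      proof -
        from ysT obtain p' xs' where ys: "ys = p' # xs'" "length xs' = k" "set xs' \<subseteq> W"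
          by (auto simp: topT)
        have ws: "ws \<in> hcoords_list ys \<longleftrightarrow> (\<exists>P' vs'. ws = P' # vs' \<and> P' \<in> hcoords p' \<and> vs' \<in> hcoords_list xs')" for ws
          unfolding ys hcoords_list_def by (auto simp: list_all2_Cons2)
        show ?thesis
        proof
          assume "(hd ys, mset (tl ys)) \<in> N"
          then obtain xs1 P1 vs1 where 1: "mset xs' = mset xs1" "P1 \<in> hcoords p'"
            "vs1 \<in> hcoords_list xs1" "\<Phi> d P1 vs1 \<noteq> 0" by (auto simp: N_def ys)
          have "\<Psi> d ws \<noteq> 0" if ws': "ws \<in> hcoords_list ys" for ws
          proof -
            obtain P' vs' where 2: "ws = P' # vs'" "P' \<in> hcoords p'" "vs' \<in> hcoords_list xs'"
              using ws' ws by blast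
            then have "\<Phi> d P' vs' \<noteq> 0" using nz[OF 1(4,2) 2(2) 1(3) 2(3)] 1(1) by simp
            then show ?thesis using \<Psi> hcoords_list_nth[OF 2(3)] ys(2) 2(1) by simp
          qed
          then show "length ys = Suc k \<and> (\<forall>ws\<in>hcoords_list ys. \<Psi> d ws \<noteq> 0)" using ys by simp
        next
          assume nv: "length ys = Suc k \<and> (\<forall>ws\<in>hcoords_list ys. \<Psi> d ws \<noteq> 0)"
          obtain P' where "P' \<in> hcoords p'" using hcoords_nonempty by blast
          moreover obtain vs' where "vs' \<in> hcoords_list xs'" using hcoords_list_exists by blast
          ultimately have "\<Psi> d (P' # vs') \<noteq> 0" using nv ws by blast
          then have "\<Phi> d P' vs' \<noteq> 0"
            using \<Psi> hcoords_list_nth[OF \<open>vs' \<in> hcoords_list xs'\<close>] ys(2) by simp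
          with \<open>P' \<in> hcoords p'\<close> \<open>vs' \<in> hcoords_list xs'\<close> ys show "(hd ys, mset (tl ys)) \<in> N"
            unfolding N_def by auto
        qed
      qed
      then show "ys \<in> {ys \<in> topspace T. (hd ys, mset (tl ys)) \<in> N} \<longleftrightarrow>
        ys \<in> topspace T \<inter> {ys. length ys = Suc k \<and> (\<forall>ws\<in>hcoords_list ys. \<Psi> d ws \<noteq> 0)}" by blast
    qed
    have "openin T (topspace T \<inter> {ys. length ys = Suc k \<and> (\<forall>ws\<in>hcoords_list ys. \<Psi> d ws \<noteq> 0)})"
      unfolding topT unfolding T_def
      by (subst Int_commute) (rule openin_subtopology_Int[OF openin_multi_zariski_nonvanishing[OF multi]])
    moreover have "N \<subseteq> (\<lambda>ys. (hd ys, mset (tl ys))) ` topspace T"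
    proof
      fix z assume "z \<in> N"
      then obtain p xs where "z = (p, mset xs)" "length xs = k" "set xs \<subseteq> W" by (auto simp: N_def)
      then show "z \<in> (\<lambda>ys. (hd ys, mset (tl ys))) ` topspace T"
        by (intro image_eqI[of _ _ "p # xs"]) (auto simp: topT)
    qed
    ultimately have "openin (proj_times_Sym k W) N"
      unfolding proj_times_Sym_def openin_quotient_topology T_def[symmetric] pre by blast
    moreover have "(p, mset xs) \<in> N" using nonzero z(2,3) P vs unfolding N_def by blast
    ultimately obtain y where y: "y \<in> N" "y \<in> {(p, mset xs) | p xs. length xs = k \<and> set xs \<subseteq> W \<and>
        p \<in> proj_span (set xs) \<and> lin_indep_pts xs}"
      using z(1) unfolding abstract_secant_variety_def in_closure_of by blast
    from y(1) obtain p1 xs1 P1 vs1 where 1: "y = (p1, mset xs1)" "length xs1 = k" "set xs1 \<subseteq> W"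
      "P1 \<in> hcoords p1" "vs1 \<in> hcoords_list xs1" "\<Phi> d P1 vs1 \<noteq> 0" by (auto simp: N_def)
    from y(2) 1(1) obtain xs2 where "mset xs1 = mset xs2" "p1 \<in> proj_span (set xs2)" by auto
    then have "p1 \<in> proj_span (set xs1)" using mset_eq_setD by metis
    from zero[OF 1(2,3) this 1(4,5)] 1(6) show False by blast
  qed
  then have "smult (A l vs) (Gu P) - smult (A l' vs) (Gw P) = 0"
    by (intro poly_eqI) (simp add: \<Phi>_def mult.commute)
  from arg_cong[OF this, of "\<lambda>q. poly q 1"] show ?thesis
    by (simp add: Gu(1) Gw(1) A_def mult.commute)
qed

section \<open>Recovering a multiset of points from the products of linear forms\<close>

lemma polyfuns_of_vec:
  assumes "f \<in> polyfuns vcoords"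
  shows "(\<lambda>t. f (\<chi> j. t j)) \<in> polyfuns coords"
  using assms by (rule polyfuns_compose) (auto intro: polyfuns_coord)

lemma nonvanishing_simultaneously_vec:
  assumes "f \<in> polyfuns vcoords" "g \<in> polyfuns vcoords" "f x \<noteq> 0" "g y \<noteq> 0"
  obtains z where "f z \<noteq> 0" "g z \<noteq> 0"
proof -
  have "f (\<chi> j. x $ j) \<noteq> 0" "g (\<chi> j. y $ j) \<noteq> 0" using assms by (simp_all add: vec_lambda_eta)
  from nonvanishing_simultaneously[OF polyfuns_of_vec[OF assms(1)] polyfuns_of_vec[OF assms(2)], OF this]
  show thesis using that by blast
qed

lemma polyfuns_pairing: "(\<lambda>l. pairing l x) \<in> polyfuns vcoords"
  unfolding pairing_def by (intro polyfuns_intros polyfuns.coord) auto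

lemma pairing_axis: "pairing (axis r 1) x = x $ r"
  by (simp add: pairing_def axis_def if_distrib[of "\<lambda>c. c * _"] cong: if_cong)

lemma pairing_prod_nonvanishing:
  fixes S :: "(complex ^ 'm::finite) set"
  assumes "finite S" "0 \<notin> S"
  obtains l where "\<And>x. x \<in> S \<Longrightarrow> pairing l x \<noteq> 0"
proof -
  have "(\<lambda>t. pairing (\<chi> j. t j) x) \<in> polyfuns coords \<and> (\<exists>t. pairing (\<chi> j. t j) x \<noteq> 0)" if "x \<in> S" for x
  proof -
    from that assms obtain r where "x $ r \<noteq> 0" by (metis vec_eq_iff zero_index)
    then have "pairing (\<chi> j. (axis r 1 :: complex ^ 'm) $ j) x \<noteq> 0" by (simp add: vec_lambda_eta pairing_axis)
    then show ?thesis using polyfuns_of_vec[OF polyfuns_pairing] by blast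
  qed
  from polyfuns_prod_nonvanishing[of S "\<lambda>x t. pairing (\<chi> j. t j) x", OF assms(1) this]
  obtain t where "(\<Prod>x\<in>S. pairing (\<chi> j. t j) x) \<noteq> 0" by blast
  with assms(1) show thesis by (intro that[of "\<chi> j. t j"]) (auto simp: prod_zero_iff)
qed

text \<open>The kernel of the linear map \<open>\<phi>\<close> is the line of \<open>Y\<close>, and
  \<open>adj\<close> is the transpose of \<open>\<phi>\<close>: pulling back a form that vanishes
  nowhere on the image of \<open>S\<close> gives one that vanishes at \<open>Y\<close> and nowhere
  on \<open>S\<close>.\<close>

lemma separating_form:
  fixes S :: "(complex ^ 'm::finite) set"
  assumes "finite S" and Y: "Y \<noteq> 0" and S: "\<And>x c. x \<in> S \<Longrightarrow> x \<noteq> c *s Y"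
  obtains l where "pairing l Y = 0" "\<And>x. x \<in> S \<Longrightarrow> pairing l x \<noteq> 0"
proof -
  obtain q where q: "Y $ q \<noteq> 0" using Y by (metis vec_eq_iff zero_index)
  define \<phi> where "\<phi> x = Y $ q *s x - x $ q *s Y" for x
  define adj where "adj m = Y $ q *s m - pairing m Y *s axis q 1" for m
  have adj: "pairing (adj m) x = pairing m (\<phi> x)" for m x
  proof -
    have "pairing (adj m) x = Y $ q * pairing m x - pairing m Y * pairing (axis q 1) x"
      by (simp add: pairing_def adj_def left_diff_distrib sum_subtractf sum_distrib_left mult.assoc)
    also have "\<dots> = pairing m (\<phi> x)"
      by (simp add: pairing_axis) (simp add: pairing_def \<phi>_def right_diff_distrib sum_subtractf
          sum_distrib_left sum_distrib_right mult_ac)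
    finally show ?thesis .
  qed
  have "0 \<notin> \<phi> ` S"
  proof
    assume "0 \<in> \<phi> ` S"
    then obtain x where x: "x \<in> S" "Y $ q *s x = x $ q *s Y" by (auto simp: \<phi>_def)
    have "x = (1 / Y $ q) *s (Y $ q *s x)" using q by (simp add: vector_smult_assoc)
    also have "\<dots> = (x $ q / Y $ q) *s Y" unfolding x(2) by (simp add: vector_smult_assoc)
    finally show False using S[OF x(1)] by blast
  qed
  then obtain m where "\<And>x. x \<in> \<phi> ` S \<Longrightarrow> pairing m x \<noteq> 0"
    using pairing_prod_nonvanishing[of "\<phi> ` S"] assms(1) by blast
  moreover have "\<phi> Y = 0" by (simp add: \<phi>_def)
  then have "pairing (adj m) Y = 0" unfolding adj by (simp add: pairing_def)
  ultimately show thesis using that[of "adj m"] by (simp add: adj)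
qed

text \<open>If a point of \<open>ys\<close> were missing from \<open>xs\<close>, a form vanishing
  there but at no point of \<open>xs\<close> would contradict \<open>eq\<close>. Distinctness of
  \<open>ys\<close> and equal length then leave no room for multiplicities in
  \<open>xs\<close>.\<close>

lemma mset_eq_from_pairings:
  fixes xs ys :: "'m::finite proj list"
  assumes vs: "vs \<in> hcoords_list xs" and ws: "ws \<in> hcoords_list ys"
    and len: "length xs = length ys" and dist: "distinct ys"
    and eq: "\<And>l. prod_list (map (pairing l) vs) = c * prod_list (map (pairing l) ws)"
  shows "mset xs = mset ys"
proof -
  have "set ys \<subseteq> set xs"
  proof (rule subsetI, rule ccontr)
    fix y assume y: "y \<in> set ys" "y \<notin> set xs"
    then obtain i where i: "i < length ys" "ys ! i = y" by (auto simp: in_set_conv_nth)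
    then have Y: "ws ! i \<in> hcoords y" "ws ! i \<in> set ws" using hcoords_list_nth[OF ws] by auto
    have "x \<noteq> a *s ws ! i" if x: "x \<in> set vs" for x a
    proof
      assume xa: "x = a *s ws ! i"
      from x obtain j where j: "j < length xs" "x = vs ! j"
        using hcoords_list_nth[OF vs] by (auto simp: in_set_conv_nth)
      then have xj: "x \<in> hcoords (xs ! j)" using hcoords_list_nth[OF vs] by simp
      then have "a \<noteq> 0" using xa hcoords_nonzero by fastforce
      then have "x \<in> hcoords y" unfolding xa using Y(1) by (intro hcoords_scale)
      with xj have "y = xs ! j" by (metis hcoords_unique)
      with y j show False by simp
    qed
    from separating_form[OF _ hcoords_nonzero[OF Y(1)] this, of "set vs"]
    obtain l where l: "pairing l (ws ! i) = 0" "\<And>x. x \<in> set vs \<Longrightarrow> pairing l x \<noteq> 0" by auto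
    have "prod_list (map (pairing l) ws) = 0"
      using l(1) Y(2) by (auto simp: prod_list_zero_iff image_iff)
    moreover have "prod_list (map (pairing l) vs) \<noteq> 0" using l(2) by (auto simp: prod_list_zero_iff)
    ultimately show False using eq by simp
  qed
  moreover have "card (set xs) \<le> card (set ys)"
    using card_length[of xs] len dist by (simp add: distinct_card)
  ultimately have set: "set xs = set ys" by (metis List.finite_set card_seteq)
  then have "distinct xs" using len dist by (metis card_distinct distinct_card)
  with set dist show ?thesis by (simp add: set_eq_iff_mset_eq_distinct)
qed

section \<open>The parametrized secant variety\<close>

lemma segre_veronese_vec_scale: "segre_veronese_vec (c *s a) v = c *s segre_veronese_vec a v"
  by (simp add: segre_veronese_vec_def vec_eq_iff mult.assoc)

lemma segre_veronese_vec_eqI: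
  fixes a a' :: "complex ^ 'l" and v v' :: "complex ^ 'n"
  assumes "\<And>b j l. a $ b * (v $ j * v $ l) = a' $ b * (v' $ j * v' $ l)"
  shows "segre_veronese_vec a v = segre_veronese_vec a' v'"
  unfolding vec_eq_iff
proof
  fix q :: "'l \<times> 'n uprod"
  obtain b j l where "q = (b, Upair j l)" by (metis prod.exhaust uprod_exhaust)
  then show "segre_veronese_vec a v $ q = segre_veronese_vec a' v' $ q" using assms by simp
qed

definition par_tensor :: "('n::finite par \<Rightarrow> complex) \<Rightarrow> complex ^ (3 \<times> 'n uprod)" where
  "par_tensor t = (\<Sum>i\<in>UNIV. segre_veronese_vec (par_a t i) (par_v t i))"

lemma polyfuns_segre_veronese_vec:
  "(\<lambda>t. segre_veronese_vec (par_a t i) (par_v t i) $ q) \<in> polyfuns coords"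
  by (simp add: segre_veronese_vec_def polyfuns.mult polyfuns_par polyfuns_uprod_mult)

lemma polyfuns_par_tensor: "(\<lambda>t. par_tensor t $ q) \<in> polyfuns coords"
  by (simp add: par_tensor_def sum_component polyfuns_sum polyfuns_segre_veronese_vec)

text \<open>The parametrized tensors form a cone, so that the homogeneous components of their
  equations are again equations.\<close>

lemma par_tensor_scale: "\<exists>u. par_tensor u = c *s par_tensor t"
proof
  show "par_tensor (mk_par (\<lambda>i. c *s par_a t i) (par_v t) 0) = c *s par_tensor t"
    by (simp add: par_tensor_def segre_veronese_vec_scale vec_eq_iff sum_component sum_distrib_left)
qed

definition general_par :: "('n::finite par \<Rightarrow> complex) \<Rightarrow> bool" where
  "general_par t \<longleftrightarrow> (\<exists>c. frame (par_v t) c) \<and> on_no_conic (par_a t) \<and> pairwise_distinct_pts (par_a t)"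

lemma par_tensor_eq_imp_same_tensor:
  assumes "par_tensor t = par_tensor u"
  shows "same_tensor (par_a t) (par_v t) (par_a u) (par_v u)"
  unfolding same_tensor_def
proof (intro allI)
  fix b j l
  have "par_tensor t $ (b, Upair j l) = par_tensor u $ (b, Upair j l)" using assms by simp
  then show "(\<Sum>i\<in>UNIV. par_a t i $ b * (par_v t i $ j * par_v t i $ l)) =
      (\<Sum>i\<in>UNIV. par_a u i $ b * (par_v u i $ j * par_v u i $ l))"
    by (simp add: par_tensor_def sum_component)
qed

abbreviation pair_coords :: "((complex ^ 'm) \<times> (complex ^ 'm) \<Rightarrow> complex) set" where
  "pair_coords \<equiv> range (\<lambda>q w. fst w $ q) \<union> range (\<lambda>q w. snd w $ q)"

lemma polyfuns_pair_fix:
  assumes "G \<in> polyfuns pair_coords"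
  shows "(\<lambda>P. G (P, l)) \<in> polyfuns vcoords" "(\<lambda>l. G (P, l)) \<in> polyfuns vcoords"
proof -
  have c: "(\<lambda>P. P $ q) \<in> polyfuns vcoords" for q :: 'a by (intro polyfuns.coord) simp
  show "(\<lambda>P. G (P, l)) \<in> polyfuns vcoords" "(\<lambda>l. G (P, l)) \<in> polyfuns vcoords"
    using assms by (rule polyfuns_compose; auto intro: c polyfuns.const)+
qed

text \<open>The linear form is itself a parameter, so one fraction B / A serves all forms at once. A
  symmetric expression such as this product is needed, since tensors determine their summands only
  up to permutation.\<close>

lemma product_of_values_rational:
  assumes n: "CARD('n::finite) \<ge> 5"
  obtains A B :: "(complex ^ (3 \<times> 'n::finite uprod)) \<times> (complex ^ (3 \<times> 'n uprod)) \<Rightarrow> complex" and t where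
    "A \<in> polyfuns pair_coords" "B \<in> polyfuns pair_coords" "A (par_tensor t, par_l t) \<noteq> 0"
    "\<And>t. A (par_tensor t, par_l t) *
       (\<Prod>i\<in>UNIV. pairing (par_l t) (segre_veronese_vec (par_a t i) (par_v t i))) = B (par_tensor t, par_l t)"
proof -
  obtain h :: "('n par \<Rightarrow> complex) \<Rightarrow> complex" and t0 where h: "h \<in> polyfuns coords" "h t0 \<noteq> 0"
    "\<And>t. h t \<noteq> 0 \<Longrightarrow> general_par t"
    using general_parameters[OF n] unfolding general_par_def by metis
  define f :: "('n par \<Rightarrow> complex) \<Rightarrow> complex" where
    "f t = (\<Prod>i\<in>UNIV. pairing (par_l t) (segre_veronese_vec (par_a t i) (par_v t i)))" for t
  have f: "f \<in> polyfuns coords"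
    unfolding f_def pairing_def by (intro polyfuns_intros polyfuns_par polyfuns_segre_veronese_vec)
  have \<Phi>: "(\<lambda>t. c (par_tensor t, par_l t)) \<in> polyfuns coords" if "c \<in> pair_coords"
    for c :: "(complex ^ (3 \<times> 'n uprod)) \<times> (complex ^ (3 \<times> 'n uprod)) \<Rightarrow> complex"
    using that by (auto simp: polyfuns_par_tensor polyfuns_par)
  have const: "f t = f u" if eq: "\<And>c. c \<in> pair_coords \<Longrightarrow> c (par_tensor t, par_l t) = c (par_tensor u, par_l u)"
    and ht: "h t \<noteq> 0" and hu: "h u \<noteq> 0" for t u
  proof -
    have P: "par_tensor t = par_tensor u" unfolding vec_eq_iff
    proof
      fix q show "par_tensor t $ q = par_tensor u $ q" using eq[of "\<lambda>w. fst w $ q"] by simp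
    qed
    have l: "par_l t = par_l u" unfolding vec_eq_iff
    proof
      fix q show "par_l t $ q = par_l u $ q" using eq[of "\<lambda>w. snd w $ q"] by simp
    qed
    obtain c c' where fr: "frame (par_v t) c" "frame (par_v u) c'"
      using h(3)[OF ht] h(3)[OF hu] unfolding general_par_def by blast
    have card: "CARD('n option) \<ge> 3" using n by (simp add: card_UNIV_option)
    obtain \<pi> where \<pi>: "bij \<pi>" "\<And>i b j l. par_a u i $ b * (par_v u i $ j * par_v u i $ l) =
        par_a t (\<pi> i) $ b * (par_v t (\<pi> i) $ j * par_v t (\<pi> i) $ l)"
      using decomposition_unique[OF card fr(1) _ _ fr(2) _ _ par_tensor_eq_imp_same_tensor[OF P]]
        h(3)[OF ht] h(3)[OF hu] unfolding general_par_def by blast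
    have "segre_veronese_vec (par_a u i) (par_v u i) = segre_veronese_vec (par_a t (\<pi> i)) (par_v t (\<pi> i))" for i
      by (rule segre_veronese_vec_eqI) (rule \<pi>(2))
    then have "f u = (\<Prod>i\<in>UNIV. pairing (par_l t) (segre_veronese_vec (par_a t (\<pi> i)) (par_v t (\<pi> i))))"
      by (simp add: f_def l)
    also have "\<dots> = f t"
      unfolding f_def by (rule prod.reindex_bij_betw[OF \<pi>(1)])
    finally show ?thesis by simp
  qed
  show thesis
  proof (rule constant_on_fibres_imp_fraction[where C = pair_coords and
        \<Phi> = "\<lambda>t. (par_tensor t, par_l t)" and h = h and ?t0.0 = t0 and f = f, OF \<Phi> h(1,2) f const])
    fix A B t1
    assume "A \<in> polyfuns pair_coords" "B \<in> polyfuns pair_coords" "A (par_tensor t1, par_l t1) \<noteq> 0"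
      "\<And>t. A (par_tensor t, par_l t) * f t = B (par_tensor t, par_l t)"
    then show thesis by (intro that[of A B t1]) (simp_all add: f_def)
  qed
qed

lemma segre_veronese_representative:
  assumes "x \<in> segre_veronese" "u \<in> hcoords x"
  obtains a v where "u = segre_veronese_vec a v"
proof -
  from assms(1) obtain a v where av: "segre_veronese_vec a v \<in> hcoords x" by (auto simp: segre_veronese_def)
  obtain c where "u = c *s segre_veronese_vec a v" using hcoords_parallel[OF av assms(2)] by blast
  then have "u = segre_veronese_vec (c *s a) v" by (simp add: segre_veronese_vec_scale)
  then show thesis by (rule that)
qed

text \<open>The coefficients \<tau>_i are absorbed into the first factors, so every combination is a
  parametrized tensor, also for dependent points or vanishing coefficients. \<open>T\<close> is the
  product of the \<tau>_i.\<close>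

lemma parameters_of_points:
  fixes xs :: "(3 \<times> 'n::finite uprod) proj list"
  assumes len: "length xs = CARD('n) + 1" and X: "set xs \<subseteq> segre_veronese" and vs: "vs \<in> hcoords_list xs"
  obtains a :: "'n option \<Rightarrow> complex ^ 3" and v :: "'n option \<Rightarrow> complex ^ 'n" and T where
    "\<And>l. par_tensor (mk_par a v l) = (\<Sum>i<CARD('n) + 1. \<tau> i *s vs ! i)"
    "\<And>l. (\<Prod>i\<in>UNIV. pairing l (segre_veronese_vec (a i) (v i))) = T * prod_list (map (pairing l) vs)"
proof -
  let ?k = "CARD('n) + 1"
  have "card (UNIV :: 'n option set) = card {..<?k}" by (simp add: card_UNIV_option)
  then obtain e :: "'n option \<Rightarrow> nat" where e: "bij_betw e UNIV {..<?k}"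
    using bij_betw_iff_card[of "UNIV :: 'n option set" "{..<?k}"] by auto
  have "\<exists>a v. vs ! e i = segre_veronese_vec a v" for i
  proof -
    have "e i < length xs" using e len by (auto simp: bij_betw_def)
    then have "xs ! e i \<in> segre_veronese" "vs ! e i \<in> hcoords (xs ! e i)"
      using X hcoords_list_nth[OF vs] by (auto simp: subset_iff)
    then show ?thesis by (metis segre_veronese_representative)
  qed
  then obtain a v where av: "\<And>i. vs ! e i = segre_veronese_vec (a i) (v i)" by metis
  show thesis
  proof (rule that[of "\<lambda>i. \<tau> (e i) *s a i" v "\<Prod>i\<in>UNIV. \<tau> (e i)"])
    fix l
    have "(\<Sum>i\<in>UNIV. \<tau> (e i) *s vs ! e i) = (\<Sum>i<?k. \<tau> i *s vs ! i)"
      by (rule sum.reindex_bij_betw[OF e])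
    then show "par_tensor (mk_par (\<lambda>i. \<tau> (e i) *s a i) v l) = (\<Sum>i<?k. \<tau> i *s vs ! i)"
      by (simp add: par_tensor_def segre_veronese_vec_scale av)
    have "(\<Prod>i\<in>UNIV. pairing l (vs ! e i)) = (\<Prod>i<?k. pairing l (vs ! i))"
      by (rule prod.reindex_bij_betw[OF e])
    also have "\<dots> = prod_list (map (pairing l) vs)"
      using hcoords_list_nth[OF vs] len by (intro prod_list_map_nth[symmetric]) simp
    finally show "(\<Prod>i\<in>UNIV. pairing l (segre_veronese_vec (\<tau> (e i) *s a i) (v i))) =
        (\<Prod>i\<in>UNIV. \<tau> (e i)) * prod_list (map (pairing l) vs)"
      by (simp add: segre_veronese_vec_scale pairing_scale prod.distrib av)
  qed
qed

lemma general_par_nonzero: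
  fixes t :: "'n::finite par \<Rightarrow> complex"
  assumes "general_par t"
  shows "par_a t i \<noteq> 0"
  using assms by (intro pairwise_distinct_pts_nonzero) (auto simp: general_par_def card_UNIV_option)

lemma general_summands_independent:
  fixes t :: "'n::finite par \<Rightarrow> complex"
  assumes n: "CARD('n) \<ge> 5" and t: "general_par t"
    and r: "(\<Sum>i\<in>UNIV. r i *s segre_veronese_vec (par_a t i) (par_v t i)) = 0"
  shows "r i = 0"
proof -
  obtain c where c: "frame (par_v t) c" using t by (auto simp: general_par_def)
  have card: "CARD('n option) \<ge> 3" using n by (simp add: card_UNIV_option)
  have "r i * par_a t i $ b = 0" for b
  proof (rule frame_squares_independent[OF c card, where r = "\<lambda>i. r i * par_a t i $ b"])
    fix j l
    have "(\<Sum>i\<in>UNIV. r i *s segre_veronese_vec (par_a t i) (par_v t i)) $ (b, Upair j l) = 0"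
      using r by simp
    then show "(\<Sum>i\<in>UNIV. r i * par_a t i $ b * (par_v t i $ j * par_v t i $ l)) = 0"
      by (simp add: sum_component mult.assoc)
  qed
  moreover obtain b where "par_a t i $ b \<noteq> 0"
    using general_par_nonzero[OF t, of i] by (metis vec_eq_iff zero_index)
  ultimately show ?thesis by (metis mult_eq_0_iff)
qed

text \<open>Translates parameters into lists of points. All coefficients of the combination are 1,
  so the product of values of a form needs no correction factor.\<close>

lemma general_secant_point:
  fixes t :: "'n::finite par \<Rightarrow> complex"
  assumes n: "CARD('n) \<ge> 5" and t: "general_par t"
  obtains p ys ws where "par_tensor t \<in> hcoords p" "length ys = CARD('n) + 1" "set ys \<subseteq> segre_veronese"
    "ws \<in> hcoords_list ys" "distinct ys" "lin_indep_pts ys" "p \<in> proj_span (set ys)"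
    "\<And>l. prod_list (map (pairing l) ws) = (\<Prod>i\<in>UNIV. pairing l (segre_veronese_vec (par_a t i) (par_v t i)))"
proof -
  let ?k = "CARD('n) + 1"
  define Y where "Y i = segre_veronese_vec (par_a t i) (par_v t i)" for i
  have indep: "r i = 0" if "(\<Sum>i\<in>UNIV. r i *s Y i) = 0" for r i
    using general_summands_independent[OF n t] that unfolding Y_def by blast
  have Ynz: "Y i \<noteq> 0" for i
  proof
    assume "Y i = 0"
    then have "(\<Sum>j\<in>UNIV. of_bool (j = i) *s Y j) = 0"
      by (intro sum.neutral) auto
    from indep[of "\<lambda>j. of_bool (j = i)" i] this show False by simp
  qed
  have Ypar: "i = j" if "Y i = c *s Y j" for i j c
  proof (rule ccontr)
    assume ij: "i \<noteq> j"
    define r where "r m = (if m = i then 1 else if m = j then - c else 0)" for m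
    have "(\<Sum>m\<in>UNIV. r m *s Y m) = (\<Sum>m\<in>{i, j}. r m *s Y m)"
      by (rule sum.mono_neutral_right) (auto simp: r_def)
    also have "\<dots> = 0" using ij that by (simp add: r_def)
    finally have "r i = 0" by (rule indep)
    then show False by (simp add: r_def)
  qed
  have "\<exists>x. Y i \<in> hcoords x" for i using point_exists[OF Ynz] by blast
  then obtain y where y: "\<And>i. Y i \<in> hcoords (y i)" by metis
  have yinj: "inj y"
  proof (rule injI)
    fix i j assume "y i = y j"
    then have "Y i \<in> hcoords (y j)" using y by metis
    from hcoords_parallel[OF y[of j] this] Ypar show "i = j" by metis
  qed
  have "card (UNIV :: 'n option set) = card {..<?k}" by (simp add: card_UNIV_option)
  then obtain e :: "nat \<Rightarrow> 'n option" where e: "bij_betw e {..<?k} UNIV"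
    using bij_betw_iff_card[of "{..<?k}" "UNIV :: 'n option set"] by auto
  then have einj: "inj_on e {..<?k}" and esurj: "e ` {..<?k} = UNIV" by (auto simp: bij_betw_def)
  define ys where "ys = map (\<lambda>j. y (e j)) [0..<?k]"
  define ws where "ws = map (\<lambda>j. Y (e j)) [0..<?k]"
  have len: "length ys = ?k" by (simp add: ys_def)
  have wsy: "ws \<in> hcoords_list ys"
    by (simp add: hcoords_list_def ws_def ys_def list_all2_conv_all_nth y del: upt_Suc)
  have dist: "distinct ys"
    unfolding ys_def distinct_map using einj yinj
    by (auto simp: inj_on_def inj_def atLeast0LessThan simp del: upt_Suc)
  have setws: "set ws = range Y"
    unfolding ws_def set_map set_upt atLeast0LessThan esurj[symmetric] by (simp add: image_image)
  have Yinj: "inj Y"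
  proof (rule injI)
    fix i j assume "Y i = Y j"
    then have "Y i = 1 *s Y j" by simp
    then show "i = j" by (rule Ypar)
  qed
  have distws: "distinct ws"
    unfolding ws_def distinct_map using einj Yinj
    by (auto simp: inj_on_def inj_def atLeast0LessThan simp del: upt_Suc)
  have "vec.independent (set ws)"
  proof
    assume "vec.dependent (set ws)"
    then obtain u where u: "\<exists>v\<in>set ws. u v \<noteq> 0" "(\<Sum>v\<in>set ws. u v *s v) = 0"
      using vec.dependent_finite[of "set ws"] by auto
    then have "(\<Sum>i\<in>UNIV. u (Y i) *s Y i) = 0"
      unfolding setws by (simp add: sum.reindex[OF Yinj])
    from indep[OF this] u(1) show False unfolding setws by auto
  qed
  with distws wsy have li: "lin_indep_pts ys" unfolding lin_indep_pts_def by blast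
  have sum: "par_tensor t = (\<Sum>j<length ys. 1 *s ws ! j)"
  proof -
    have "(\<Sum>j<length ys. 1 *s ws ! j) = (\<Sum>j<?k. Y (e j))"
      by (rule sum.cong) (auto simp: ws_def len simp del: upt_Suc)
    also have "\<dots> = (\<Sum>i\<in>UNIV. Y i)" by (rule sum.reindex_bij_betw[OF e])
    finally show ?thesis by (simp add: par_tensor_def Y_def)
  qed
  have "par_tensor t \<noteq> 0"
  proof
    assume "par_tensor t = 0"
    then have "(\<Sum>i\<in>UNIV. 1 *s Y i) = 0" by (simp add: par_tensor_def Y_def)
    from indep[OF this] show False by simp
  qed
  then obtain p where p: "par_tensor t \<in> hcoords p" using point_exists by blast
  have yX: "y i \<in> segre_veronese" for i
  proof -
    have "par_v t i \<noteq> 0"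
    proof
      assume "par_v t i = 0"
      then have "Y i = segre_veronese_vec 0 0"
        unfolding Y_def by (intro segre_veronese_vec_eqI) simp
      then show False using Ynz[of i] by (simp add: segre_veronese_vec_def vec_eq_iff)
    qed
    then show ?thesis
      using general_par_nonzero[OF t, of i] y[of i] unfolding segre_veronese_def Y_def by blast
  qed
  show thesis
  proof (rule that[OF p len _ wsy dist li])
    show "set ys \<subseteq> segre_veronese" using yX by (auto simp: ys_def)
    show "p \<in> proj_span (set ys)" by (rule combination_in_proj_span[OF wsy p sum])
    fix l
    have "prod_list (map (pairing l) ws) = (\<Prod>j<?k. pairing l (ws ! j))"
      by (rule prod_list_map_nth) (simp add: ws_def)
    also have "\<dots> = (\<Prod>j<?k. pairing l (Y (e j)))"
      by (rule prod.cong) (auto simp: ws_def simp del: upt_Suc)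
    also have "\<dots> = (\<Prod>i\<in>UNIV. pairing l (Y i))" by (rule prod.reindex_bij_betw[OF e])
    finally show "prod_list (map (pairing l) ws) =
        (\<Prod>i\<in>UNIV. pairing l (segre_veronese_vec (par_a t i) (par_v t i)))" by (simp add: Y_def)
  qed
qed

section \<open>The general fibre of the abstract secant variety\<close>

lemma secant_point_parameters:
  fixes xs :: "(3 \<times> 'n::finite uprod) proj list"
  assumes "length xs = CARD('n) + 1" "set xs \<subseteq> segre_veronese" "p \<in> proj_span (set xs)" "P \<in> hcoords p"
  obtains t where "par_tensor t = P"
proof -
  obtain vs where vs: "vs \<in> hcoords_list xs" using hcoords_list_exists by blast
  obtain \<tau> where "P = (\<Sum>i<length xs. \<tau> i *s vs ! i)"
    using proj_span_combination[OF assms(3) vs assms(4)] by blast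
  then have P: "P = (\<Sum>i<CARD('n) + 1. \<tau> i *s vs ! i)" by (simp only: assms(1))
  obtain a v where "par_tensor (mk_par a v 0) = (\<Sum>i<CARD('n) + 1. \<tau> i *s vs ! i)"
    using parameters_of_points[OF assms(1,2) vs, of \<tau>] by metis
  then show thesis using P by (intro that) simp
qed

lemma secant_variety_vanishing:
  fixes p :: "(3 \<times> 'n::finite uprod) proj"
  assumes "p \<in> secant_variety (CARD('n) + 1) segre_veronese" "F \<in> homog_polys"
    "\<And>t. F (par_tensor t) = 0" "v \<in> hcoords p"
  shows "F v = 0"
  using assms(1) unfolding secant_variety_def
proof (rule homog_vanishes_on_closure[OF _ assms(2) _ assms(4)])
  fix s :: "(3 \<times> 'n uprod) proj" and w
  assume "s \<in> (\<Union>xs\<in>{xs. length xs = CARD('n) + 1 \<and> set xs \<subseteq> segre_veronese}. proj_span (set xs))"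
    and w: "w \<in> hcoords s"
  then obtain xs where "length xs = CARD('n) + 1" "set xs \<subseteq> segre_veronese" "s \<in> proj_span (set xs)" by blast
  from secant_point_parameters[OF this w] show "F w = 0" using assms(3) by metis
qed

lemma polyfuns_of_par_tensor:
  assumes "F \<in> polyfuns vcoords"
  shows "(\<lambda>t. F (par_tensor t)) \<in> polyfuns coords"
  using assms by (rule polyfuns_compose) (auto intro: polyfuns_par_tensor)

text \<open>In effect the irreducibility of the secant variety: the open set, \<open>H\<close> and
  generality of the parameters all pull back to nonzero polynomials on one affine space, which have
  a common point of nonvanishing.\<close>

lemma general_point_in_open_set:
  fixes O' :: "(3 \<times> 'n::finite uprod) proj set"
  assumes n: "CARD('n) \<ge> 5" and O': "openin zariski O'" "y \<in> O'"
    "y \<in> secant_variety (CARD('n) + 1) segre_veronese"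
    and H: "H \<in> homog_polys" "H (par_tensor t1) \<noteq> 0"
  obtains p where "p \<in> O'" "p \<in> secant_variety (CARD('n) + 1) segre_veronese" "\<forall>v\<in>hcoords p. H v \<noteq> 0"
proof -
  define S where "S = (\<Union>xs\<in>{xs. length xs = CARD('n) + 1 \<and> set xs \<subseteq> (segre_veronese :: (3 \<times> 'n uprod) proj set)}.
      proj_span (set xs))"
  have S: "secant_variety (CARD('n) + 1) segre_veronese = zariski closure_of S"
    by (simp add: secant_variety_def S_def)
  obtain s where s: "s \<in> S" "s \<in> O'" using O' unfolding S in_closure_of by blast
  obtain F where F: "F \<in> homog_polys" "\<forall>v\<in>hcoords s. F v \<noteq> 0" "{y. \<forall>v\<in>hcoords y. F v \<noteq> 0} \<subseteq> O'"
    using zariski_basis[OF O'(1) s(2)] by blast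
  obtain P where P: "P \<in> hcoords s" using hcoords_nonempty by blast
  obtain xs where "length xs = CARD('n) + 1" "set xs \<subseteq> segre_veronese" "s \<in> proj_span (set xs)"
    using s(1) unfolding S_def by blast
  from secant_point_parameters[OF this P] obtain t0 where t0: "par_tensor t0 = P" .
  obtain h :: "('n par \<Rightarrow> complex) \<Rightarrow> complex" and th where h: "h \<in> polyfuns coords" "h th \<noteq> 0"
    "\<And>t. h t \<noteq> 0 \<Longrightarrow> general_par t"
    using general_parameters[OF n] unfolding general_par_def by metis
  have FH: "F \<in> polyfuns vcoords" "H \<in> polyfuns vcoords" using F H by (auto simp: homog_polys_def)
  have "F (par_tensor t0) \<noteq> 0" using F(2) P t0 by simp
  from nonvanishing_simultaneously[OF polyfuns_of_par_tensor[OF FH(1)] polyfuns_of_par_tensor[OF FH(2)], OF this H(2)]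
  obtain t2 where t2: "F (par_tensor t2) \<noteq> 0" "H (par_tensor t2) \<noteq> 0" by blast
  have "(\<lambda>t. F (par_tensor t) * H (par_tensor t)) \<in> polyfuns coords"
    by (intro polyfuns.mult polyfuns_of_par_tensor FH)
  from nonvanishing_simultaneously[OF this h(1), of t2 th] t2 h(2)
  obtain t where t: "F (par_tensor t) \<noteq> 0" "H (par_tensor t) \<noteq> 0" "h t \<noteq> 0" by auto
  obtain p ys where p: "par_tensor t \<in> hcoords p" "length ys = CARD('n) + 1" "set ys \<subseteq> segre_veronese"
    "p \<in> proj_span (set ys)" using general_secant_point[OF n h(3)[OF t(3)]] by metis
  have "p \<in> S" unfolding S_def using p by blast
  then have "p \<in> zariski closure_of S" using closure_of_subset[of S zariski] by auto
  moreover have "p \<in> O'" using F(3) homog_nonvanishing[OF F(1) p(1) t(1)] by blast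
  moreover have "\<forall>v\<in>hcoords p. H v \<noteq> 0" using homog_nonvanishing[OF H(1) p(1) t(2)] by blast
  ultimately show thesis using that S by simp
qed

text \<open>An arbitrary point of the fibre and the known decomposition are compared through their
  Chow forms, the functions \<alpha> and \<beta> of the linear form, which turn out to be
  proportional.\<close>

lemma general_fibre_is_point:
  fixes A B :: "(complex ^ (3 \<times> 'n::finite uprod)) \<times> (complex ^ (3 \<times> 'n uprod)) \<Rightarrow> complex"
  assumes n: "CARD('n) \<ge> 5"
    and A: "A \<in> polyfuns pair_coords" and B: "B \<in> polyfuns pair_coords"
    and AB: "\<And>t. A (par_tensor t, par_l t) *
       (\<Prod>i\<in>UNIV. pairing (par_l t) (segre_veronese_vec (par_a t i) (par_v t i))) = B (par_tensor t, par_l t)"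
    and t: "general_par t" "A (par_tensor t, l0) \<noteq> 0" "par_tensor t \<in> hcoords p"
  obtains z where "z \<in> topspace (proj_times_Sym (CARD('n) + 1) segre_veronese)"
    "secant_fiber (CARD('n) + 1) segre_veronese p = {z}"
proof -
  let ?k = "CARD('n) + 1"
  define X :: "(3 \<times> 'n uprod) proj set" where "X = segre_veronese"
  define P where "P = par_tensor t"
  obtain p' ys ws where ys: "par_tensor t \<in> hcoords p'" "length ys = ?k" "set ys \<subseteq> segre_veronese"
    "ws \<in> hcoords_list ys" "distinct ys" "lin_indep_pts ys" "p' \<in> proj_span (set ys)"
    "\<And>l. prod_list (map (pairing l) ws) = (\<Prod>i\<in>UNIV. pairing l (segre_veronese_vec (par_a t i) (par_v t i)))"
    by (rule general_secant_point[OF n t(1)]) (rule that)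
  have p': "p' = p" using hcoords_unique[OF ys(1) t(3)] .
  have top: "(p, mset ys) \<in> topspace (proj_times_Sym ?k X)"
    unfolding topspace_proj_times_Sym X_def using ys by blast
  define Inc where "Inc = {(p, mset xs) | p xs. length xs = ?k \<and> set xs \<subseteq> X \<and> p \<in> proj_span (set xs) \<and> lin_indep_pts xs}"
  have "Inc \<subseteq> topspace (proj_times_Sym ?k X)"
    unfolding topspace_proj_times_Sym Inc_def by blast
  then have "Inc \<subseteq> abstract_secant_variety ?k X"
    unfolding abstract_secant_variety_def Inc_def[symmetric] by (rule closure_of_subset)
  moreover have "(p, mset ys) \<in> Inc" unfolding Inc_def X_def using ys p' by blast
  ultimately have mem: "(p, mset ys) \<in> abstract_secant_variety ?k X" by blast
  have unique: "ms = mset ys" if z: "(p, ms) \<in> abstract_secant_variety ?k X" for ms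
  proof -
    have "(p, ms) \<in> topspace (proj_times_Sym ?k X)"
      using z unfolding abstract_secant_variety_def by (rule subsetD[OF closure_of_subset_topspace])
    then obtain xs where xs: "ms = mset xs" "length xs = ?k" "set xs \<subseteq> X"
      unfolding topspace_proj_times_Sym by blast
    obtain vs where vs: "vs \<in> hcoords_list xs" using hcoords_list_exists by blast
    define \<alpha> where "\<alpha> l = prod_list (map (pairing l) vs)" for l
    define \<beta> where "\<beta> l = prod_list (map (pairing l) ws)" for l
    \<comment> \<open>On the incidence variety B / A is T times the product of values, with an
      unknown T. Two forms l and l' eliminate T, and cross-multiplication leaves a relation of the
      kind that passes to the closure.\<close>
    have relAB: "A (P, l) * B (P, l') * \<alpha> l = B (P, l) * A (P, l') * \<alpha> l'" for l l'
      unfolding \<alpha>_def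
    proof (rule relation_on_abstract_secant_variety[where u = "\<lambda>P. A (P, l) * B (P, l')" and
          w = "\<lambda>P. B (P, l) * A (P, l')" and k = ?k and W = X, OF _ _ _ z[unfolded xs(1)] xs(2,3) _ vs])
      show "(\<lambda>P. A (P, l) * B (P, l')) \<in> polyfuns vcoords" "(\<lambda>P. B (P, l) * A (P, l')) \<in> polyfuns vcoords"
        by (intro polyfuns.mult polyfuns_pair_fix A B)+
      show "P \<in> hcoords p" using t(3) by (simp add: P_def)
      fix us :: "(3 \<times> 'n uprod) proj list" and zs \<tau>
      assume us: "length us = ?k" "set us \<subseteq> X" "zs \<in> hcoords_list us"
      define Q where "Q = (\<Sum>i<?k. \<tau> i *s zs ! i)"
      obtain a v T where par: "\<And>l. par_tensor (mk_par a v l) = Q"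
        "\<And>l. (\<Prod>i\<in>UNIV. pairing l (segre_veronese_vec (a i) (v i))) = T * prod_list (map (pairing l) zs)"
        by (rule parameters_of_points[OF us(1) us(2)[unfolded X_def] us(3), of \<tau>, folded Q_def])
          (rule that)
      have BQ: "B (Q, l) = A (Q, l) * (T * prod_list (map (pairing l) zs))" for l
        using AB[of "mk_par a v l"] by (simp add: par)
      show "A (Q, l) * B (Q, l') * prod_list (map (pairing l) zs) =
          B (Q, l) * A (Q, l') * prod_list (map (pairing l') zs)"
        unfolding BQ by (simp add: mult_ac)
    qed
    \<comment> \<open>For the known decomposition the factor T is 1.\<close>
    have BP: "B (P, l) = A (P, l) * \<beta> l" for l
      using AB[of "mk_par (par_a t) (par_v t) l"] by (simp add: par_tensor_def P_def \<beta>_def ys(8))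
    have rel: "A (P, l) * A (P, l') * (\<alpha> l * \<beta> l' - \<beta> l * \<alpha> l') = 0" for l l'
      using relAB[of l l'] unfolding BP by algebra
    have pA: "(\<lambda>l. A (P, l)) \<in> polyfuns vcoords" by (rule polyfuns_pair_fix(2)[OF A])
    have pprod: "(\<lambda>l. prod_list (map (pairing l) us)) \<in> polyfuns vcoords" for us :: "(complex ^ (3 \<times> 'n uprod)) list"
      unfolding prod_list_map_nth[OF refl] by (intro polyfuns_prod polyfuns_pairing)
    have p\<alpha>: "\<alpha> \<in> polyfuns vcoords" and p\<beta>: "\<beta> \<in> polyfuns vcoords"
      unfolding \<alpha>_def \<beta>_def by (rule pprod)+
    have "0 \<notin> set ws"
    proof
      assume "0 \<in> set ws"
      then obtain i where "i < length ys" "ws ! i = 0"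
        using hcoords_list_nth[OF ys(4)] by (auto simp: in_set_conv_nth)
      then show False using hcoords_list_nth[OF ys(4)] hcoords_nonzero by metis
    qed
    then obtain l1 where "\<And>x. x \<in> set ws \<Longrightarrow> pairing l1 x \<noteq> 0"
      using pairing_prod_nonvanishing[of "set ws"] by auto
    then have "\<beta> l1 \<noteq> 0" by (auto simp: \<beta>_def prod_list_zero_iff)
    moreover have A0: "A (P, l0) \<noteq> 0" using t(2) by (simp add: P_def)
    ultimately obtain l' where l': "A (P, l') \<noteq> 0" "\<beta> l' \<noteq> 0"
      using nonvanishing_simultaneously_vec[OF pA p\<beta>, of l0 l1] by blast
    \<comment> \<open>By \<open>rel\<close> this holds wherever A(P, l) is nonzero; being polynomial
      in \<open>l\<close>, it then holds for every \<open>l\<close>.\<close>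
    have "\<alpha> l * \<beta> l' - \<beta> l * \<alpha> l' = 0" for l
    proof (rule ccontr)
      assume "\<alpha> l * \<beta> l' - \<beta> l * \<alpha> l' \<noteq> 0"
      moreover have "(\<lambda>l. \<alpha> l * \<beta> l' - \<beta> l * \<alpha> l') \<in> polyfuns vcoords"
        by (intro polyfuns_intros p\<alpha> p\<beta>)
      ultimately obtain l2 where "A (P, l2) \<noteq> 0" "\<alpha> l2 * \<beta> l' - \<beta> l2 * \<alpha> l' \<noteq> 0"
        using nonvanishing_simultaneously_vec[OF pA, of _ l0 l] A0 by blast
      then show False using rel[of l2 l'] l'(1) by simp
    qed
    then have quot: "\<alpha> l = \<alpha> l' / \<beta> l' * \<beta> l" for l
      using l'(2) by (simp add: field_simps)
    define \<kappa> where "\<kappa> = \<alpha> l' / \<beta> l'"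
    have lin: "\<alpha> l = \<kappa> * \<beta> l" for l unfolding \<kappa>_def by (rule quot)
    have "mset xs = mset ys"
      by (rule mset_eq_from_pairings[OF vs ys(4) _ ys(5) lin[unfolded \<alpha>_def \<beta>_def]])
        (simp only: ys(2) xs(2))
    then show ?thesis using xs(1) by simp
  qed
  have "secant_fiber ?k X p = {(p, mset ys)}"
  proof (rule set_eqI)
    fix z :: "(3 \<times> 'n uprod) proj \<times> (3 \<times> 'n uprod) proj multiset"
    obtain q ms where z: "z = (q, ms)" by (cases z)
    show "z \<in> secant_fiber ?k X p \<longleftrightarrow> z \<in> {(p, mset ys)}"
      unfolding z secant_fiber_def using unique[of ms] mem by (simp only: mem_Collect_eq fst_conv) blast
  qed
  with top show thesis unfolding X_def by (rule that)
qed

text \<open>The function \<open>g\<close> ensures general parameters over a point of the secant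
  variety, and A(P, l0) that the fraction is usable there. Their product need not be homogeneous, so
  one of its components becomes \<open>H\<close>.\<close>

lemma general_secant_fibre:
  assumes n: "CARD('n::finite) \<ge> 5"
  obtains H :: "complex ^ (3 \<times> 'n::finite uprod) \<Rightarrow> complex" and t1 where "H \<in> homog_polys" "H (par_tensor t1) \<noteq> 0"
    "\<And>p v. p \<in> secant_variety (CARD('n) + 1) segre_veronese \<Longrightarrow> v \<in> hcoords p \<Longrightarrow> H v \<noteq> 0 \<Longrightarrow>
       \<exists>z\<in>topspace (proj_times_Sym (CARD('n) + 1) segre_veronese).
         secant_fiber (CARD('n) + 1) segre_veronese p = {z}"
proof -
  obtain A B :: "(complex ^ (3 \<times> 'n uprod)) \<times> (complex ^ (3 \<times> 'n uprod)) \<Rightarrow> complex" and t1 where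
    AB: "A \<in> polyfuns pair_coords" "B \<in> polyfuns pair_coords" "A (par_tensor t1, par_l t1) \<noteq> 0"
    "\<And>t. A (par_tensor t, par_l t) *
       (\<Prod>i\<in>UNIV. pairing (par_l t) (segre_veronese_vec (par_a t i) (par_v t i))) = B (par_tensor t, par_l t)"
    using product_of_values_rational[OF n] by blast
  define l0 where "l0 = par_l t1"
  obtain h :: "('n par \<Rightarrow> complex) \<Rightarrow> complex" and th where h: "h \<in> polyfuns coords" "h th \<noteq> 0"
    "\<And>t. h t \<noteq> 0 \<Longrightarrow> general_par t"
    using general_parameters[OF n] unfolding general_par_def by metis
  have coords: "(\<lambda>t. f (par_tensor t)) \<in> polyfuns coords" if "f \<in> vcoords"
    for f :: "complex ^ (3 \<times> 'n uprod) \<Rightarrow> complex"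
    using polyfuns_of_par_tensor[OF polyfuns.coord[OF that]] .
  obtain g t2 where g: "g \<in> polyfuns vcoords" "g (par_tensor t2) \<noteq> 0"
    "\<And>w. (\<And>G. G \<in> polyfuns vcoords \<Longrightarrow> (\<And>t. G (par_tensor t) = 0) \<Longrightarrow> G w = 0) \<Longrightarrow> g w \<noteq> 0 \<Longrightarrow>
       \<exists>t. h t \<noteq> 0 \<and> (\<forall>f\<in>vcoords. f (par_tensor t) = f w)"
  proof (rule general_point_of_closure_in_image[where C = vcoords and \<Phi> = par_tensor, OF coords h(1,2)])
  qed (auto intro: that)
  define F where "F P = g P * A (P, l0)" for P
  have F: "F \<in> polyfuns vcoords"
    unfolding F_def by (intro polyfuns.mult g polyfuns_pair_fix AB)
  obtain t3 where t3: "F (par_tensor t3) \<noteq> 0"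
    using nonvanishing_simultaneously[OF polyfuns_of_par_tensor[OF g(1)]
        polyfuns_of_par_tensor[OF polyfuns_pair_fix(1)[OF AB(1), of l0]], of t2 t1] g(2) AB(3)
    by (auto simp: F_def l0_def)
  obtain G where G: "\<And>v c. poly (G v) c = F (c *s v)" "\<And>d. (\<lambda>v. coeff (G v) d) \<in> homog_polys"
    "\<And>c d v. coeff (G (c *s v)) d = c ^ d * coeff (G v) d" using homogeneous_components[OF F] by blast
  have "poly (G (par_tensor t3)) 1 \<noteq> 0" using t3 by (simp add: G(1))
  then have "G (par_tensor t3) \<noteq> 0" by auto
  then obtain d where d: "coeff (G (par_tensor t3)) d \<noteq> 0" by (meson leading_coeff_0_iff)
  show thesis
  proof (rule that[of "\<lambda>v. coeff (G v) d" t3])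
    fix p v assume p: "p \<in> secant_variety (CARD('n) + 1) segre_veronese" "v \<in> hcoords p" "coeff (G v) d \<noteq> 0"
    then have "G v \<noteq> 0" by auto
    \<comment> \<open>\<open>F\<close> may vanish at \<open>v\<close>, but a nonzero component makes
      it nonzero at some nonzero multiple, which represents the same point.\<close>
    then obtain c where c: "poly (G v) c \<noteq> 0" "c \<notin> {0}" using exists_nonroot[of "G v" "{0}"] by blast
    define P where "P = c *s v"
    have P: "P \<in> hcoords p" unfolding P_def using c p(2) by (intro hcoords_scale) auto
    have FP: "F P \<noteq> 0" using c by (simp add: P_def G(1))
    have "\<exists>t. h t \<noteq> 0 \<and> (\<forall>f\<in>vcoords. f (par_tensor t) = f P)"
    proof (rule g(3))
      show "g P \<noteq> 0" using FP by (simp add: F_def)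
      fix K :: "complex ^ (3 \<times> 'n uprod) \<Rightarrow> complex"
      assume K: "K \<in> polyfuns vcoords" "\<And>t. K (par_tensor t) = 0"
      obtain L where L: "\<And>v c. poly (L v) c = K (c *s v)" "\<And>d. (\<lambda>v. coeff (L v) d) \<in> homog_polys"
        "\<And>c d v. coeff (L (c *s v)) d = c ^ d * coeff (L v) d"
        using homogeneous_components[OF K(1)] by blast
      \<comment> \<open>As the tensors form a cone, each component of \<open>K\<close> vanishes on
        them, and homogeneous equations extend to the closure.\<close>
      have "poly (L (par_tensor t)) c = 0" for t c
        using par_tensor_scale[of c t] K(2) by (metis L(1))
      then have L0: "L (par_tensor t) = 0" for t using poly_all_0_iff_0 by blast
      have "coeff (L P) e = 0" for e
        by (rule secant_variety_vanishing[OF p(1) L(2) _ P]) (simp add: L0)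
      then have "L P = 0" by (intro poly_eqI) simp
      then show "K P = 0" using L(1)[of P 1] by simp
    qed
    then obtain t where t: "h t \<noteq> 0" "\<forall>f\<in>vcoords. f (par_tensor t) = f P" by (elim exE conjE)
    have tP: "par_tensor t = P" unfolding vec_eq_iff
    proof
      fix q show "par_tensor t $ q = P $ q" using bspec[OF t(2), of "\<lambda>v. v $ q"] by simp
    qed
    have "A (par_tensor t, l0) \<noteq> 0" using FP by (simp add: F_def tP)
    moreover have "par_tensor t \<in> hcoords p" using P by (simp add: tP)
    ultimately show "\<exists>z\<in>topspace (proj_times_Sym (CARD('n) + 1) segre_veronese).
         secant_fiber (CARD('n) + 1) segre_veronese p = {z}"
      using general_fibre_is_point[OF n AB(1,2,4) h(3)[OF t(1)]] by metis
  qed (use G(2) d in auto)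
qed

lemma irreducible_components_singleton:
  assumes "z \<in> topspace T"
  shows "irreducible_components (subtopology T {z}) = {{z}}"
proof -
  have top: "topspace (subtopology T {z}) = {z}" using assms by auto
  have irr: "irreducible_in (subtopology T {z}) Z \<longleftrightarrow> Z = {z}" for Z
  proof
    assume "irreducible_in (subtopology T {z}) Z"
    then have "Z \<subseteq> {z}" "topspace (subtopology (subtopology T {z}) Z) \<noteq> {}"
      by (auto simp: irreducible_in_def irreducible_top_def)
    then show "Z = {z}" by auto
  next
    assume Z: "Z = {z}"
    have "topspace (subtopology (subtopology T {z}) Z) = {z}" using assms Z by auto
    then show "irreducible_in (subtopology T {z}) Z"
      unfolding irreducible_in_def irreducible_top_def top using Z by auto
  qed
  then show ?thesis unfolding irreducible_components_def irr by auto
qed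

theorem secant_order_eq_1:
  assumes n: "CARD('n::finite) \<ge> 5"
  shows "secant_order (CARD('n) + 1) (segre_veronese :: (3 \<times> 'n::finite uprod) proj set) = 1"
proof -
  let ?k = "CARD('n) + 1"
  define X :: "(3 \<times> 'n uprod) proj set" where "X = segre_veronese"
  define T where "T = subtopology zariski (secant_variety ?k X)"
  define Cs where "Cs p = irreducible_components (subtopology (proj_times_Sym ?k X) (secant_fiber ?k X p))" for p
  obtain H :: "complex ^ (3 \<times> 'n uprod) \<Rightarrow> complex" and t1 where H: "H \<in> homog_polys" "H (par_tensor t1) \<noteq> 0"
    "\<And>p v. p \<in> secant_variety ?k X \<Longrightarrow> v \<in> hcoords p \<Longrightarrow> H v \<noteq> 0 \<Longrightarrow>
       \<exists>z\<in>topspace (proj_times_Sym ?k X). secant_fiber ?k X p = {z}"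
    using general_secant_fibre[OF n] unfolding X_def by blast
  define U where "U = {p. \<forall>v\<in>hcoords p. H v \<noteq> 0} \<inter> secant_variety ?k X"
  have topT: "topspace T = secant_variety ?k X" by (simp add: T_def)
  have U: "openin T U"
    unfolding U_def T_def by (rule openin_subtopology_Int[OF openin_zariski_nonvanishing[OF H(1)]])
  have meets: "O' \<inter> U \<noteq> {}" if O': "openin T O'" "O' \<noteq> {}" for O'
  proof -
    obtain O1 where O1: "openin zariski O1" "O' = O1 \<inter> secant_variety ?k X"
      using O'(1) by (auto simp: T_def openin_subtopology)
    then obtain y where y: "y \<in> O1" "y \<in> secant_variety ?k X" using O'(2) by blast
    obtain p where "p \<in> O1" "p \<in> secant_variety ?k X" "\<forall>v\<in>hcoords p. H v \<noteq> 0"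
      unfolding X_def by (rule general_point_in_open_set[OF n O1(1) y[unfolded X_def] H(1,2)])
    then have "p \<in> O' \<inter> U" unfolding O1(2) U_def by simp
    then show ?thesis by blast
  qed
  have ne: "topspace T \<noteq> {}"
  proof -
    obtain h :: "('n par \<Rightarrow> complex) \<Rightarrow> complex" and th where h: "h \<in> polyfuns coords" "h th \<noteq> 0"
      "\<And>t. h t \<noteq> 0 \<Longrightarrow> general_par t"
      using general_parameters[OF n] unfolding general_par_def by metis
    obtain p ys where p: "length ys = ?k" "set ys \<subseteq> X" "p \<in> proj_span (set ys)"
      unfolding X_def using general_secant_point[OF n h(3)[OF h(2)]] by metis
    then have "p \<in> (\<Union>xs\<in>{xs. length xs = ?k \<and> set xs \<subseteq> X}. proj_span (set xs))" by blast
    then have "p \<in> secant_variety ?k X"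
      unfolding secant_variety_def by (rule subsetD[OF closure_of_subset, rotated]) simp
    then show ?thesis using topT by blast
  qed
  have Une: "U \<noteq> {}" using meets[of "topspace T"] ne by auto
  have dense: "T closure_of U = topspace T"
    unfolding dense_intersects_open using meets by blast
  have one: "finite (Cs p) \<and> card (Cs p) = 1" if p: "p \<in> U" for p
  proof -
    obtain v where "v \<in> hcoords p" using hcoords_nonempty by blast
    then obtain z where "z \<in> topspace (proj_times_Sym ?k X)" "secant_fiber ?k X p = {z}"
      using H(3)[of p v] p unfolding U_def by blast
    then have "Cs p = {{z}}" unfolding Cs_def using irreducible_components_singleton by metis
    then show ?thesis by simp
  qed
  have "secant_order ?k X = (THE d. generally T (\<lambda>p. finite (Cs p) \<and> card (Cs p) = d))"
    by (simp add: secant_order_def T_def Cs_def Let_def)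
  also have "\<dots> = 1"
  proof (rule the_equality)
    show "generally T (\<lambda>p. finite (Cs p) \<and> card (Cs p) = 1)"
      unfolding generally_def using U Une dense one by blast
    \<comment> \<open>Any nonempty open set meets \<open>U\<close>, so no other number can be the
      general one.\<close>
    fix d assume "generally T (\<lambda>p. finite (Cs p) \<and> card (Cs p) = d)"
    then obtain V where V: "openin T V" "V \<noteq> {}" "\<forall>p\<in>V. finite (Cs p) \<and> card (Cs p) = d"
      unfolding generally_def by blast
    then obtain p where "p \<in> V" "p \<in> U" using meets[OF V(1,2)] by blast
    then show "d = 1" using V(3) one by metis
  qed
  finally show ?thesis by (simp add: X_def)
qed

theorem theorem6p12:
  fixes X :: "(3 \<times> 'n::finite uprod) proj set"
  assumes "CARD('n) \<ge> 5"
    and "X = segre_veronese"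
    and "\<not> weakly_defective (CARD('n) + 1) X"
  shows "secant_order (CARD('n) + 1) X = 1"
  using secant_order_eq_1[OF assms(1)] assms(2) by simp

end
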